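(* Let $A$ be a permutation group contained in a direct sum $B$ of regular permutation groups. If $A$ is (up to permutation isomorphism) different from $K_4$, $C_3$, $C_4$, $C_5$, and from every direct sum $C_i\oplus D$ with $i\in\{3,4,5\}$ and $D$ a permutation group, then $A\in BGR(2)$. Otherwise, either $A\notin BGR(k)$ for every $k\ge 2$, or $A=K_4\in BGR(3)$.
   Context: Permutation groups are considered up to permutation isomorphism. A group $G\le S_n$ acts on $\{0,1\}^n$ by $x^\sigma=(x_{\sigma(1)},\ldots,x_{\sigma(n)})$. For $k\ge 2$, a $k$-valued boolean function is a map $f:\{0,1\}^n\to\{0,1,\ldots,k-1\}$, with symmetry group $S(f)=\{\sigma\in S_n: f(x^\sigma)=f(x)\text{ for all }x\}$. $BGR(k)$ is the class of permutation groups equal to $S(f)$ for some $k$-valued boolean function $f$. A permutation group is regular if it is transitive and the point stabilizer is trivial. $C_i\le S_i$ is the group generated by the cycle $(1,2,\ldots,i)$. $K_4\le S_4$ is the group $\{1,(1,2)(3,4),(1,3)(2,4),(1,4)(2,3)\}$. The direct sum $G\oplus H$ of $G\le S_m$ and $H\le S_n$ is the group of permutations of $\{1,\ldots,m+n\}$ acting as an element of $G$ on $\{1,\ldots,m\}$ and independently as an element of $H$ (shifted by $m$) on $\{m+1,\ldots,m+n\}$; sums of more summands are defined iteratively. *)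

theory Defs
  imports "HOL-Algebra.Sym_Groups"
begin

text \<open>
  A permutation group is a pair of its degree \<open>n\<close> and its set of elements, permutations of
  \<open>{1..n}\<close>. The degree has to be recorded because permutations are total functions on
  \<^typ>\<open>nat\<close> that fix everything outside \<open>{1..n}\<close>.
\<close>

type_synonym perm_grp = "nat \<times> (nat \<Rightarrow> nat) set"

definition perm_group :: "perm_grp \<Rightarrow> bool" where
  "perm_group G \<longleftrightarrow> fst G \<ge> 1 \<and> subgroup (snd G) (sym_group (fst G))"

definition contained_in :: "perm_grp \<Rightarrow> perm_grp \<Rightarrow> bool" where
  "contained_in G H \<longleftrightarrow> fst G = fst H \<and> snd G \<subseteq> snd H"

text \<open>A bijection between the domains \<open>{1..n}\<close> of two groups is an element of \<open>S\<^sub>n\<close>, so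
  permutation isomorphism is conjugacy in \<open>S\<^sub>n\<close>.\<close>

definition perm_iso :: "perm_grp \<Rightarrow> perm_grp \<Rightarrow> bool" where
  "perm_iso G H \<longleftrightarrow> fst G = fst H \<and>
     (\<exists>\<pi>. \<pi> permutes {1..fst G} \<and> snd H = (\<lambda>\<sigma>. \<pi> \<circ> \<sigma> \<circ> inv' \<pi>) ` snd G)"

definition transitive :: "perm_grp \<Rightarrow> bool" where
  "transitive G \<longleftrightarrow> (\<forall>i\<in>{1..fst G}. \<forall>j\<in>{1..fst G}. \<exists>\<sigma>\<in>snd G. \<sigma> i = j)"

definition regular :: "perm_grp \<Rightarrow> bool" where
  "regular G \<longleftrightarrow> perm_group G \<and> transitive G \<and>
     (\<forall>i\<in>{1..fst G}. {\<sigma> \<in> snd G. \<sigma> i = i} = {id})"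

definition direct_sum :: "perm_grp \<Rightarrow> perm_grp \<Rightarrow> perm_grp" where
  "direct_sum G H =
     (fst G + fst H,
      {\<lambda>i. if i \<le> fst G then \<sigma> i else \<tau> (i - fst G) + fst G | \<sigma> \<tau>. \<sigma> \<in> snd G \<and> \<tau> \<in> snd H})"

inductive sum_of_regular :: "perm_grp \<Rightarrow> bool" where
  single: "regular G \<Longrightarrow> sum_of_regular G"
| add: "sum_of_regular G \<Longrightarrow> regular H \<Longrightarrow> sum_of_regular (direct_sum G H)"

definition cyclic_perm_group :: "nat \<Rightarrow> perm_grp" where
  "cyclic_perm_group i = (i, generate (sym_group i) {cycle_of_list [1..<Suc i]})"

definition K4 :: perm_grp where
  "K4 = (4, {id, transpose 1 2 \<circ> transpose 3 4, transpose 1 3 \<circ> transpose 2 4,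
             transpose 1 4 \<circ> transpose 2 3})"

definition cube :: "nat \<Rightarrow> (nat \<Rightarrow> nat) set" where
  "cube n = ({1..n} \<rightarrow>\<^sub>E {0, 1})"

definition act :: "(nat \<Rightarrow> nat) \<Rightarrow> (nat \<Rightarrow> nat) \<Rightarrow> (nat \<Rightarrow> nat)" where
  "act x \<sigma> = x \<circ> \<sigma>"

text \<open>The values of \<open>f\<close> outside \<open>cube n\<close> are irrelevant.\<close>

definition symmetry_group :: "nat \<Rightarrow> ((nat \<Rightarrow> nat) \<Rightarrow> nat) \<Rightarrow> perm_grp" where
  "symmetry_group n f = (n, {\<sigma>. \<sigma> permutes {1..n} \<and> (\<forall>x\<in>cube n. f (act x \<sigma>) = f x)})"

text \<open>This class is closed under \<^const>\<open>perm_iso\<close>, since the variables of \<open>f\<close> can be renamed.\<close>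

definition BGR :: "nat \<Rightarrow> perm_grp set" where
  "BGR k = {symmetry_group n f | n f. n \<ge> 1 \<and> f \<in> cube n \<rightarrow> {0..<k}}"

definition exceptional :: "perm_grp \<Rightarrow> bool" where
  "exceptional A \<longleftrightarrow> perm_iso A K4 \<or>
     (\<exists>i\<in>{3, 4, 5}. perm_iso A (cyclic_perm_group i) \<or>
        (\<exists>D. perm_group D \<and> perm_iso A (direct_sum (cyclic_perm_group i) D)))"

end

theory Submission
  imports Defs "HOL-Algebra.Multiplicative_Group"
begin

text \<open>
  Boolean functions are families of subsets of \<open>{1..n}\<close>. A subgroup of a sum of regular groups is
  exactly a group whose point stabilizers are normal: it acts regularly on each of its orbits.
  On an orbit with at least 6 points, subsets of different sizes can be used independently, and
  a few of them suffice to recover right multiplication by generators, hence the regular group.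
  Stacking the orbits into a chain of blocks makes every block recognizable by size, so these
  families coexist; one transversal-like set \<open>S\<close> and its images then tie the actions on the
  orbits together. On an orbit with group \<open>C\<^sub>3\<close>, \<open>C\<^sub>4\<close>, \<open>C\<^sub>5\<close> or \<open>K\<^sub>4\<close> there may remain one extra
  symmetry fixing \<open>S\<close>. It is excluded by a variant of \<open>S\<close> with one point fewer, unless the group
  contains a full cycle of that orbit fixing all other points, which makes \<open>C\<^sub>i\<close> a direct summand.
  Conversely, on at most 5 points a reflection maps each subset to a rotated copy of it, so no
  function can tell \<open>C\<^sub>i\<close> from the dihedral group.
\<close>

section \<open>Rigid families of subsets of a finite group\<close>

text \<open>The obstacle is that a single family of subsets has to carry all encodings at once, so
  most of the work consists in keeping them apart, preferably by size. Pairs of two kinds collide,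
  hence one kind is replaced by its complements; a rigid subgroup must have at least 5 elements to
  be distinguishable from the four-element sets used to enlarge it. The exclusion of the extra
  symmetry runs as follows. Composing with a group element makes \<phi> keep \<open>S\<close>.
  Applied to the variant that has \<open>S'\<close> in place of \<open>S\<close> on one orbit
  \<open>B\<close>, it then acts on this set as some group element \<open>c\<close> does. On every
  other orbit \<open>c\<close> keeps \<open>S\<close> and is therefore trivial, so \<open>c\<close>
  moves points of \<open>B\<close> only. Either \<phi> was trivial on \<open>B\<close> already, or
  \<open>c\<close> is a full cycle of \<open>B\<close> and splits off a cyclic summand. This also
  explains why \<open>K4\<close> is exceptional only alone, while cyclic groups are exceptional with
  any further summand: a Klein orbit never yields such a \<open>c\<close>. Alone on its four points,
  however, its extra sets cannot be told from the sets of the chain; one fixed point is enough to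
  separate them.\<close>

no_notation subset_mset (infix \<open><#\<close> 50)

context group
begin

definition translates_onto :: "('a \<Rightarrow> 'a) \<Rightarrow> 'a set \<Rightarrow> 'a set set \<Rightarrow> bool" where
  "translates_onto \<phi> K \<D> \<longleftrightarrow> bij_betw \<phi> K K \<and>
     (\<forall>k\<in>K. \<forall>Z\<in>\<D>. \<exists>k'\<in>K. \<exists>Z'\<in>\<D>. \<phi> ` (k <# Z) = k' <# Z')"

definition right_commuting :: "('a \<Rightarrow> 'a) \<Rightarrow> 'a set \<Rightarrow> 'a set \<Rightarrow> bool" where
  "right_commuting \<phi> K S \<longleftrightarrow> (\<forall>g\<in>K. \<forall>x\<in>S. \<phi> (g \<otimes> x) = \<phi> g \<otimes> x)"

text \<open>
  A map that commutes with all right multiplications is a left translation. So \<open>rigid_on K \<D>\<close>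
  means that the translates of members of \<open>\<D>\<close> are respected by left translations only.
\<close>

definition rigid_on :: "'a set \<Rightarrow> 'a set set \<Rightarrow> bool" where
  "rigid_on K \<D> \<longleftrightarrow> \<D> \<noteq> {} \<and> (\<forall>Z\<in>\<D>. Z \<noteq> {} \<and> Z \<subset> K) \<and>
     (\<forall>\<phi>. translates_onto \<phi> K \<D> \<longrightarrow> right_commuting \<phi> K K)"

section \<open>Left translates and the maps that respect them\<close>

lemma l_coset_image: "g <# Z = (\<lambda>z. g \<otimes> z) ` Z"
  by (auto simp: l_coset_def)

lemma card_l_coset: "Z \<subseteq> carrier G \<Longrightarrow> g \<in> carrier G \<Longrightarrow> card (g <# Z) = card Z"
  unfolding l_coset_image by (intro card_image inj_onI) (auto simp: subset_iff)

lemma l_coset_eq_cancel: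
  assumes "g <# Z = h <# Z'" "g \<in> carrier G" "h \<in> carrier G" "Z \<subseteq> carrier G" "Z' \<subseteq> carrier G"
  shows "(inv h \<otimes> g) <# Z = Z'"
proof -
  have "(inv h \<otimes> g) <# Z = inv h <# (h <# Z')" using assms by (simp flip: assms(1) add: lcos_m_assoc)
  also have "\<dots> = (inv h \<otimes> h) <# Z'" using assms by (intro lcos_m_assoc) auto
  finally show ?thesis using assms by (simp add: lcos_mult_one)
qed

lemma subgroup_l_coset_subset:
  "subgroup K G \<Longrightarrow> g \<in> K \<Longrightarrow> Z \<subseteq> K \<Longrightarrow> g <# Z \<subseteq> K"
  by (auto simp: l_coset_image subset_iff intro: subgroup.m_closed)

lemma l_coset_Diff:
  assumes K: "subgroup K G" and g: "g \<in> K" and Y: "Y \<subseteq> K"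
  shows "g <# (K - Y) = K - (g <# Y)"
proof -
  have sub: "K \<subseteq> carrier G" using K subgroup.subset by blast
  have "bij_betw (\<lambda>z. g \<otimes> z) K K"
  proof (rule bij_betw_byWitness[where f'="\<lambda>z. inv g \<otimes> z"])
    show "(\<lambda>z. g \<otimes> z) ` K \<subseteq> K" using K g by (auto intro: subgroup.m_closed)
    show "(\<lambda>z. inv g \<otimes> z) ` K \<subseteq> K"
      using K g by (auto intro: subgroup.m_closed subgroup.m_inv_closed)
  qed (use sub g in \<open>auto simp: subset_iff m_assoc[symmetric]\<close>)
  then show ?thesis unfolding l_coset_image
    using Y by (simp add: bij_betw_def inj_on_image_set_diff[of _ K])
qed

text \<open>Two kinds of pairs in one family could be mistaken for each other. Passing to
  complements for one kind changes its size and, by this lemma, loses no information.\<close>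

lemma translates_onto_Diff:
  assumes t: "bij_betw \<phi> K K" and K: "subgroup K G" and g: "g \<in> K" "g' \<in> K"
    and Y: "Y \<subseteq> K" "Y' \<subseteq> K"
    and e: "\<phi> ` (g <# (K - Y)) = g' <# (K - Y')"
  shows "\<phi> ` (g <# Y) = g' <# Y'"
proof -
  have s: "g <# Y \<subseteq> K" "g' <# Y' \<subseteq> K" using subgroup_l_coset_subset K g Y by auto
  have "\<phi> ` (K - (g <# Y)) = K - \<phi> ` (g <# Y)"
    using t s(1) by (simp add: bij_betw_def inj_on_image_set_diff[of _ K])
  then have "K - \<phi> ` (g <# Y) = K - (g' <# Y')"
    using e l_coset_Diff[OF K g(1) Y(1)] l_coset_Diff[OF K g(2) Y(2)] by simp
  moreover have "\<phi> ` (g <# Y) \<subseteq> K" using t s by (auto simp: bij_betw_def)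
  ultimately show ?thesis using s by blast
qed

text \<open>Since \<phi> preserves sizes, a member that is alone with its size can only go to a
  translate of itself.\<close>

lemma translates_onto_unique_card:
  assumes "translates_onto \<phi> K \<D>" "subgroup K G" "g \<in> K" "Z \<in> \<D>" "\<forall>Y\<in>\<D>. Y \<subseteq> K"
    and u: "\<And>Y. Y \<in> \<D> \<Longrightarrow> card Y = card Z \<Longrightarrow> Y = Z"
  obtains g' where "g' \<in> K" "\<phi> ` (g <# Z) = g' <# Z"
proof -
  obtain g' Z' where *: "g' \<in> K" "Z' \<in> \<D>" "\<phi> ` (g <# Z) = g' <# Z'"
    using assms(1,3,4) unfolding translates_onto_def by metis
  have sub: "K \<subseteq> carrier G" using assms(2) subgroup.subset by blast
  have "g <# Z \<subseteq> K" using assms subgroup_l_coset_subset by auto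
  then have "inj_on \<phi> (g <# Z)"
    using assms(1) by (auto simp: translates_onto_def bij_betw_def inj_on_subset)
  then have "card (g' <# Z') = card (g <# Z)" using *(3) by (metis card_image)
  moreover have "card (g' <# Z') = card Z'" "card (g <# Z) = card Z"
    using * assms(3-5) sub card_l_coset by (meson subset_iff subset_trans)+
  ultimately have "Z' = Z" using u * by simp
  then show thesis using * that by blast
qed

text \<open>Commutation passes to products, and to \<open>inv h\<close> by evaluating at
  \<open>g \<otimes> inv h\<close>. So a family only has to encode right multiplication by
  generators.\<close>

lemma right_commuting_generate:
  assumes sg: "subgroup K G" and SK: "S \<subseteq> K" and m: "\<phi> \<in> K \<rightarrow> K"
    and S: "right_commuting \<phi> K S"
  shows "right_commuting \<phi> K (generate G S)"
proof -
  have K: "generate G S \<subseteq> K" using generate_subgroup_incl[OF SK sg] .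
  note c = subgroup.mem_carrier[OF sg]
  have "\<forall>g\<in>K. \<phi> (g \<otimes> h) = \<phi> g \<otimes> h" if "h \<in> generate G S" for h
    using that
  proof induction
    case one
    then show ?case using c m by (auto simp: Pi_iff)
  next
    case (incl h)
    then show ?case using S by (auto simp: right_commuting_def)
  next
    case (inv h)
    show ?case
    proof
      fix g assume g: "g \<in> K"
      have h: "h \<in> K" using inv SK by auto
      then have gh: "g \<otimes> inv h \<in> K" using g sg by (simp add: subgroup.m_closed subgroup.m_inv_closed)
      have "\<phi> (g \<otimes> inv h \<otimes> h) = \<phi> (g \<otimes> inv h) \<otimes> h"
        using S gh inv by (auto simp: right_commuting_def)
      moreover have "g \<otimes> inv h \<otimes> h = g" using g h c by (simp add: m_assoc)
      ultimately show "\<phi> (g \<otimes> inv h) = \<phi> g \<otimes> inv h"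
        using g h gh m c by (simp add: Pi_iff m_assoc)
    qed
  next
    case (eng h1 h2)
    have h: "h1 \<in> K" "h2 \<in> K" using eng K by auto
    show ?case
    proof
      fix g assume g: "g \<in> K"
      have "\<phi> (g \<otimes> h1 \<otimes> h2) = \<phi> (g \<otimes> h1) \<otimes> h2"
        using eng h g sg by (simp add: subgroup.m_closed)
      also have "\<dots> = \<phi> g \<otimes> h1 \<otimes> h2" using eng g by simp
      finally show "\<phi> (g \<otimes> (h1 \<otimes> h2)) = \<phi> g \<otimes> (h1 \<otimes> h2)"
        using g h c m by (auto simp: m_assoc Pi_iff)
    qed
  qed
  then show ?thesis by (auto simp: right_commuting_def)
qed

text \<open>A nontrivial \<open>c\<close> would send \<one> to \<open>a\<close> or to
  \<open>b\<close>, and either choice forces \<open>b = a \<otimes> a\<close>. This supplies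
  three-element sets with trivial stabilizer.\<close>

lemma trivial_translation:
  assumes "a \<in> carrier G" "b \<in> carrier G" "c \<in> carrier G"
    and "a \<noteq> \<one>" "b \<noteq> \<one>" "b \<noteq> a" "b \<noteq> a \<otimes> a" and e: "c <# {\<one>, a, b} = {\<one>, a, b}"
  shows "c = \<one>"
proof -
  have e': "{c, c \<otimes> a, c \<otimes> b} = {\<one>, a, b}" using e assms by (simp add: l_coset_image)
  then have "c \<in> {\<one>, a, b}" by blast
  moreover have False if "c = a"
  proof -
    have "b = a \<or> b = a \<otimes> a \<or> b = a \<otimes> b" using e' that by blast
    then show False using assms by (auto simp: l_cancel_one)
  qed
  moreover have False if "c = b"
  proof -
    have "a \<in> {b, b \<otimes> a, b \<otimes> b}" using e' that by blast
    moreover have "a \<noteq> b \<otimes> a" using assms(1,2,5) r_cancel_one' by blast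
    ultimately have a: "a = b \<otimes> b" using assms(6) by blast
    have "\<one> \<in> {b, b \<otimes> a, b \<otimes> b}" using e' that by blast
    then have "b \<otimes> a = \<one>" using assms(4,5) a by (metis insert_iff singletonD)
    then have "a \<otimes> a = b" using assms(2) by (simp add: a m_assoc)
    then show False using assms by simp
  qed
  ultimately show ?thesis by blast
qed

text \<open>The element \<open>x\<close> is the only member of \<open>insert x W\<close> outside
  \<open>H\<close>, so the image of the translate by \<open>g\<close> consists of
  \<open>\<phi> g <# W\<close> and one point outside that coset of \<open>H\<close>. Matching it
  with \<open>g' <# insert x W\<close> gives \<open>\<phi> g <# W = g' <# W\<close>, and the trivial
  stabilizer of \<open>W\<close> gives \<open>g' = \<phi> g\<close>.\<close>

lemma right_commuting_outside:
  assumes K: "subgroup K G" and H: "subgroup H G" "H \<subseteq> K" and b: "bij_betw \<phi> K K"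
    and c: "right_commuting \<phi> K H"
    and W: "W \<subseteq> H" "card W \<ge> 2" "\<And>c. c \<in> H \<Longrightarrow> c <# W = W \<Longrightarrow> c = \<one>"
    and x: "x \<in> K" "x \<notin> H" and g: "g \<in> K" "g' \<in> K"
    and e: "\<phi> ` (g <# insert x W) = g' <# insert x W"
  shows "\<phi> (g \<otimes> x) = \<phi> g \<otimes> x"
proof -
  have cK: "\<And>x. x \<in> K \<Longrightarrow> x \<in> carrier G" using K subgroup.mem_carrier by metis
  have cH: "\<And>x. x \<in> H \<Longrightarrow> x \<in> carrier G" using H subgroup.mem_carrier by metis
  note Hm = subgroup.m_closed[OF H(1)] subgroup.m_inv_closed[OF H(1)]
  have fg: "\<phi> g \<in> K" using b g by (auto simp: bij_betw_def)
  have fgx: "\<phi> (g \<otimes> x) \<in> K"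
    using b g x K by (auto simp: bij_betw_def subgroup.m_closed)
  have 1: "\<phi> ` (g <# W) = \<phi> g <# W"
    unfolding l_coset_image image_image
    using c g W(1) by (intro image_cong) (auto simp: right_commuting_def)
  have e': "insert (\<phi> (g \<otimes> x)) (\<phi> g <# W) = insert (g' \<otimes> x) (g' <# W)"
    using e 1 by (simp add: l_coset_image)
  have n1: "\<phi> (g \<otimes> x) \<noteq> \<phi> g \<otimes> h" if h: "h \<in> H" for h
  proof
    assume a: "\<phi> (g \<otimes> x) = \<phi> g \<otimes> h"
    also have "\<dots> = \<phi> (g \<otimes> h)" using c g h by (auto simp: right_commuting_def)
    finally have "g \<otimes> x = g \<otimes> h"
      using b g x h H K by (meson bij_betw_def inj_onD subgroup.m_closed subset_iff)
    then show False using x h g cK cH by auto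
  qed
  have n2: "g' \<otimes> x \<noteq> g' \<otimes> h" if h: "h \<in> H" for h
    using x h g cK cH by auto
  \<comment> \<open>As \<open>W\<close> has two points, some point of \<open>\<phi> g <# W\<close>
    comes from \<open>g' <# W\<close>. This puts \<open>g'\<close> and \<open>\<phi> g\<close> into
    the same left coset of \<open>H\<close>.\<close>
  have "\<not> \<phi> g <# W \<subseteq> {g' \<otimes> x}"
  proof
    assume "\<phi> g <# W \<subseteq> {g' \<otimes> x}"
    then have "card (\<phi> g <# W) \<le> 1" using card_mono[of "{g' \<otimes> x}"] by fastforce
    moreover have "card (\<phi> g <# W) = card W" using card_l_coset W fg cK cH by blast
    ultimately show False using W by simp
  qed
  then obtain w w' where w: "w \<in> W" "w' \<in> W" "\<phi> g \<otimes> w = g' \<otimes> w'"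
    using e' unfolding l_coset_image by blast
  define d where "d = w \<otimes> inv w'"
  have wH: "w \<in> H" "w' \<in> H" using w W by auto
  then have d: "d \<in> H" using Hm by (simp add: d_def)
  have wc: "w \<in> carrier G" "w' \<in> carrier G" using w W cH by auto
  have gd: "g' = \<phi> g \<otimes> d"
    unfolding d_def using w(3) wc g fg cK by (metis inv_solve_right m_assoc m_closed inv_closed)
  have g'W: "g' <# W = \<phi> g <# (d <# W)"
    using gd fg cK d cH W by (subst lcos_m_assoc) (auto simp: subset_iff)
  have "\<phi> (g \<otimes> x) \<notin> g' <# W"
  proof
    assume "\<phi> (g \<otimes> x) \<in> g' <# W"
    then obtain v where "v \<in> W" "\<phi> (g \<otimes> x) = \<phi> g \<otimes> (d \<otimes> v)"
      using g'W by (auto simp: l_coset_image)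
    then show False using n1[of "d \<otimes> v"] d W Hm by auto
  qed
  then have E: "\<phi> (g \<otimes> x) = g' \<otimes> x" using e' by auto
  have "g' \<otimes> x \<notin> \<phi> g <# W"
  proof
    assume "g' \<otimes> x \<in> \<phi> g <# W"
    then obtain v where "v \<in> W" "\<phi> (g \<otimes> x) = \<phi> g \<otimes> v"
      using E by (auto simp: l_coset_image)
    then show False using n1[of v] W by auto
  qed
  then have "\<phi> g <# W = g' <# W" using e' E \<open>\<phi> (g \<otimes> x) \<notin> g' <# W\<close> by (metis insert_ident)
  then have "(inv (\<phi> g) \<otimes> g') <# W = W"
    using l_coset_eq_cancel[of g' W "\<phi> g" W] g fg cK cH W by (auto simp: subset_iff)
  moreover have "inv (\<phi> g) \<otimes> g' = d" using gd fg cK d cH by (simp add: m_assoc[symmetric])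
  ultimately have "d = \<one>" using W d by auto
  then show ?thesis using E gd fg cK by auto
qed


lemma mem_l_coset_iff:
  assumes H: "subgroup H G" and "u \<in> carrier G" "v \<in> carrier G"
  shows "v \<in> u <# H \<longleftrightarrow> inv u \<otimes> v \<in> H"
proof
  assume "v \<in> u <# H"
  then obtain h where "h \<in> H" "v = u \<otimes> h" by (auto simp: l_coset_image)
  then show "inv u \<otimes> v \<in> H"
    using assms subgroup.mem_carrier[OF H] by (simp add: m_assoc[symmetric])
next
  assume "inv u \<otimes> v \<in> H"
  moreover have "v = u \<otimes> (inv u \<otimes> v)" using assms by (simp add: m_assoc[symmetric])
  ultimately show "v \<in> u <# H" unfolding l_coset_image by blast
qed

text \<open>Left cosets are disjoint or equal, so the translate onto which \<open>g <# H\<close> is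
  mapped must be the one through \<open>\<phi> g\<close>. The second form says that \<phi> respects
  lying in a common coset.\<close>

lemma l_cosets_preserved:
  assumes K: "subgroup K G" and H: "subgroup H G" "H \<subseteq> K" and b: "bij_betw \<phi> K K"
    and p: "\<forall>g\<in>K. \<exists>g'\<in>K. \<phi> ` (g <# H) = g' <# H"
  shows "\<And>g. g \<in> K \<Longrightarrow> \<phi> ` (g <# H) = \<phi> g <# H"
    and "\<And>u v. u \<in> K \<Longrightarrow> v \<in> K \<Longrightarrow> inv (\<phi> u) \<otimes> \<phi> v \<in> H \<longleftrightarrow> inv u \<otimes> v \<in> H"
proof -
  have cK: "\<And>x. x \<in> K \<Longrightarrow> x \<in> carrier G" using K subgroup.mem_carrier by metis
  have fK: "\<And>x. x \<in> K \<Longrightarrow> \<phi> x \<in> K" using b by (auto simp: bij_betw_def)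
  show 1: "\<phi> ` (g <# H) = \<phi> g <# H" if g: "g \<in> K" for g
  proof -
    obtain g' where g': "g' \<in> K" "\<phi> ` (g <# H) = g' <# H" using p g by blast
    have "g \<in> g <# H" using mem_l_coset_iff[OF H(1)] cK[OF g] subgroup.one_closed[OF H(1)] by simp
    then have "\<phi> g \<in> g' <# H" using g' by blast
    then show ?thesis using g' l_repr_independence[OF _ cK[OF g'(1)] H(1)] by simp
  qed
  show "inv (\<phi> u) \<otimes> \<phi> v \<in> H \<longleftrightarrow> inv u \<otimes> v \<in> H" if u: "u \<in> K" and v: "v \<in> K" for u v
  proof -
    have "u <# H \<subseteq> K" using subgroup_l_coset_subset[OF K u H(2)] .
    then have "v \<in> u <# H \<longleftrightarrow> \<phi> v \<in> \<phi> ` (u <# H)"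
      using b v by (auto simp: bij_betw_def subset_iff dest: inj_onD)
    then show ?thesis using 1[OF u] mem_l_coset_iff[OF H(1)] cK fK u v by simp
  qed
qed

text \<open>Translating the coset of \<open>g\<close> and its image back to \<open>H\<close> gives a
  bijection \<psi> of \<open>H\<close>, to which the rigidity of \<open>H\<close> applies.\<close>

lemma right_commuting_on_l_coset:
  assumes fin: "finite (carrier G)" and K: "subgroup K G" and H: "subgroup H G" "H \<subseteq> K"
    and b: "bij_betw \<phi> K K"
    and p: "\<forall>g\<in>K. \<exists>g'\<in>K. \<phi> ` (g <# H) = g' <# H"
    and r: "rigid_on H \<D>"
    and t: "\<forall>g\<in>K. \<forall>Z\<in>\<D>. \<exists>g'\<in>K. \<exists>Z'\<in>\<D>. \<phi> ` (g <# Z) = g' <# Z'"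
  shows "right_commuting \<phi> K H"
  unfolding right_commuting_def
proof (intro ballI)
  fix g h assume g: "g \<in> K" and h: "h \<in> H"
  have cK: "\<And>x. x \<in> K \<Longrightarrow> x \<in> carrier G" using K subgroup.mem_carrier by metis
  have cH: "\<And>x. x \<in> H \<Longrightarrow> x \<in> carrier G" using H subgroup.mem_carrier by metis
  have fK: "\<And>x. x \<in> K \<Longrightarrow> \<phi> x \<in> K" using b by (auto simp: bij_betw_def)
  note Km = subgroup.m_closed[OF K] subgroup.m_inv_closed[OF K]
  note Hm = subgroup.m_closed[OF H(1)] subgroup.m_inv_closed[OF H(1)]
  have \<D>: "\<And>Z. Z \<in> \<D> \<Longrightarrow> Z \<subseteq> H" "\<And>Z. Z \<in> \<D> \<Longrightarrow> Z \<noteq> {}" using r by (auto simp: rigid_on_def)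
  note l = l_cosets_preserved[OF K H b p]
  define \<psi> where "\<psi> k = inv (\<phi> g) \<otimes> \<phi> (g \<otimes> k)" for k
  have \<psi>_image: "\<psi> ` Y = inv (\<phi> g) <# (\<phi> ` (g <# Y))" for Y
    by (simp add: \<psi>_def l_coset_image image_image)
  have "\<psi> ` H = (inv (\<phi> g) \<otimes> \<phi> g) <# H"
    unfolding \<psi>_image l(1)[OF g] using cK fK g cH by (intro lcos_m_assoc) auto
  also have "\<dots> = H" using cK fK g cH by (simp add: lcos_mult_one subset_iff)
  finally have "\<psi> ` H = H" .
  moreover from this have "inj_on \<psi> H"
    using fin cH by (intro eq_card_imp_inj_on) (auto intro: finite_subset[of H])
  ultimately have bij: "bij_betw \<psi> H H" by (simp add: bij_betw_def)
  have "\<exists>k'\<in>H. \<exists>Z'\<in>\<D>. \<psi> ` (k <# Z) = k' <# Z'" if k: "k \<in> H" and Z: "Z \<in> \<D>" for k Z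
  proof -
    have gk: "g \<otimes> k \<in> K" using Km(1) g k H(2) by blast
    obtain g' Z' where g': "g' \<in> K" "Z' \<in> \<D>" "\<phi> ` ((g \<otimes> k) <# Z) = g' <# Z'"
      using t[rule_format, OF gk Z] by blast
    \<comment> \<open>Hypothesis \<open>t\<close> places \<open>g'\<close> in \<open>K\<close> only.
      A point of \<open>Z'\<close> is used to see that \<open>inv (\<phi> g) \<otimes> g'\<close>
      lies in \<open>H\<close>.\<close>
    obtain z' where z': "z' \<in> Z'" "z' \<in> H" using \<D>[OF g'(2)] by blast
    have "g' \<otimes> z' \<in> \<phi> ` ((g \<otimes> k) <# Z)" using g' z' by (auto simp: l_coset_image)
    then obtain z where z: "z \<in> Z" "z \<in> H" "g' \<otimes> z' = \<phi> (g \<otimes> k \<otimes> z)"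
      using \<D>[OF Z] by (auto simp: l_coset_image)
    have "inv (\<phi> g) \<otimes> \<phi> (g \<otimes> k \<otimes> z) \<in> H \<longleftrightarrow> inv g \<otimes> (g \<otimes> k \<otimes> z) \<in> H"
      using g gk z H Km by (intro l(2)) auto
    moreover have "inv g \<otimes> (g \<otimes> k \<otimes> z) = k \<otimes> z"
      using g k z cK cH by (simp add: m_assoc[symmetric])
    ultimately have "inv (\<phi> g) \<otimes> (g' \<otimes> z') \<in> H" using k z Hm by simp
    then have "inv (\<phi> g) \<otimes> (g' \<otimes> z') \<otimes> inv z' \<in> H" using z' Hm by blast
    moreover have "inv (\<phi> g) \<otimes> (g' \<otimes> z') \<otimes> inv z' = inv (\<phi> g) \<otimes> g'"
      using g g' z' cK cH fK by (simp add: m_assoc)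
    moreover have "\<psi> ` (k <# Z) = (inv (\<phi> g) \<otimes> g') <# Z'"
    proof -
      have "g <# (k <# Z) = (g \<otimes> k) <# Z"
        using g k \<D>(1)[OF Z] cK cH by (intro lcos_m_assoc) auto
      then have "\<psi> ` (k <# Z) = inv (\<phi> g) <# (g' <# Z')" using \<psi>_image g' by simp
      also have "\<dots> = (inv (\<phi> g) \<otimes> g') <# Z'"
        using g g' \<D>(1)[OF g'(2)] cK cH fK by (intro lcos_m_assoc) auto
      finally show ?thesis .
    qed
    ultimately show ?thesis using g' by metis
  qed
  then have "translates_onto \<psi> H \<D>" using bij by (simp add: translates_onto_def)
  then have "\<psi> (\<one> \<otimes> h) = \<psi> \<one> \<otimes> h"
    using r h subgroup.one_closed[OF H(1)] unfolding rigid_on_def right_commuting_def by blast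
  then have "inv (\<phi> g) \<otimes> \<phi> (g \<otimes> h) = h"
    using g h cK cH fK by (simp add: \<psi>_def)
  moreover have "\<phi> (g \<otimes> h) \<in> carrier G" using g h H Km fK cK by auto
  ultimately show "\<phi> (g \<otimes> h) = \<phi> g \<otimes> h"
    using g h cK cH fK by (metis inv_closed inv_solve_left)
qed

lemma subgroup_generate_insert:
  assumes "subgroup K G" "x \<in> carrier G"
  shows "subgroup (generate G (insert x K)) G" "K \<subseteq> generate G (insert x K)"
    "x \<in> generate G (insert x K)" "insert x K \<subseteq> carrier G"
proof -
  show 1: "insert x K \<subseteq> carrier G" using assms subgroup.subset by blast
  show "subgroup (generate G (insert x K)) G" using generate_is_subgroup[OF 1] .
  show "K \<subseteq> generate G (insert x K)" "x \<in> generate G (insert x K)"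
    by (auto intro: generate.incl)
qed

text \<open>
  The set \<open>K\<close> itself makes the left cosets recognizable, and on each of them \<open>\<D>\<close> forces left
  translations. A set \<open>insert x W\<close> with \<open>W \<subseteq> K\<close> of size 3 and trivial stabilizer then attaches
  \<open>g \<otimes> x\<close> to \<open>g\<close>; it does not interfere with \<open>K\<close> because its size is 4.
\<close>

lemma rigid_on_extend:
  assumes fin: "finite (carrier G)" and K: "subgroup K G" "card K \<ge> 5" "rigid_on K \<D>"
    and x: "x \<in> carrier G" "x \<notin> K"
  shows "\<exists>\<D>'. rigid_on (generate G (insert x K)) \<D>'"
proof -
  define L where "L = generate G (insert x K)"
  note L = subgroup_generate_insert[OF K(1) x(1), folded L_def]
  have cL: "\<And>x. x \<in> L \<Longrightarrow> x \<in> carrier G" using L subgroup.mem_carrier by metis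
  have cK: "\<And>x. x \<in> K \<Longrightarrow> x \<in> carrier G" using K subgroup.mem_carrier by metis
  have one: "\<one> \<in> K" using K subgroup.one_closed by metis
  note Km = subgroup.m_closed[OF K(1)] subgroup.m_inv_closed[OF K(1)]
  have finL: "finite L" "finite K" using fin cL cK by (auto intro: finite_subset[of _ "carrier G"])
  have ex: "\<exists>a\<in>K. a \<notin> S" if "card S < 5" "finite S" for S
  proof (rule ccontr)
    assume "\<not> ?thesis"
    then have "K \<subseteq> S" by blast
    then have "card K \<le> card S" using that card_mono by blast
    then show False using that K by simp
  qed
  obtain a where a: "a \<in> K" "a \<noteq> \<one>" using ex[of "{\<one>}"] by auto
  have "card {\<one>, a, a \<otimes> a} < 5" by (simp add: card_insert_if)
  then obtain b where b: "b \<in> K" "b \<noteq> \<one>" "b \<noteq> a" "b \<noteq> a \<otimes> a" using ex[of "{\<one>, a, a \<otimes> a}"] by auto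
  define W where "W = {\<one>, a, b}"
  have W: "W \<subseteq> K" "card W = 3" "finite W" using a b one by (auto simp: W_def)
  have triv: "c = \<one>" if "c \<in> K" "c <# W = W" for c
    using trivial_translation[of a b c] that a b cK by (auto simp: W_def)
  have \<D>: "\<And>Z. Z \<in> \<D> \<Longrightarrow> Z \<noteq> {}" "\<And>Z. Z \<in> \<D> \<Longrightarrow> Z \<subset> K" "\<D> \<noteq> {}"
    using K by (auto simp: rigid_on_def)
  have cardD: "card Z < card K" if "Z \<in> \<D>" for Z
    using \<D>(2)[OF that] finL by (simp add: psubset_card_mono)
  have xW: "x \<notin> W" using W x by auto
  have cardW: "card (insert x W) = 4" using W xW by simp
  define \<D>' where "\<D>' = \<D> \<union> {K, insert x W}"
  have sub: "Y \<subseteq> L" if "Y \<in> \<D>'" for Y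
    using that \<D>(2) L W by (auto simp: \<D>'_def)
  have "rigid_on L \<D>'"
    unfolding rigid_on_def
  proof (intro conjI allI impI ballI)
    show "\<D>' \<noteq> {}" by (simp add: \<D>'_def)
    fix Z assume Z: "Z \<in> \<D>'"
    show "Z \<noteq> {}" using Z \<D> one by (auto simp: \<D>'_def)
    have KL: "K \<subset> L" using L x by blast
    then have "card K < card L" using finL by (simp add: psubset_card_mono)
    then have "card Z < card L" using Z cardD cardW K by (force simp: \<D>'_def)
    then show "Z \<subset> L" using sub[OF Z] by auto
  next
    fix \<phi> assume t: "translates_onto \<phi> L \<D>'"
    then have b: "bij_betw \<phi> L L" by (simp add: translates_onto_def)
    have fL: "\<And>x. x \<in> L \<Longrightarrow> \<phi> x \<in> L" using b by (auto simp: bij_betw_def)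
    have p: "\<forall>g\<in>L. \<exists>g'\<in>L. \<phi> ` (g <# K) = g' <# K"
    proof
      fix g assume g: "g \<in> L"
      show "\<exists>g'\<in>L. \<phi> ` (g <# K) = g' <# K"
      proof (rule translates_onto_unique_card[OF t L(1) g, of K])
      show "K \<in> \<D>'" "\<forall>Y\<in>\<D>'. Y \<subseteq> L" using sub by (auto simp: \<D>'_def)
      show "Y = K" if "Y \<in> \<D>'" "card Y = card K" for Y
        using that cardD cardW K by (force simp: \<D>'_def)
      qed blast
    qed
    note l = l_cosets_preserved[OF L(1) K(1) L(2) b p]
    have sz: "card Z = card Z'" if "\<phi> ` (g <# Z) = g' <# Z'" "g \<in> L" "g' \<in> L" "Z \<in> \<D>'" "Z' \<in> \<D>'"
      for g g' Z Z'
    proof -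
      have "g <# Z \<subseteq> L" using that sub subgroup_l_coset_subset[OF L(1)] by simp
      then have "inj_on \<phi> (g <# Z)" by (rule inj_on_subset[OF bij_betw_imp_inj_on[OF b]])
      then have "card (g <# Z) = card (g' <# Z')" using that(1) card_image by fastforce
      moreover have "Z \<subseteq> carrier G" "Z' \<subseteq> carrier G"
        using sub[OF that(4)] sub[OF that(5)] cL by auto
      ultimately show ?thesis using that cL by (simp add: card_l_coset)
    qed
    \<comment> \<open>Members of \<open>\<D>\<close> may also have size 4. They are told from
      \<open>insert x W\<close> by lying in a single left coset of \<open>K\<close>, a property that
      \<phi> respects.\<close>
    have tr: "inv u \<otimes> v \<in> K" if as: "u \<in> g' <# Z'" "v \<in> g' <# Z'" "\<phi> ` (g <# Z) = g' <# Z'" "Z \<subseteq> K" "g \<in> L"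
      for u v g g' Z Z'
    proof -
      obtain r s where rs: "r \<in> Z" "s \<in> Z" "u = \<phi> (g \<otimes> r)" "v = \<phi> (g \<otimes> s)"
        using as(1,2) unfolding as(3)[symmetric] by (auto simp: l_coset_image)
      have "inv (g \<otimes> r) \<otimes> (g \<otimes> s) = inv r \<otimes> s"
        using rs as cL cK by (simp add: inv_mult_group m_assoc subset_iff) (simp add: m_assoc[symmetric] subset_iff)
      moreover have "inv r \<otimes> s \<in> K" using rs as Km by blast
      moreover have "g \<otimes> r \<in> L" "g \<otimes> s \<in> L" using rs as L by (auto intro: subgroup.m_closed)
      ultimately show ?thesis using l(2) rs by simp
    qed
    have "\<exists>g'\<in>L. \<exists>Z'\<in>\<D>. \<phi> ` (g <# Z) = g' <# Z'" if g: "g \<in> L" and Z: "Z \<in> \<D>" for g Z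
    proof -
      have ZD: "Z \<in> \<D>'" using Z by (simp add: \<D>'_def)
      obtain g' Z' where g': "g' \<in> L" "Z' \<in> \<D>'" "\<phi> ` (g <# Z) = g' <# Z'"
        using t g ZD unfolding translates_onto_def by metis
      have "Z' \<noteq> K" using sz[OF g'(3) g g'(1) ZD g'(2)] cardD[OF Z] by auto
      moreover have "Z' \<noteq> insert x W"
      proof
        assume Z': "Z' = insert x W"
        have "inv g' \<otimes> (g' \<otimes> x) = x" using g' x cL by (simp add: m_assoc[symmetric])
        moreover have "inv (g' \<otimes> \<one>) \<otimes> (g' \<otimes> x) \<in> K"
          using \<D>(2)[OF Z] by (intro tr[OF _ _ g'(3)]) (auto simp: Z' W_def l_coset_image g)
        ultimately show False using x g' cL by simp
      qed
      ultimately show ?thesis using g' by (auto simp: \<D>'_def)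
    qed
    then have rK: "right_commuting \<phi> L K"
      using right_commuting_on_l_coset[OF fin L(1) K(1) L(2) b p K(3)] by blast
    have "\<phi> (g \<otimes> x) = \<phi> g \<otimes> x" if g: "g \<in> L" for g
    proof -
      have ZD: "insert x W \<in> \<D>'" by (simp add: \<D>'_def)
      obtain g' Z' where g': "g' \<in> L" "Z' \<in> \<D>'" "\<phi> ` (g <# insert x W) = g' <# Z'"
        using t g ZD unfolding translates_onto_def by metis
      have "Z' \<noteq> K" using sz[OF g'(3) g g'(1) ZD g'(2)] cardW K by auto
      moreover have "Z' \<notin> \<D>"
      proof
        assume Z': "Z' \<in> \<D>"
        have gx: "g \<otimes> x \<in> L" "g \<otimes> \<one> \<in> L" using g L one by (auto intro: subgroup.m_closed)
        have "\<phi> (g \<otimes> \<one>) \<in> g' <# Z'" "\<phi> (g \<otimes> x) \<in> g' <# Z'"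
          unfolding g'(3)[symmetric] by (auto simp: l_coset_image W_def)
        then obtain u v where uv: "u \<in> Z'" "v \<in> Z'" "\<phi> (g \<otimes> \<one>) = g' \<otimes> u" "\<phi> (g \<otimes> x) = g' \<otimes> v"
          by (auto simp: l_coset_image)
        have uvK: "u \<in> K" "v \<in> K" using uv Z' \<D> by auto
        have "inv (g' \<otimes> u) \<otimes> (g' \<otimes> v) = inv u \<otimes> v"
          using uvK g' cL cK by (simp add: inv_mult_group m_assoc) (simp add: m_assoc[symmetric])
        moreover have "inv u \<otimes> v \<in> K" using uvK Km by blast
        ultimately have "inv (g \<otimes> \<one>) \<otimes> (g \<otimes> x) \<in> K" using l(2)[OF gx(2) gx(1)] uv by simp
        moreover have "inv (g \<otimes> \<one>) \<otimes> (g \<otimes> x) = x" using g x cL by (simp add: m_assoc[symmetric])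
        ultimately show False using x by simp
      qed
      ultimately have Z': "Z' = insert x W" using g'(2) unfolding \<D>'_def by blast
      show ?thesis
      proof (rule right_commuting_outside[OF L(1) K(1) L(2) b rK W(1) _ triv L(3) x(2) g g'(1)])
        show "\<phi> ` (g <# insert x W) = g' <# insert x W" using g'(3) Z' by simp
      qed (use W in simp_all)
    qed
    then have "right_commuting \<phi> L (insert x K)" using rK by (auto simp: right_commuting_def)
    then show "right_commuting \<phi> L L"
      using right_commuting_generate[OF L(1), of "insert x K"] L fL by (auto simp: L_def[symmetric])
  qed
  then show ?thesis unfolding L_def by blast
qed

lemma rigid_on_carrier:
  assumes fin: "finite (carrier G)" and "subgroup K G" "card K \<ge> 5" "rigid_on K \<D>"
  shows "\<exists>\<D>'. rigid_on (carrier G) \<D>'"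
  using assms(2-)
proof (induction "card (carrier G) - card K" arbitrary: K \<D> rule: less_induct)
  case less
  note K = less.prems
  have sub: "K \<subseteq> carrier G" using K subgroup.subset by blast
  show ?case
  proof (cases "K = carrier G")
    case True
    then show ?thesis using K by blast
  next
    case False
    then obtain x where x: "x \<in> carrier G" "x \<notin> K" using sub by blast
    define L where "L = generate G (insert x K)"
    note L = subgroup_generate_insert[OF K(1) x(1), folded L_def]
    obtain \<D>' where D': "rigid_on L \<D>'" using rigid_on_extend[OF fin K x] L_def by blast
    have "K \<subset> L" "L \<subseteq> carrier G" using L x subgroup.subset[OF L(1)] by auto
    then have "card K < card L" "card L \<le> card (carrier G)"
      using fin by (auto intro: psubset_card_mono card_mono finite_subset)
    then show ?thesis using K less.hyps[OF _ L(1) _ D'] by simp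
  qed
qed


section \<open>Counting cosets\<close>

lemma l_coset_eq_iff:
  assumes H: "subgroup H G" and "u \<in> carrier G" "v \<in> carrier G"
  shows "u <# H = v <# H \<longleftrightarrow> inv u \<otimes> v \<in> H"
proof
  assume "u <# H = v <# H"
  moreover have "v \<in> v <# H" using assms by (simp add: mem_l_coset_iff subgroup.one_closed)
  ultimately show "inv u \<otimes> v \<in> H" using assms by (simp flip: mem_l_coset_iff)
next
  assume "inv u \<otimes> v \<in> H"
  then have "v \<in> u <# H" using assms by (simp add: mem_l_coset_iff)
  then show "u <# H = v <# H" using l_repr_independence assms by simp
qed

lemma l_cosets_disjoint:
  assumes H: "subgroup H G" and "u \<in> carrier G" "v \<in> carrier G" "inv u \<otimes> v \<notin> H"
  shows "(u <# H) \<inter> (v <# H) = {}"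
proof -
  have False if z: "z \<in> u <# H" "z \<in> v <# H" for z
  proof -
    have "u <# H = v <# H"
      using l_repr_independence[OF z(1) assms(2) H] l_repr_independence[OF z(2) assms(3) H] by simp
    then show False using l_coset_eq_iff assms by simp
  qed
  then show ?thesis by blast
qed

lemma card_ge_two_l_cosets:
  assumes "finite L" and L: "subgroup L G" and H: "subgroup H G" "H \<subseteq> L" and x: "x \<in> L" "x \<notin> H"
  shows "card L \<ge> 2 * card H"
proof -
  have c: "x \<in> carrier G" using L x subgroup.mem_carrier by metis
  have HC: "H \<subseteq> carrier G" using H subgroup.subset by blast
  have "(\<one> <# H) \<inter> (x <# H) = {}" using x c by (intro l_cosets_disjoint[OF H(1)]) auto
  then have d: "H \<inter> (x <# H) = {}" using HC by (simp add: lcos_mult_one)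
  have "x <# H \<subseteq> L" using subgroup_l_coset_subset[OF L x(1) H(2)] .
  then have "card (H \<union> (x <# H)) \<le> card L" using H assms(1) by (intro card_mono) auto
  moreover have "card (H \<union> (x <# H)) = card H + card ((x <# H))"
    using d \<open>x <# H \<subseteq> L\<close> H assms(1) by (intro card_Un_disjoint) (auto intro: finite_subset)
  ultimately show ?thesis using card_l_coset[OF HC c] by simp
qed

lemma card_ge_three_l_cosets:
  assumes "finite L" and L: "subgroup L G" and H: "subgroup H G" "H \<subseteq> L"
    and x: "x \<in> L" "x \<notin> H" "x \<otimes> x \<notin> H"
  shows "card L \<ge> 3 * card H"
proof -
  have c: "x \<in> carrier G" using L x subgroup.mem_carrier by metis
  have xx: "x \<otimes> x \<in> L" using L x by (simp add: subgroup.m_closed)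
  have HC: "H \<subseteq> carrier G" using H subgroup.subset by blast
  have "(\<one> <# H) \<inter> (x <# H) = {}" "(\<one> <# H) \<inter> ((x \<otimes> x) <# H) = {}"
    using x c by (intro l_cosets_disjoint[OF H(1)]; simp)+
  then have d: "H \<inter> (x <# H) = {}" "H \<inter> ((x \<otimes> x) <# H) = {}" using HC by (simp_all add: lcos_mult_one)
  have d': "(x <# H) \<inter> ((x \<otimes> x) <# H) = {}"
    using x c by (intro l_cosets_disjoint[OF H(1)]) (auto simp: m_assoc[symmetric])
  have s: "x <# H \<subseteq> L" "(x \<otimes> x) <# H \<subseteq> L" using subgroup_l_coset_subset[OF L _ H(2)] x xx by auto
  have f: "finite H" "finite (x <# H)" "finite ((x \<otimes> x) <# H)"
    using s H assms(1) by (auto intro: finite_subset)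
  have "card (H \<union> (x <# H) \<union> ((x \<otimes> x) <# H)) \<le> card L" using H assms(1) s by (intro card_mono) auto
  moreover have "card (H \<union> (x <# H) \<union> ((x \<otimes> x) <# H)) = card H + card ((x <# H)) + card (((x \<otimes> x) <# H))"
    using d d' f by (subst card_Un_disjoint, auto)+
  ultimately show ?thesis using card_l_coset[OF HC] c by simp
qed

section \<open>Rigid families for subgroups with few generators\<close>

lemma right_commuting_involution:
  assumes K: "subgroup K G" and m: "\<phi> \<in> K \<rightarrow> K" and x: "x \<in> K" "x \<otimes> x = \<one>" and g: "g \<in> K" "g' \<in> K"
    and e: "\<phi> ` (g <# {\<one>, x}) = g' <# {\<one>, x}"
  shows "\<phi> (g \<otimes> x) = \<phi> g \<otimes> x"
proof -
  have c: "x \<in> carrier G" "g \<in> carrier G" "g' \<in> carrier G" using subgroup.mem_carrier[OF K] x g by auto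
  have "{\<phi> g, \<phi> (g \<otimes> x)} = {g', g' \<otimes> x}" using e c by (simp add: l_coset_image)
  moreover have "g' \<otimes> x \<otimes> x = g'" using c x by (simp add: m_assoc)
  ultimately show ?thesis by (auto simp: doubleton_eq_iff)
qed

lemma generate_members:
  assumes "S \<subseteq> carrier G"
  shows "subgroup (generate G S) G" "\<one> \<in> generate G S" "\<And>x. x \<in> S \<Longrightarrow> x \<in> generate G S"
    "\<And>x. x \<in> generate G S \<Longrightarrow> x \<in> carrier G"
  using generate_is_subgroup[OF assms] generate_in_carrier[OF assms]
  by (auto intro: generate.intros)

text \<open>For an involution an unoriented edge \<open>{k, k \<otimes> x}\<close> suffices, since
  each end is the other one times \<open>x\<close>. Both involutions would give pairs, so
  \<open>y\<close> is encoded by complements; their size differs from 2 because the order is at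
  least 5.\<close>

lemma rigid_on_dihedral:
  assumes fin: "finite (carrier G)" and x: "x \<in> carrier G" "x \<otimes> x = \<one>" "x \<noteq> \<one>"
    and y: "y \<in> carrier G" "y \<otimes> y = \<one>" "y \<noteq> \<one>" and K: "K = generate G {x, y}" "card K \<ge> 5"
  shows "rigid_on K {{\<one>, x}, K - {\<one>, y}}"
proof -
  have "{x, y} \<subseteq> carrier G" using x y by simp
  note gen = generate_members[OF this, folded K(1)]
  have mem: "x \<in> K" "y \<in> K" "\<one> \<in> K" using gen by auto
  have f: "finite K" using fin gen(4) by (auto intro: finite_subset)
  have sz: "card {\<one>, x} = 2" "card {\<one>, y} = 2" using x y by auto
  then have sz': "card (K - {\<one>, y}) = card K - 2" using mem f by (subst card_Diff_subset) auto
  let ?D = "{{\<one>, x}, K - {\<one>, y}}"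
  show ?thesis unfolding rigid_on_def
  proof (intro conjI allI impI)
    have "card (K - {\<one>, y}) \<noteq> 0" "card K \<noteq> card {\<one>, x}" using sz sz' K(2) by simp_all
    then have "K \<noteq> {\<one>, x}" "K - {\<one>, y} \<noteq> {}" by (metis card.empty)+
    then show "\<forall>Z\<in>?D. Z \<noteq> {} \<and> Z \<subset> K" using mem by auto
    fix \<phi> assume t: "translates_onto \<phi> K ?D"
    then have b: "bij_betw \<phi> K K" by (simp add: translates_onto_def)
    then have m: "\<phi> \<in> K \<rightarrow> K" by (auto simp: bij_betw_def)
    have sub: "\<forall>Y\<in>?D. Y \<subseteq> K" using mem by auto
    have "\<phi> (g \<otimes> x) = \<phi> g \<otimes> x" if g: "g \<in> K" for g
    proof (rule translates_onto_unique_card[OF t gen(1) g _ sub, of "{\<one>, x}"])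
      fix g' assume g': "g' \<in> K" "\<phi> ` (g <# {\<one>, x}) = g' <# {\<one>, x}"
      then show ?thesis using right_commuting_involution[OF gen(1) m mem(1) x(2) g] by blast
    qed (use sz sz' K(2) in auto)
    moreover have "\<phi> (g \<otimes> y) = \<phi> g \<otimes> y" if g: "g \<in> K" for g
    proof (rule translates_onto_unique_card[OF t gen(1) g _ sub, of "K - {\<one>, y}"])
      fix g' assume g': "g' \<in> K" "\<phi> ` (g <# (K - {\<one>, y})) = g' <# (K - {\<one>, y})"
      have "\<phi> ` (g <# {\<one>, y}) = g' <# {\<one>, y}"
        using translates_onto_Diff[OF b gen(1) g g'(1) _ _ g'(2)] mem by auto
      then show ?thesis using right_commuting_involution[OF gen(1) m mem(2) y(2) g g'(1)] by blast
    qed (use sz sz' K(2) in auto)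
    ultimately have "right_commuting \<phi> K {x, y}" by (auto simp: right_commuting_def)
    then show "right_commuting \<phi> K K" using right_commuting_generate[OF gen(1) _ m, of "{x, y}"] mem K by simp
  qed simp
qed

text \<open>Pairs and their complements are used up by \<open>a\<close> and \<open>b\<close>, so
  \<open>c\<close> is attached to \<open>generate G {a, b}\<close> by
  \<open>right_commuting_outside\<close> with \<open>W = {\<one>, a, b}\<close>. This set has
  trivial stabilizer because \<open>b\<close> differs from \<open>a \<otimes> a = \<one>\<close>.
  Order at least 8 keeps the sizes 2, 4 and \<open>card K - 2\<close> apart.\<close>

lemma rigid_on_elementary_abelian:
  assumes fin: "finite (carrier G)" and inv: "\<And>x. x \<in> carrier G \<Longrightarrow> x \<otimes> x = \<one>"
    and abc: "a \<in> carrier G" "b \<in> carrier G" "c \<in> carrier G"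
    and ne: "a \<noteq> \<one>" "b \<noteq> \<one>" "b \<noteq> a" "c \<notin> generate G {a, b}" and K: "K = generate G {a, b, c}"
  shows "rigid_on K {{\<one>, a}, {\<one>, a, b, c}, K - {\<one>, b}}" and "card K \<ge> 8"
proof -
  define H where "H = generate G {a, b}"
  have "{a, b, c} \<subseteq> carrier G" "{a, b} \<subseteq> carrier G" using abc by auto
  note gen = generate_members[OF this(1), folded K] and genH = generate_members[OF this(2), folded H_def]
  have HK: "H \<subseteq> K" unfolding H_def K by (rule mono_generate) auto
  have mem: "a \<in> K" "b \<in> K" "c \<in> K" "\<one> \<in> K" using gen by auto
  have memH: "a \<in> H" "b \<in> H" "\<one> \<in> H" "c \<notin> H" using genH ne H_def by auto
  have f: "finite K" "finite H" using fin gen(4) genH(4) by (auto intro: finite_subset)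
  have "a \<otimes> b \<in> H" using genH memH by (simp add: subgroup.m_closed)
  moreover have "a \<otimes> b \<noteq> \<one>" using inv[OF abc(1)] ne abc by (metis Units_eq Units_l_cancel)
  moreover have "a \<otimes> b \<noteq> a" "a \<otimes> b \<noteq> b" using ne abc by (auto simp: l_cancel_one r_cancel_one)
  ultimately have "card {\<one>, a, b, a \<otimes> b} = 4" "{\<one>, a, b, a \<otimes> b} \<subseteq> H" using ne memH by auto
  then have "card H \<ge> 4" using f by (metis card_mono)
  then show K8: "card K \<ge> 8" using card_ge_two_l_cosets[OF f(1) gen(1) genH(1) HK mem(3) memH(4)] by simp
  have "c \<noteq> \<one>" "c \<noteq> a" "c \<noteq> b" using memH by auto
  then have sz: "card {\<one>, a} = 2" "card {\<one>, b} = 2" "card {\<one>, a, b, c} = 4" using ne by auto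
  then have sz': "card (K - {\<one>, b}) = card K - 2" using mem f by (subst card_Diff_subset) auto
  let ?D = "{{\<one>, a}, {\<one>, a, b, c}, K - {\<one>, b}}"
  show "rigid_on K ?D" unfolding rigid_on_def
  proof (intro conjI allI impI)
    have "card K \<noteq> card {\<one>, a}" "card (K - {\<one>, b}) \<noteq> 0" "card K \<noteq> card {\<one>, a, b, c}"
      using sz sz' K8 by simp_all
    then have "K \<noteq> {\<one>, a}" "K - {\<one>, b} \<noteq> {}" "K \<noteq> {\<one>, a, b, c}" by (metis card.empty)+
    then show "\<forall>Z\<in>?D. Z \<noteq> {} \<and> Z \<subset> K" using mem by auto
    fix \<phi> assume t: "translates_onto \<phi> K ?D"
    then have bij: "bij_betw \<phi> K K" by (simp add: translates_onto_def)
    then have m: "\<phi> \<in> K \<rightarrow> K" by (auto simp: bij_betw_def)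
    have sub: "\<forall>Y\<in>?D. Y \<subseteq> K" using mem by auto
    have ra: "\<phi> (g \<otimes> a) = \<phi> g \<otimes> a" if g: "g \<in> K" for g
    proof (rule translates_onto_unique_card[OF t gen(1) g _ sub, of "{\<one>, a}"])
      fix g' assume g': "g' \<in> K" "\<phi> ` (g <# {\<one>, a}) = g' <# {\<one>, a}"
      then show ?thesis using right_commuting_involution[OF gen(1) m mem(1) inv[OF abc(1)] g] by blast
    qed (use sz sz' K8 in auto)
    have rb: "\<phi> (g \<otimes> b) = \<phi> g \<otimes> b" if g: "g \<in> K" for g
    proof (rule translates_onto_unique_card[OF t gen(1) g _ sub, of "K - {\<one>, b}"])
      fix g' assume g': "g' \<in> K" "\<phi> ` (g <# (K - {\<one>, b})) = g' <# (K - {\<one>, b})"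
      have "\<phi> ` (g <# {\<one>, b}) = g' <# {\<one>, b}"
        using translates_onto_Diff[OF bij gen(1) g g'(1) _ _ g'(2)] mem by auto
      then show ?thesis using right_commuting_involution[OF gen(1) m mem(2) inv[OF abc(2)] g g'(1)] by blast
    qed (use sz sz' K8 in auto)
    have rH: "right_commuting \<phi> K H"
    proof -
      have "right_commuting \<phi> K {a, b}" using ra rb by (auto simp: right_commuting_def)
      then show ?thesis
        using right_commuting_generate[OF gen(1) _ m, of "{a, b}"] mem by (simp add: H_def)
    qed
    have "\<phi> (g \<otimes> c) = \<phi> g \<otimes> c" if g: "g \<in> K" for g
    proof (rule translates_onto_unique_card[OF t gen(1) g _ sub, of "{\<one>, a, b, c}"])
      fix g' assume g': "g' \<in> K" "\<phi> ` (g <# {\<one>, a, b, c}) = g' <# {\<one>, a, b, c}"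
      have eq: "{\<one>, a, b, c} = insert c {\<one>, a, b}" by auto
      show ?thesis
      proof (rule right_commuting_outside[OF gen(1) genH(1) HK bij rH, where W = "{\<one>, a, b}"])
        show "\<phi> ` (g <# insert c {\<one>, a, b}) = g' <# insert c {\<one>, a, b}" using g' eq by simp
        show "d = \<one>" if "d \<in> H" "d <# {\<one>, a, b} = {\<one>, a, b}" for d
          using trivial_translation[of a b d] that abc ne inv genH by auto
      qed (use memH mem ne g g' in auto)
    qed (use sz sz' K8 in auto)
    then have "right_commuting \<phi> K {a, b, c}" using ra rb by (auto simp: right_commuting_def)
    then show "right_commuting \<phi> K K" using right_commuting_generate[OF gen(1) _ m, of "{a, b, c}"] mem K by simp
  qed simp
qed

text \<open>In the application \<open>f\<close> maps a point to its left coset: if exactly two of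
  three points share a coset, the third is determined, and the two are determined up to a
  swap.\<close>

lemma triple_by_classes:
  assumes "{p, q, r} = {u, v, w}" "p \<noteq> q" "f p = f q" "f p \<noteq> f r" "f u = f v" "f u \<noteq> f w"
  shows "r = w" "p = u \<and> q = v \<or> p = v \<and> q = u"
proof -
  have "r \<in> {u, v, w}" "p \<in> {u, v, w}" "q \<in> {u, v, w}" using assms(1) by blast+
  then show "r = w" using assms by auto
  then have "p \<in> {u, v}" "q \<in> {u, v}" using \<open>p \<in> {u, v, w}\<close> \<open>q \<in> {u, v, w}\<close> assms by auto
  then show "p = u \<and> q = v \<or> p = v \<and> q = u" using assms(2) by auto
qed

text \<open>
  The translates of \<open>{\<one>, a, x}\<close> leave open that \<open>\<phi>\<close> inverts \<open>a\<close> on some coset; together with the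
  edges \<open>{g, g \<otimes> x}\<close> this would force \<open>x \<otimes> x = a\<close>. The complement of the triple is used so that its
  size differs from that of \<open>H\<close>.
\<close>

lemma rigid_on_two_generated:
  assumes fin: "finite (carrier G)" and a: "a \<in> carrier G" and x: "x \<in> carrier G"
    and H: "H = generate G {a}" and L: "L = generate G {a, x}"
    and xH: "x \<notin> H" "x \<otimes> x \<noteq> a" and card: "card H \<ge> 3" "card L > card H + 3"
  shows "rigid_on L {{\<one>, x}, H, L - {\<one>, a, x}}"
proof -
  have "{a, x} \<subseteq> carrier G" "{a} \<subseteq> carrier G" using a x by auto
  note gen = generate_members[OF this(1), folded L] and genH = generate_members[OF this(2), folded H]
  have HL: "H \<subseteq> L" unfolding H L by (rule mono_generate) auto
  have mem: "a \<in> L" "x \<in> L" "\<one> \<in> L" using gen by auto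
  have memH: "a \<in> H" "\<one> \<in> H" using genH by auto
  have f: "finite L" using fin gen(4) by (auto intro: finite_subset)
  have "a \<noteq> \<one>"
  proof
    assume "a = \<one>"
    then have "H = {\<one>}" using generate_one H by simp
    then show False using card by simp
  qed
  then have ne: "a \<noteq> \<one>" "x \<noteq> \<one>" "x \<noteq> a" using xH memH by auto
  have sz: "card {\<one>, x} = 2" "card {\<one>, a, x} = 3" using ne by auto
  then have sz': "card (L - {\<one>, a, x}) = card L - 3" using mem f by (subst card_Diff_subset) auto
  let ?D = "{{\<one>, x}, H, L - {\<one>, a, x}}"
  show ?thesis unfolding rigid_on_def
  proof (intro conjI allI impI)
    have "card L \<noteq> card {\<one>, x}" "card (L - {\<one>, a, x}) \<noteq> 0" "card L \<noteq> card H"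
      using sz sz' card by simp_all
    then have "L \<noteq> {\<one>, x}" "L - {\<one>, a, x} \<noteq> {}" "L \<noteq> H" by (metis card.empty)+
    then show "\<forall>Z\<in>?D. Z \<noteq> {} \<and> Z \<subset> L" using mem memH HL by auto
    fix \<phi> assume t: "translates_onto \<phi> L ?D"
    then have b: "bij_betw \<phi> L L" by (simp add: translates_onto_def)
    then have m: "\<phi> \<in> L \<rightarrow> L" and inj: "inj_on \<phi> L" by (auto simp: bij_betw_def)
    have sub: "\<forall>Y\<in>?D. Y \<subseteq> L" using mem HL by auto
    have p: "\<forall>g\<in>L. \<exists>g'\<in>L. \<phi> ` (g <# H) = g' <# H"
    proof
      fix g assume g: "g \<in> L"
      show "\<exists>g'\<in>L. \<phi> ` (g <# H) = g' <# H"
        by (rule translates_onto_unique_card[OF t gen(1) g _ sub, of H]) (use sz sz' card in auto)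
    qed
    note l = l_cosets_preserved[OF gen(1) genH(1) HL b p]
    have "\<phi> (g \<otimes> a) = \<phi> g \<otimes> a \<and> \<phi> (g \<otimes> x) = \<phi> g \<otimes> x" if g: "g \<in> L" for g
    proof -
      note gc = gen(4)[OF g]
      have ga: "g \<otimes> a \<in> L" and gx: "g \<otimes> x \<in> L" using g mem gen by (auto intro: subgroup.m_closed)
      have fc: "\<phi> g \<in> carrier G" "\<phi> (g \<otimes> a) \<in> carrier G" "\<phi> (g \<otimes> x) \<in> carrier G"
        using m g ga gx gen(4) by auto
      obtain h where h: "h \<in> L" "\<phi> ` (g <# (L - {\<one>, a, x})) = h <# (L - {\<one>, a, x})"
        by (rule translates_onto_unique_card[OF t gen(1) g _ sub, of "L - {\<one>, a, x}"])
          (use sz sz' card in auto)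
      note hc = gen(4)[OF h(1)]
      have "\<phi> ` (g <# {\<one>, a, x}) = h <# {\<one>, a, x}"
        using translates_onto_Diff[OF b gen(1) g h(1) _ _ h(2)] mem by auto
      then have tri: "{\<phi> g, \<phi> (g \<otimes> a), \<phi> (g \<otimes> x)} = {h, h \<otimes> a, h \<otimes> x}"
        using gc hc by (simp add: l_coset_image)
      have "\<phi> g \<noteq> \<phi> (g \<otimes> a)" using inj_onD[OF inj _ g ga] gc a ne by auto
      moreover have "\<phi> g <# H = \<phi> (g \<otimes> a) <# H"
        using l(2)[OF g ga] l_coset_eq_iff[OF genH(1)] fc gc a memH by (simp add: m_assoc[symmetric])
      moreover have "\<phi> g <# H \<noteq> \<phi> (g \<otimes> x) <# H"
        using l(2)[OF g gx] l_coset_eq_iff[OF genH(1)] fc gc x xH by (simp add: m_assoc[symmetric])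
      moreover have "h <# H = (h \<otimes> a) <# H" "h <# H \<noteq> (h \<otimes> x) <# H"
        using l_coset_eq_iff[OF genH(1)] hc a x xH memH by (simp_all add: m_assoc[symmetric])
      ultimately have r: "\<phi> (g \<otimes> x) = h \<otimes> x"
        and pq: "\<phi> g = h \<and> \<phi> (g \<otimes> a) = h \<otimes> a \<or> \<phi> g = h \<otimes> a \<and> \<phi> (g \<otimes> a) = h"
        using triple_by_classes[OF tri, of "\<lambda>z. z <# H"] by auto
      \<comment> \<open>In the swapped case the edge of \<open>g\<close> goes to
        \<open>{h \<otimes> a, h \<otimes> x}\<close>. Reading it as
        \<open>{k, k \<otimes> x}\<close> gives \<open>a = \<one>\<close> in one direction and
        \<open>x \<otimes> x = a\<close> in the other.\<close>
      have False if s: "\<phi> g = h \<otimes> a"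
      proof -
        obtain k where k: "k \<in> L" "\<phi> ` (g <# {\<one>, x}) = k <# {\<one>, x}"
          by (rule translates_onto_unique_card[OF t gen(1) g _ sub, of "{\<one>, x}"])
            (use sz sz' card in auto)
        note kc = gen(4)[OF k(1)]
        have "{h \<otimes> a, h \<otimes> x} = {k, k \<otimes> x}" using k(2) r s gc kc by (simp add: l_coset_image)
        then consider "h \<otimes> a \<otimes> x = h \<otimes> x" | "h \<otimes> a = h \<otimes> x \<otimes> x"
          by (auto simp: doubleton_eq_iff)
        then show False
        proof cases
          case 1
          then show False using hc a x ne by simp
        next
          case 2
          then show False using hc a x xH by (simp add: m_assoc)
        qed
      qed
      then show ?thesis using r pq by auto
    qed
    then have "right_commuting \<phi> L {a, x}" by (auto simp: right_commuting_def)
    then show "right_commuting \<phi> L L"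
      using right_commuting_generate[OF gen(1) _ m, of "{a, x}"] mem L by simp
  qed simp
qed

text \<open>The edges \<open>{g, g \<otimes> a}\<close> give the dihedral group; \<open>{\<one>, a, a\<^sup>3}\<close> is not a translate of its
  mirror image once the order is at least 6.\<close>

lemma rigid_on_cyclic:
  assumes fin: "finite (carrier G)" and a: "a \<in> carrier G" and K: "K = generate G {a}" "card K \<ge> 6"
  shows "\<exists>\<D>. rigid_on K \<D>"
proof -
  have "{a} \<subseteq> carrier G" using a by simp
  note gen = generate_members[OF this, folded K(1)]
  have mem: "a \<in> K" "\<one> \<in> K" using gen by auto
  note Km = subgroup.m_closed[OF gen(1)]
  have f: "finite K" using fin gen(4) by (auto intro: finite_subset)
  have "ord a \<ge> 6" using generate_pow_card[OF a] K by simp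
  then have pow: "a [^] n \<noteq> \<one>" if "0 < n" "n < 6" for n :: nat
    using that pow_eq_id[OF a, of n] by (auto dest: dvd_imp_le)
  have ne: "a \<noteq> \<one>" "a \<otimes> a \<noteq> \<one>" "a \<otimes> (a \<otimes> a) \<noteq> \<one>" "a \<otimes> (a \<otimes> (a \<otimes> a)) \<noteq> \<one>"
      "a \<otimes> (a \<otimes> (a \<otimes> (a \<otimes> a))) \<noteq> \<one>"
    using pow[of 1] pow[of 2] pow[of 3] pow[of 4] pow[of 5] a by (simp_all add: numeral_eq_Suc m_assoc)
  define c where "c = a \<otimes> (a \<otimes> a)"
  define b where "b = inv a"
  have c: "c \<in> K" "c \<in> carrier G" using mem Km a by (auto simp: c_def)
  have b: "b \<in> carrier G" "b \<in> K" using a subgroup.m_inv_closed[OF gen(1) mem(1)] by (auto simp: b_def)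
  have ab: "a \<otimes> b = \<one>" "b \<otimes> a = \<one>" "\<And>z. z \<in> carrier G \<Longrightarrow> a \<otimes> (b \<otimes> z) = z"
    "\<And>z. z \<in> carrier G \<Longrightarrow> b \<otimes> (a \<otimes> z) = z"
    using a by (auto simp: b_def m_assoc[symmetric])
  have "c \<noteq> \<one>" "c \<noteq> a" using ne a by (auto simp: c_def)
  then have sz: "card {\<one>, a} = 2" "card {\<one>, a, c} = 3" using ne by auto
  let ?D = "{{\<one>, a}, {\<one>, a, c}}"
  have "rigid_on K ?D" unfolding rigid_on_def
  proof (intro conjI allI impI)
    have "card K \<noteq> card {\<one>, a}" "card K \<noteq> card {\<one>, a, c}" using sz K(2) by simp_all
    then have "K \<noteq> {\<one>, a}" "K \<noteq> {\<one>, a, c}" by metis+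
    then show "\<forall>Z\<in>?D. Z \<noteq> {} \<and> Z \<subset> K" using mem c by auto
    fix \<phi> assume t: "translates_onto \<phi> K ?D"
    then have bij: "bij_betw \<phi> K K" by (simp add: translates_onto_def)
    then have m: "\<phi> \<in> K \<rightarrow> K" and inj: "inj_on \<phi> K" by (auto simp: bij_betw_def)
    have sub: "\<forall>Y\<in>?D. Y \<subseteq> K" using mem c by auto
    have step: "\<phi> (g \<otimes> a) = \<phi> g \<otimes> a \<or> \<phi> (g \<otimes> a) = \<phi> g \<otimes> b" if g: "g \<in> K" for g
    proof -
      obtain k where k: "k \<in> K" "\<phi> ` (g <# {\<one>, a}) = k <# {\<one>, a}"
        by (rule translates_onto_unique_card[OF t gen(1) g _ sub, of "{\<one>, a}"])
          (use sz in auto)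
      have "{\<phi> g, \<phi> (g \<otimes> a)} = {k, k \<otimes> a}" using k gen(4) g by (simp add: l_coset_image)
      moreover have "k \<otimes> a \<otimes> b = k" using gen(4)[OF k(1)] a b ab by (simp add: m_assoc)
      ultimately show ?thesis by (auto simp: doubleton_eq_iff)
    qed
    have "\<phi> (g \<otimes> a) = \<phi> g \<otimes> a" if g: "g \<in> K" for g
    proof (rule ccontr)
      assume "\<phi> (g \<otimes> a) \<noteq> \<phi> g \<otimes> a"
      then have 1: "\<phi> (g \<otimes> a) = \<phi> g \<otimes> b" using step g by blast
      have fc: "\<phi> g \<in> carrier G" using m g gen(4) by auto
      note gc = gen(4)[OF g]
      have ga: "g \<otimes> a \<in> K" and gaa: "g \<otimes> a \<otimes> a \<in> K" and gaaa: "g \<otimes> a \<otimes> a \<otimes> a \<in> K"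
        using g mem Km by auto
      \<comment> \<open>Injectivity prevents turning back, so the reversal at \<open>g\<close>
        persists for the next two steps.\<close>
      have 2: "\<phi> (g \<otimes> a \<otimes> a) = \<phi> g \<otimes> (b \<otimes> b)"
      proof -
        have "\<phi> (g \<otimes> a \<otimes> a) \<noteq> \<phi> g" using inj_onD[OF inj _ gaa g] gc a ne by (auto simp: m_assoc)
        then show ?thesis using step[OF ga] 1 fc a b ab by (auto simp: m_assoc)
      qed
      have 3: "\<phi> (g \<otimes> a \<otimes> a \<otimes> a) = \<phi> g \<otimes> (b \<otimes> (b \<otimes> b))"
      proof -
        have "\<phi> (g \<otimes> a \<otimes> a \<otimes> a) \<noteq> \<phi> (g \<otimes> a)"
          using inj_onD[OF inj _ gaaa ga] gc a ne by (auto simp: m_assoc)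
        then show ?thesis using step[OF gaa] 1 2 fc a b ab by (auto simp: m_assoc)
      qed
      obtain k where k: "k \<in> K" "\<phi> ` (g <# {\<one>, a, c}) = k <# {\<one>, a, c}"
        by (rule translates_onto_unique_card[OF t gen(1) g _ sub, of "{\<one>, a, c}"])
          (use sz in auto)
      note kc = gen(4)[OF k(1)]
      define d where "d = inv (\<phi> g) \<otimes> k"
      have d: "d \<in> carrier G" using fc kc by (simp add: d_def)
      have "\<phi> (g \<otimes> c) = \<phi> g \<otimes> (b \<otimes> (b \<otimes> b))" using 3 gc a by (simp add: c_def m_assoc)
      then have "\<phi> g <# {\<one>, b, b \<otimes> (b \<otimes> b)} = k <# {\<one>, a, c}"
        using k(2) 1 gc fc by (simp add: l_coset_image)
      \<comment> \<open>The mirrored triple would be a translate of the original one. Each of the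
        three possible values of \<open>d\<close> yields \<open>a [^] n = \<one>\<close> for some
        \<open>n\<close> from 1 to 5.\<close>
      then have eq: "{d, d \<otimes> a, d \<otimes> c} = {\<one>, b, b \<otimes> (b \<otimes> b)}"
        using l_coset_eq_cancel[of k "{\<one>, a, c}" "\<phi> g"] kc fc a b c d
        by (simp add: d_def[symmetric] l_coset_image)
      then have "d \<in> {\<one>, b, b \<otimes> (b \<otimes> b)}" by blast
      then consider "d = \<one>" | "d = b" | "d = b \<otimes> (b \<otimes> b)" by blast
      then show False
      proof cases
        case 1
        then have "b \<in> {\<one>, a, c}" using eq a c by auto
        then have "a \<otimes> b \<in> {a \<otimes> \<one>, a \<otimes> a, a \<otimes> c}" by blast
        then show False using ne a ab by (auto simp: c_def)
      next
        case 2
        have "d \<otimes> c \<in> {\<one>, b, b \<otimes> (b \<otimes> b)}" using eq by blast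
        then have "a \<otimes> a \<in> {\<one>, b, b \<otimes> (b \<otimes> b)}" using 2 a b ab by (simp add: c_def)
        then have "a \<otimes> (a \<otimes> (a \<otimes> (a \<otimes> a))) \<in> (\<lambda>z. a \<otimes> (a \<otimes> (a \<otimes> z))) ` {\<one>, b, b \<otimes> (b \<otimes> b)}" by blast
        then show False using ne a b ab by auto
      next
        case 3
        have "b \<in> {d, d \<otimes> a, d \<otimes> c}" using eq by blast
        then have "b \<in> {b \<otimes> (b \<otimes> b), b \<otimes> b, \<one>}" using 3 a b ab by (simp add: c_def m_assoc)
        then have "a \<otimes> (a \<otimes> (a \<otimes> b)) \<in> (\<lambda>z. a \<otimes> (a \<otimes> (a \<otimes> z))) ` {b \<otimes> (b \<otimes> b), b \<otimes> b, \<one>}" by blast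
        then show False using ne a b ab by auto
      qed
    qed
    then have "right_commuting \<phi> K {a}" by (auto simp: right_commuting_def)
    then show "right_commuting \<phi> K K"
      using right_commuting_generate[OF gen(1) _ m, of "{a}"] mem K by simp
  qed simp
  then show ?thesis by blast
qed

text \<open>Here \<open>generate G {a}\<close> is a proper subgroup of
  \<open>generate G {x}\<close>. If all orders are below 6 and that of \<open>a\<close> is at least
  4, this rules out square roots of \<open>a\<close> outside its subgroup, as
  \<open>rigid_on_two_generated\<close> requires.\<close>

lemma card_generate_double:
  assumes fin: "finite (carrier G)" and "a \<in> carrier G" "x \<in> carrier G" "x \<notin> generate G {a}" "x \<otimes> x = a"
  shows "card (generate G {x}) \<ge> 2 * card (generate G {a})"
proof -
  have "{x} \<subseteq> carrier G" "{a} \<subseteq> carrier G" using assms by auto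
  note gen = generate_members[OF this(1)] and gena = generate_members[OF this(2)]
  have "{a} \<subseteq> generate G {x}"
    using assms(5) gen subgroup.m_closed[OF gen(1)] by auto
  then have "generate G {a} \<subseteq> generate G {x}" using generate_subgroup_incl gen(1) by blast
  moreover have "finite (generate G {x})" using fin gen(4) by (auto intro: finite_subset)
  ultimately show ?thesis using card_ge_two_l_cosets[OF _ gen(1) gena(1)] gen(3) assms by blast
qed

text \<open>By \<open>rigid_on_carrier\<close> it is enough to find one subgroup of order at least 5
  with a rigid family. Which kind is available depends on the largest element order.\<close>

theorem rigid_on_carrier_exists:
  assumes fin: "finite (carrier G)" and six: "card (carrier G) \<ge> 6"
  shows "\<exists>\<D>. rigid_on (carrier G) \<D>"
proof -
  note ext = rigid_on_carrier[OF fin]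
  let ?o = "\<lambda>a. card (generate G {a})"
  have gen: "subgroup (generate G {a}) G" "a \<in> generate G {a}" "generate G {a} \<subseteq> carrier G"
    if "a \<in> carrier G" for a
    using generate_members[of "{a}"] that by auto
  have outside: "\<exists>x\<in>carrier G. x \<notin> generate G {a}" if "?o a < 6" "a \<in> carrier G" for a
    using that six gen(3) by (metis leD subset_antisym subset_iff)
  have two: ?thesis
    if a: "a \<in> carrier G" and x: "x \<in> carrier G" "x \<notin> generate G {a}" "x \<otimes> x \<noteq> a"
      and c: "?o a \<ge> 3" "card (generate G {a, x}) > ?o a + 3" for a x
  proof -
    have "{a, x} \<subseteq> carrier G" using a x by simp
    then show ?thesis
      using ext[OF generate_is_subgroup _ rigid_on_two_generated[OF fin a x(1) refl refl x(2,3) c]] c by simp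
  qed
  have pair: "finite (generate G {a, x})" "subgroup (generate G {a, x}) G"
    "generate G {a} \<subseteq> generate G {a, x}" "x \<in> generate G {a, x}"
    if "a \<in> carrier G" "x \<in> carrier G" for a x
  proof -
    have "{a, x} \<subseteq> carrier G" using that by simp
    note g = generate_members[OF this]
    show "finite (generate G {a, x})" using fin g(4) by (auto intro: finite_subset)
    show "generate G {a} \<subseteq> generate G {a, x}" by (rule mono_generate) auto
  qed (use that generate_is_subgroup in \<open>auto intro: generate.incl\<close>)
  consider (big) a where "a \<in> carrier G" "?o a \<ge> 6"
    | (medium) a where "a \<in> carrier G" "?o a \<ge> 4" "\<forall>x\<in>carrier G. ?o x < 6"
    | (three) a where "a \<in> carrier G" "?o a = 3" "\<forall>x\<in>carrier G. ?o x < 4"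
    | (small) "\<forall>x\<in>carrier G. ?o x < 3"
  proof (cases "\<exists>a\<in>carrier G. ?o a \<ge> 6")
    case True
    then show thesis using big by blast
  next
    case F6: False
    show thesis
    proof (cases "\<exists>a\<in>carrier G. ?o a \<ge> 4")
      case True
      then show thesis using F6 medium by (meson not_le)
    next
      case F4: False
      show thesis
      proof (cases "\<exists>a\<in>carrier G. ?o a \<ge> 3")
        case True
        then obtain a where a: "a \<in> carrier G" "?o a \<ge> 3" by blast
        moreover have "\<not> ?o a \<ge> 4" using F4 a by blast
        ultimately have "?o a = 3" by simp
        then show thesis using a F4 three[of a] by (meson not_le)
      next
        case False
        then show thesis using small by (meson not_le)
      qed
    qed
  qed
  then show ?thesis
  proof cases
    case big
    then have "card (generate G {a}) \<ge> 5" by simp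
    then show ?thesis using rigid_on_cyclic[OF fin big(1) refl big(2)] ext[OF gen(1)] big by blast
  next
    case medium
    then obtain x where x: "x \<in> carrier G" "x \<notin> generate G {a}" using outside by blast
    have "x \<otimes> x \<noteq> a" using card_generate_double[OF fin medium(1) x] medium x by fastforce
    moreover have "card (generate G {a, x}) \<ge> 2 * ?o a"
      using card_ge_two_l_cosets[OF pair(1,2) gen(1) pair(3,4)] medium x by blast
    ultimately show ?thesis using two[OF medium(1) x] medium by simp
  next
    case three
    note a = three(1)
    show ?thesis
    \<comment> \<open>The fact \<open>two\<close> asks for more than \<open>3 + 3\<close> elements,
      so two cosets of \<open>generate G {a}\<close> are not enough. A third one is provided by
      \<open>x \<otimes> x\<close> if it lies outside.\<close>
    proof (cases "\<exists>x\<in>carrier G. x \<notin> generate G {a} \<and> x \<otimes> x \<notin> generate G {a}")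
      case True
      then obtain x where x: "x \<in> carrier G" "x \<notin> generate G {a}" "x \<otimes> x \<notin> generate G {a}" by blast
      then have "x \<otimes> x \<noteq> a" using gen(2)[OF a] by auto
      moreover have "card (generate G {a, x}) \<ge> 3 * ?o a"
        using card_ge_three_l_cosets[OF pair(1,2) gen(1) pair(3,4)] a x by blast
      ultimately show ?thesis using two[OF a x(1,2)] three by simp
    next
      case False
      \<comment> \<open>Otherwise \<one> and the first three powers of \<open>x\<close> would be
        distinct, while no element has order above 3.\<close>
      have sq: "x \<otimes> x = \<one>" if x: "x \<in> carrier G" "x \<notin> generate G {a}" for x
      proof (rule ccontr)
        assume n: "x \<otimes> x \<noteq> \<one>"
        have xx: "x \<otimes> x \<in> generate G {a}" using False x by blast
        have one: "\<one> \<in> generate G {a}" by (rule generate.one)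
        have x3: "x \<otimes> (x \<otimes> x) \<notin> generate G {a}"
        proof
          assume "x \<otimes> (x \<otimes> x) \<in> generate G {a}"
          then have "x \<otimes> (x \<otimes> x) \<otimes> inv (x \<otimes> x) \<in> generate G {a}"
            using xx subgroup.m_closed[OF gen(1)[OF a]] subgroup.m_inv_closed[OF gen(1)[OF a]] by blast
          then show False using x by (simp add: m_assoc)
        qed
        have "x \<noteq> \<one>" "x \<otimes> (x \<otimes> x) \<noteq> \<one>" "x \<otimes> (x \<otimes> x) \<noteq> x \<otimes> x" using x(2) one x3 xx by metis+
        moreover from this have "x \<otimes> x \<noteq> x" "x \<otimes> (x \<otimes> x) \<noteq> x" using n x(1) by simp_all
        ultimately have "card {\<one>, x, x \<otimes> x, x \<otimes> (x \<otimes> x)} = 4" using n by force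
        moreover have "{\<one>, x, x \<otimes> x, x \<otimes> (x \<otimes> x)} \<subseteq> generate G {x}"
          using gen[OF x(1)] subgroup.m_closed[OF gen(1)[OF x(1)]] generate.one by auto
        moreover have "finite (generate G {x})" using gen(3)[OF x(1)] fin finite_subset by blast
        ultimately have "?o x \<ge> 4" by (metis card_mono)
        then show False using three x by fastforce
      qed
      obtain x where x: "x \<in> carrier G" "x \<notin> generate G {a}" using outside[of a] three by auto
      \<comment> \<open>The elements \<open>x\<close> and \<open>x \<otimes> a\<close> are
        involutions with product \<open>a\<close>, so they generate a dihedral group that has the
        subgroup of \<open>a\<close> as a proper subgroup and hence at least 6 elements.\<close>
      define y where "y = x \<otimes> a"
      have y: "y \<in> carrier G" "y \<notin> generate G {a}"
      proof -
        show "y \<in> carrier G" using a x by (simp add: y_def)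
        show "y \<notin> generate G {a}"
        proof
          assume "y \<in> generate G {a}"
          then have "x \<otimes> a \<otimes> inv a \<in> generate G {a}"
            using gen(2)[OF a] subgroup.m_closed[OF gen(1)[OF a]] subgroup.m_inv_closed[OF gen(1)[OF a]]
            unfolding y_def by blast
          then show False using a x by (simp add: m_assoc)
        qed
      qed
      have ne: "x \<noteq> \<one>" "y \<noteq> \<one>" using x y generate.one by metis+
      have "{x, y} \<subseteq> carrier G" using x y by simp
      note g = generate_members[OF this]
      have "x \<otimes> y = a" using sq[OF x] a x by (simp add: y_def m_assoc[symmetric])
      then have "a \<in> generate G {x, y}" using g(3) subgroup.m_closed[OF g(1)] by blast
      then have "generate G {a} \<subseteq> generate G {x, y}" using generate_subgroup_incl[OF _ g(1)] by simp
      moreover have "finite (generate G {x, y})" using fin g(4) by (auto intro: finite_subset)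
      ultimately have "card (generate G {x, y}) \<ge> 2 * ?o a"
        using card_ge_two_l_cosets[OF _ g(1) gen(1)[OF a]] x g(3) by blast
      then have c: "card (generate G {x, y}) \<ge> 5" using three by simp
      show ?thesis
        using ext[OF g(1) c rigid_on_dihedral[OF fin x(1) sq[OF x] ne(1) y(1) sq[OF y] ne(2) refl c]] .
    qed
  next
    case small
    have sq: "x \<otimes> x = \<one>" if x: "x \<in> carrier G" for x
    proof (rule ccontr)
      assume n: "x \<otimes> x \<noteq> \<one>"
      then have "x \<noteq> \<one>" by auto
      then have "card {\<one>, x, x \<otimes> x} = 3" using n x by (auto simp: card_insert_if)
      moreover have "{\<one>, x, x \<otimes> x} \<subseteq> generate G {x}"
        using gen[OF x] subgroup.m_closed[OF gen(1)[OF x]] generate.one by auto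
      moreover have "finite (generate G {x})" using gen(3)[OF x] fin finite_subset by blast
      ultimately have "?o x \<ge> 3" by (metis card_mono)
      then show False using small x by fastforce
    qed
    have ex: "\<exists>x\<in>carrier G. x \<notin> S" if "card S < 6" "finite S" for S
      using that six card_mono by (metis leD order_trans subsetI)
    obtain a where a: "a \<in> carrier G" "a \<noteq> \<one>" using ex[of "{\<one>}"] by auto
    obtain b where b: "b \<in> carrier G" "b \<notin> {\<one>, a}" using ex[of "{a, \<one>}"] a by auto
    have comm: "x \<otimes> y = y \<otimes> x" if "x \<in> carrier G" "y \<in> carrier G" for x y
    proof -
      have "inv z = z" if "z \<in> carrier G" for z using sq that by (simp add: inv_equality)
      then show ?thesis using that by (metis inv_mult_group m_closed)
    qed
    have S: "{a, b} \<subseteq> carrier G" using a b by simp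
    have "generate G {a, b} \<subseteq> {\<one>, a, b, a \<otimes> b}"
    proof
      fix z assume "z \<in> generate G {a, b}"
      then show "z \<in> {\<one>, a, b, a \<otimes> b}"
      proof induction
        case (inv h)
        then show ?case using sq a b by (auto simp: inv_equality)
      next
        case (eng h1 h2)
        have "b \<otimes> a = a \<otimes> b" "a \<otimes> b \<otimes> (a \<otimes> b) = \<one>" using a b comm sq by auto
        moreover have aab: "a \<otimes> (a \<otimes> b) = b" using sq a b by (simp flip: m_assoc)
        moreover have abb: "a \<otimes> b \<otimes> b = a" using sq a b by (simp add: m_assoc)
        moreover have "b \<otimes> (a \<otimes> b) = a" using a b abb comm[of b "a \<otimes> b"] by simp
        moreover have "a \<otimes> b \<otimes> a = b" using a b aab comm[of "a \<otimes> b" a] by simp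
        moreover have "a \<otimes> a = \<one>" "b \<otimes> b = \<one>" using sq a b by auto
        ultimately show ?case using eng.IH a b by (elim insertE emptyE) simp_all
      qed auto
    qed
    then have "card (generate G {a, b}) \<le> card {\<one>, a, b, a \<otimes> b}" by (intro card_mono) auto
    also have "\<dots> \<le> 4" by (simp add: card_insert_if)
    finally have "card (generate G {a, b}) < 6" by simp
    moreover have "finite (generate G {a, b})"
      using generate_in_carrier[OF S] fin by (auto intro: finite_subset)
    ultimately obtain c where c: "c \<in> carrier G" "c \<notin> generate G {a, b}" using ex by blast
    have "{a, b, c} \<subseteq> carrier G" using a b c by simp
    note sg = generate_is_subgroup[OF this]
    have "rigid_on (generate G {a, b, c}) {{\<one>, a}, {\<one>, a, b, c}, generate G {a, b, c} - {\<one>, b}}"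
      "card (generate G {a, b, c}) \<ge> 8"
      using rigid_on_elementary_abelian[OF fin sq a(1) b(1) c(1) a(2) _ _ c(2) refl] b by auto
    then show ?thesis using ext[OF sg] by simp
  qed
qed

end

section \<open>Groups of order three, four and five\<close>

context group
begin

text \<open>Once \<one> and \<open>a\<close> are fixed, the edges determine the walk around the
  cycle: injectivity excludes turning back, and \<open>a \<otimes> a \<noteq> \<one>\<close> makes
  the two neighbours of a point different.\<close>

lemma cyclic_edges_fix:
  assumes fin: "finite (carrier G)" and a: "a \<in> carrier G" and gen: "generate G {a} = carrier G"
    and aa: "a \<otimes> a \<noteq> \<one>" and inj: "inj_on \<phi> (carrier G)" and m: "\<phi> \<in> carrier G \<rightarrow> carrier G"
    and edge: "\<And>g. g \<in> carrier G \<Longrightarrow> \<exists>k\<in>carrier G. \<phi> ` (g <# {\<one>, a}) = k <# {\<one>, a}"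
    and fix1: "\<phi> \<one> = \<one>" "\<phi> a = a" and g: "g \<in> carrier G"
  shows "\<phi> g = g"
proof -
  have step: "\<phi> (g \<otimes> a \<otimes> a) = g \<otimes> a \<otimes> a"
    if g: "g \<in> carrier G" "\<phi> g = g" "\<phi> (g \<otimes> a) = g \<otimes> a" for g
  proof -
    obtain k where k: "k \<in> carrier G" "\<phi> ` ((g \<otimes> a) <# {\<one>, a}) = k <# {\<one>, a}"
      using edge[of "g \<otimes> a"] g a by auto
    then have "{g \<otimes> a, \<phi> (g \<otimes> a \<otimes> a)} = {k, k \<otimes> a}" using g a by (simp add: l_coset_image)
    moreover have "\<phi> (g \<otimes> a \<otimes> a) \<noteq> g"
      using inj_onD[OF inj, of "g \<otimes> a \<otimes> a" g] g a aa by (auto simp: m_assoc)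
    ultimately show ?thesis using k a g by (auto simp: doubleton_eq_iff)
  qed
  have pow: "\<phi> (a [^] n) = a [^] n \<and> \<phi> (a [^] n \<otimes> a) = a [^] n \<otimes> a" for n :: nat
    by (induction n) (use step a fix1 in auto)
  have "g \<in> {a [^] k | k. k \<in> (UNIV :: nat set)}"
    using g gen generate_pow_on_finite_carrier[OF fin a] by simp
  then show ?thesis using pow by auto
qed

lemma four_elements:
  assumes "card (carrier G) = 4" and sq: "\<And>x. x \<in> carrier G \<Longrightarrow> x \<otimes> x = \<one>"
  shows "\<exists>a\<in>carrier G. \<exists>b\<in>carrier G. a \<noteq> \<one> \<and> b \<noteq> \<one> \<and> b \<noteq> a \<and> a \<otimes> b = b \<otimes> a \<and>
    carrier G = {\<one>, a, b, a \<otimes> b} \<and> a \<otimes> b \<notin> {\<one>, a, b}"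
proof -
  have fin: "finite (carrier G)" using assms(1) by (metis card.infinite zero_neq_numeral)
  have ex: "\<exists>x\<in>carrier G. x \<notin> S" if "card S < 4" "finite S" for S
    using that assms(1) card_mono by (metis leD subsetI)
  obtain a where a: "a \<in> carrier G" "a \<noteq> \<one>" using ex[of "{\<one>}"] by auto
  obtain b where b: "b \<in> carrier G" "b \<noteq> \<one>" "b \<noteq> a" using ex[of "{a, \<one>}"] a by auto
  have "inv z = z" if "z \<in> carrier G" for z using sq that by (simp add: inv_equality)
  then have comm: "a \<otimes> b = b \<otimes> a" using a b by (metis inv_mult_group m_closed)
  have "a \<otimes> b \<noteq> a \<otimes> a" using a b by simp
  then have ab: "a \<otimes> b \<notin> {\<one>, a, b}" using a b sq by auto
  then have "card {\<one>, a, b, a \<otimes> b} = 4" using a b by auto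
  then have "carrier G = {\<one>, a, b, a \<otimes> b}"
    using fin a b assms(1) by (intro card_subset_eq[symmetric]) auto
  then show ?thesis using a b comm ab by blast
qed

text \<open>A divisor of 3, 4 or 5 that does not divide 2 is the number itself, so an element whose
  square is not \<one> generates. If there is none, an element of order 2 makes the group order
  even.\<close>

lemma cyclic_or_involutions:
  assumes c: "card (carrier G) \<in> {3, 4, 5}"
  shows "(\<exists>a\<in>carrier G. generate G {a} = carrier G \<and> a \<otimes> a \<noteq> \<one>)
    \<or> card (carrier G) = 4 \<and> (\<forall>x\<in>carrier G. x \<otimes> x = \<one>)"
proof (cases "\<exists>a\<in>carrier G. a \<otimes> a \<noteq> \<one>")
  case True
  have fin: "finite (carrier G)" using c by (auto intro: card_ge_0_finite)
  obtain a where a: "a \<in> carrier G" "a \<otimes> a \<noteq> \<one>" using True by blast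
  have "\<not> ord a dvd 2" using pow_eq_id[OF a(1), of 2] a by (simp add: numeral_eq_Suc)
  moreover have "ord a dvd card (carrier G)" using ord_dvd_group_order[OF a(1)] by (simp add: order_def)
  moreover have "k = n" if "k dvd n" "\<not> k dvd 2" "n \<in> {3, 4, 5}" for k n :: nat
  proof -
    have "k \<le> n" using that by (auto intro: dvd_imp_le)
    then have "k \<in> {0, 1, 2, 3, 4, 5}" using that(3) by auto
    then show ?thesis using that by (elim insertE emptyE) auto
  qed
  ultimately have "ord a = card (carrier G)" using c by blast
  then have "card (generate G {a}) = card (carrier G)" using generate_pow_card[OF a(1)] by simp
  then have "generate G {a} = carrier G"
    using fin a(1) by (intro card_subset_eq) (auto intro: generate_in_carrier[of "{a}"])
  then show ?thesis using a by blast
next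
  case False
  have fin: "finite (carrier G)" using c by (auto intro: card_ge_0_finite)
  have "card (carrier G) \<noteq> 1" using c by auto
  then have "carrier G \<noteq> {\<one>}" by auto
  then obtain a where a: "a \<in> carrier G" "a \<noteq> \<one>" by blast
  have "ord a dvd 2" using pow_eq_id[OF a(1), of 2] a False by (simp add: numeral_eq_Suc)
  moreover have "ord a \<noteq> 1" using a ord_eq_1 by simp
  moreover have "ord a \<le> 2" "ord a \<noteq> 0" using \<open>ord a dvd 2\<close> by (auto intro: dvd_imp_le intro!: Nat.gr0I)
  ultimately have "ord a = 2" by linarith
  then have "2 dvd card (carrier G)" using ord_dvd_group_order[OF a(1)] by (simp add: order_def)
  then have "card (carrier G) = 4" using c by auto
  then show ?thesis using False by blast
qed

end

section \<open>Permutation groups with normal point stabilizers\<close>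

text \<open>Normality is expressed by \<open>stabilizer_normal\<close>: that \<sigma> fixes
  \<open>\<tau> i\<close> means that \<open>inv' \<tau> \<circ> \<sigma> \<circ> \<tau>\<close>
  fixes \<open>i\<close>. In this form the condition passes to subgroups at once.\<close>

locale normal_stabilizers =
  fixes X :: "'a set" and A :: "('a \<Rightarrow> 'a) set"
  assumes finite_points: "finite X"
    and permutes: "\<sigma> \<in> A \<Longrightarrow> \<sigma> permutes X"
    and id_mem: "id \<in> A"
    and comp_mem: "\<sigma> \<in> A \<Longrightarrow> \<tau> \<in> A \<Longrightarrow> \<sigma> \<circ> \<tau> \<in> A"
    and inv_mem: "\<sigma> \<in> A \<Longrightarrow> inv' \<sigma> \<in> A"
    and stabilizer_normal: "\<sigma> \<in> A \<Longrightarrow> \<tau> \<in> A \<Longrightarrow> \<sigma> i = i \<Longrightarrow> \<sigma> (\<tau> i) = \<tau> i"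
begin

definition orbit :: "'a \<Rightarrow> 'a set" where
  "orbit i = (\<lambda>\<sigma>. \<sigma> i) ` A"

text \<open>Members are nonempty and proper so that, stacked on an initial segment of the chain,
  their sizes lie strictly between those of two consecutive segments.\<close>

definition chain_family :: "'a set \<Rightarrow> 'a set set \<Rightarrow> bool" where
  "chain_family B \<Z> \<longleftrightarrow> \<Z> \<noteq> {} \<and> (\<forall>Z\<in>\<Z>. Z \<noteq> {} \<and> Z \<subset> B) \<and> (\<forall>\<sigma>\<in>A. \<forall>Z\<in>\<Z>. \<sigma> ` Z \<in> \<Z>)"

definition preserves :: "'a set \<Rightarrow> 'a set set \<Rightarrow> ('a \<Rightarrow> 'a) \<Rightarrow> bool" where
  "preserves B \<Z> \<phi> \<longleftrightarrow> bij_betw \<phi> B B \<and> (\<forall>Z\<in>\<Z>. \<phi> ` Z \<in> \<Z>)"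

definition rigid_family :: "'a set \<Rightarrow> 'a set set \<Rightarrow> bool" where
  "rigid_family B \<Z> \<longleftrightarrow> (\<forall>\<phi>. preserves B \<Z> \<phi> \<longrightarrow> (\<exists>\<sigma>\<in>A. \<forall>y\<in>B. \<phi> y = \<sigma> y))"

definition cycle_on :: "('a \<Rightarrow> 'a) \<Rightarrow> 'a set \<Rightarrow> bool" where
  "cycle_on b B \<longleftrightarrow> card B \<in> {3, 4, 5} \<and> (\<exists>p\<in>B. B = range (\<lambda>k. (b ^^ k) p))"

text \<open>
  The orbits with group \<open>C\<^sub>3\<close>, \<open>C\<^sub>4\<close>, \<open>C\<^sub>5\<close>, \<open>K\<^sub>4\<close> have no rigid family. There \<open>\<Z>\<close> and \<open>S\<close> admit at
  most one nontrivial symmetry, and this moves \<open>S'\<close> as no element of the group does, except for a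
  full cycle.
\<close>

definition breaking_pair :: "'a set \<Rightarrow> 'a set set \<Rightarrow> 'a set \<Rightarrow> 'a set \<Rightarrow> bool" where
  "breaking_pair B \<Z> S S' \<longleftrightarrow> S \<subset> B \<and> S' \<subset> B \<and> S' \<noteq> {} \<and> card S = Suc (card S') \<and>
    (\<forall>\<phi> b. preserves B \<Z> \<phi> \<and> \<phi> ` S = S \<and> b \<in> A \<and> \<phi> ` S' = b ` S' \<longrightarrow>
       (\<forall>y\<in>B. \<phi> y = y) \<or> cycle_on b B)"

text \<open>The orbit is identified with the group acting on it, \<open>p\<close> being the unit. By normality of the
  stabilizers the choice of \<open>\<sigma>\<close> does not matter.\<close>

definition orbit_group :: "'a \<Rightarrow> 'a monoid" where
  "orbit_group p = \<lparr>carrier = orbit p, mult = (\<lambda>x y. (SOME \<sigma>. \<sigma> \<in> A \<and> \<sigma> p = x) y), one = p\<rparr>"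

section \<open>The group structure on an orbit\<close>

lemma inj_mem: "\<sigma> \<in> A \<Longrightarrow> inj \<sigma>"
  using permutes permutes_inj by blast

lemma inv_apply: "\<sigma> \<in> A \<Longrightarrow> inv' \<sigma> (\<sigma> x) = x" "\<sigma> \<in> A \<Longrightarrow> \<sigma> (inv' \<sigma> x) = x"
  using permutes permutes_inverses by metis+

lemma carrier_orbit_group [simp]: "carrier (orbit_group p) = orbit p"
  and one_orbit_group [simp]: "one (orbit_group p) = p"
  by (simp_all add: orbit_group_def)

text \<open>The permutation \<open>inv' \<tau> \<circ> \<sigma>\<close> fixes \<open>p\<close> and
  hence, by normality, every point of the orbit: the action on an orbit is regular.\<close>

lemma agree_on_orbit:
  assumes "\<sigma> \<in> A" "\<tau> \<in> A" "\<sigma> p = \<tau> p" "y \<in> orbit p"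
  shows "\<sigma> y = \<tau> y"
proof -
  obtain \<rho> where r: "\<rho> \<in> A" "y = \<rho> p" using assms by (auto simp: orbit_def)
  have "(inv' \<tau> \<circ> \<sigma>) p = p" using assms(3) inv_apply(1)[OF assms(2), of p] by simp
  then have "(inv' \<tau> \<circ> \<sigma>) (\<rho> p) = \<rho> p"
    using stabilizer_normal[OF comp_mem[OF inv_mem[OF assms(2)] assms(1)] r(1)] by blast
  then have "\<tau> (inv' \<tau> (\<sigma> y)) = \<tau> y" using r by simp
  then show ?thesis using inv_apply(2)[OF assms(2)] by simp
qed

lemma mult_orbit_group:
  assumes "\<sigma> \<in> A" "y \<in> orbit p"
  shows "\<sigma> p \<otimes>\<^bsub>orbit_group p\<^esub> y = \<sigma> y"
proof -
  define s where "s = (SOME \<tau>. \<tau> \<in> A \<and> \<tau> p = \<sigma> p)"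
  have "s \<in> A \<and> s p = \<sigma> p" unfolding s_def by (rule someI[of _ \<sigma>]) (use assms in simp)
  then have "s y = \<sigma> y" using agree_on_orbit assms by blast
  then show ?thesis by (simp add: orbit_group_def s_def)
qed

lemma base_in_orbit: "p \<in> orbit p"
  unfolding orbit_def by (rule image_eqI[OF _ id_mem]) simp

lemma orbit_closed:
  assumes s: "\<sigma> \<in> A" and y: "y \<in> orbit p"
  shows "\<sigma> y \<in> orbit p"
proof -
  obtain \<tau> where "\<tau> \<in> A" "y = \<tau> p" using y by (auto simp: orbit_def)
  then show ?thesis unfolding orbit_def by (intro image_eqI[OF _ comp_mem[OF s]]) auto
qed

lemma group_orbit_group: "group (orbit_group p)"
proof (rule groupI)
  fix x y assume x: "x \<in> carrier (orbit_group p)" and y: "y \<in> carrier (orbit_group p)"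
  then obtain \<sigma> where s: "\<sigma> \<in> A" "x = \<sigma> p" by (auto simp: orbit_def)
  then have xy: "x \<otimes>\<^bsub>orbit_group p\<^esub> y = \<sigma> y" using y mult_orbit_group by simp
  then show "x \<otimes>\<^bsub>orbit_group p\<^esub> y \<in> carrier (orbit_group p)" using s y orbit_closed by simp
  fix z assume z: "z \<in> carrier (orbit_group p)"
  obtain \<tau> where t: "\<tau> \<in> A" "y = \<tau> p" using y by (auto simp: orbit_def)
  have "x \<otimes>\<^bsub>orbit_group p\<^esub> y \<otimes>\<^bsub>orbit_group p\<^esub> z = (\<sigma> \<circ> \<tau>) z"
    using mult_orbit_group[of "\<sigma> \<circ> \<tau>" z p] xy s t z comp_mem by simp
  also have "\<dots> = x \<otimes>\<^bsub>orbit_group p\<^esub> (y \<otimes>\<^bsub>orbit_group p\<^esub> z)"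
    using s t z mult_orbit_group orbit_closed by simp
  finally show "x \<otimes>\<^bsub>orbit_group p\<^esub> y \<otimes>\<^bsub>orbit_group p\<^esub> z
    = x \<otimes>\<^bsub>orbit_group p\<^esub> (y \<otimes>\<^bsub>orbit_group p\<^esub> z)" .
next
  fix x assume x: "x \<in> carrier (orbit_group p)"
  then show "\<one>\<^bsub>orbit_group p\<^esub> \<otimes>\<^bsub>orbit_group p\<^esub> x = x"
    using mult_orbit_group[OF id_mem, of x p] by simp
  obtain \<sigma> where s: "\<sigma> \<in> A" "x = \<sigma> p" using x by (auto simp: orbit_def)
  have "inv' \<sigma> p \<otimes>\<^bsub>orbit_group p\<^esub> x = p"
    using mult_orbit_group[OF inv_mem[OF s(1)], of x p] x s inv_apply by simp
  moreover have "inv' \<sigma> p \<in> orbit p" using s inv_mem by (auto simp: orbit_def)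
  ultimately show "\<exists>y\<in>carrier (orbit_group p). y \<otimes>\<^bsub>orbit_group p\<^esub> x = \<one>\<^bsub>orbit_group p\<^esub>" by auto
qed (simp add: base_in_orbit)

lemma orbit_subset: "p \<in> X \<Longrightarrow> orbit p \<subseteq> X"
  using permutes permutes_in_image by (fastforce simp: orbit_def)

lemma orbit_image: "\<sigma> \<in> A \<Longrightarrow> \<sigma> ` orbit p = orbit p"
proof -
  assume s: "\<sigma> \<in> A"
  have "y \<in> \<sigma> ` orbit p" if "y \<in> orbit p" for y
  proof -
    have "inv' \<sigma> y \<in> orbit p" using orbit_closed[OF inv_mem[OF s] that] .
    then have "\<sigma> (inv' \<sigma> y) \<in> \<sigma> ` orbit p" by (rule imageI)
    then show ?thesis using inv_apply(2)[OF s] by simp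
  qed
  then show ?thesis using s orbit_closed by blast
qed

text \<open>Left translation in the orbit group is the action of \<open>A\<close>. This turns rigid
  families in the group into \<open>A\<close>-invariant families of subsets of the orbit.\<close>

lemma translate_as_image:
  assumes "\<sigma> \<in> A" "Z \<subseteq> orbit p"
  shows "\<sigma> p <#\<^bsub>orbit_group p\<^esub> Z = \<sigma> ` Z"
proof -
  have "\<sigma> p <#\<^bsub>orbit_group p\<^esub> Z = (\<lambda>z. \<sigma> p \<otimes>\<^bsub>orbit_group p\<^esub> z) ` Z"
    by (auto simp: l_coset_def)
  also have "\<dots> = \<sigma> ` Z" using assms by (intro image_cong refl mult_orbit_group) auto
  finally show ?thesis .
qed

lemma translates_orbit_group:
  assumes "Z \<subseteq> orbit p"
  shows "(\<exists>k\<in>orbit p. Y = k <#\<^bsub>orbit_group p\<^esub> Z) \<longleftrightarrow> (\<exists>\<sigma>\<in>A. Y = \<sigma> ` Z)"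
proof
  assume "\<exists>k\<in>orbit p. Y = k <#\<^bsub>orbit_group p\<^esub> Z"
  then obtain \<sigma> where "\<sigma> \<in> A" "Y = \<sigma> p <#\<^bsub>orbit_group p\<^esub> Z" by (auto simp: orbit_def)
  then show "\<exists>\<sigma>\<in>A. Y = \<sigma> ` Z" using translate_as_image[OF _ assms] by blast
next
  assume "\<exists>\<sigma>\<in>A. Y = \<sigma> ` Z"
  then obtain \<sigma> where "\<sigma> \<in> A" "Y = \<sigma> ` Z" by blast
  then show "\<exists>k\<in>orbit p. Y = k <#\<^bsub>orbit_group p\<^esub> Z"
    by (intro bexI[of _ "\<sigma> p"]) (simp_all add: translate_as_image[OF _ assms] orbit_closed base_in_orbit)
qed

section \<open>Families on a single orbit\<close>

lemma chain_family_images: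
  assumes "\<D> \<noteq> {}" "\<And>Z. Z \<in> \<D> \<Longrightarrow> Z \<noteq> {} \<and> Z \<subset> orbit p"
  shows "chain_family (orbit p) {\<sigma> ` Z | \<sigma> Z. \<sigma> \<in> A \<and> Z \<in> \<D>}"
  unfolding chain_family_def
proof (intro conjI ballI)
  show "{\<sigma> ` Z | \<sigma> Z. \<sigma> \<in> A \<and> Z \<in> \<D>} \<noteq> {}" using assms(1) id_mem by blast
next
  fix Y assume "Y \<in> {\<sigma> ` Z | \<sigma> Z. \<sigma> \<in> A \<and> Z \<in> \<D>}"
  then obtain \<sigma> Z where Y: "\<sigma> \<in> A" "Z \<in> \<D>" "Y = \<sigma> ` Z" by blast
  show "Y \<noteq> {}" using Y assms(2) by auto
  have "\<sigma> ` Z \<subset> \<sigma> ` orbit p"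
    using assms(2)[OF Y(2)] inj_mem[OF Y(1)] by (meson image_strict_mono inj_on_subset subset_UNIV)
  then show "Y \<subset> orbit p" using Y orbit_image by simp
next
  fix \<tau> Y assume t: "\<tau> \<in> A" and "Y \<in> {\<sigma> ` Z | \<sigma> Z. \<sigma> \<in> A \<and> Z \<in> \<D>}"
  then obtain \<sigma> Z where Y: "\<sigma> \<in> A" "Z \<in> \<D>" "Y = \<sigma> ` Z" by blast
  then have "\<tau> ` Y = (\<tau> \<circ> \<sigma>) ` Z" by (simp add: image_comp)
  then show "\<tau> ` Y \<in> {\<sigma> ` Z | \<sigma> Z. \<sigma> \<in> A \<and> Z \<in> \<D>}" using comp_mem[OF t Y(1)] Y(2) by blast
qed

lemma orbit_family_large:
  assumes p: "p \<in> X" and six: "card (orbit p) \<ge> 6"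
  shows "\<exists>\<Z>. chain_family (orbit p) \<Z> \<and> rigid_family (orbit p) \<Z>"
proof -
  interpret G: group "orbit_group p" by (rule group_orbit_group)
  have fin: "finite (orbit p)" using orbit_subset[OF p] finite_points finite_subset by blast
  obtain \<D> where D: "G.rigid_on (orbit p) \<D>" using G.rigid_on_carrier_exists fin six by auto
  define \<Z> where "\<Z> = {\<sigma> ` Z | \<sigma> Z. \<sigma> \<in> A \<and> Z \<in> \<D>}"
  have DO: "Z \<noteq> {}" "Z \<subset> orbit p" if "Z \<in> \<D>" for Z using D that by (auto simp: G.rigid_on_def)
  have "\<D> \<noteq> {}" using D by (simp add: G.rigid_on_def)
  then have chain: "chain_family (orbit p) \<Z>" unfolding \<Z>_def using DO by (intro chain_family_images) auto
  have "rigid_family (orbit p) \<Z>" unfolding rigid_family_def preserves_def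
  proof (intro allI impI)
    fix \<phi> assume \<phi>: "bij_betw \<phi> (orbit p) (orbit p) \<and> (\<forall>Z\<in>\<Z>. \<phi> ` Z \<in> \<Z>)"
    have "\<exists>k'\<in>orbit p. \<exists>Z'\<in>\<D>. \<phi> ` (k <#\<^bsub>orbit_group p\<^esub> Z) = k' <#\<^bsub>orbit_group p\<^esub> Z'"
      if k: "k \<in> orbit p" and Z: "Z \<in> \<D>" for k Z
    proof -
      obtain \<sigma> where s: "\<sigma> \<in> A" "k = \<sigma> p" using k by (auto simp: orbit_def)
      then have kZ: "k <#\<^bsub>orbit_group p\<^esub> Z = \<sigma> ` Z" using translate_as_image DO[OF Z] by auto
      have "\<sigma> ` Z \<in> \<Z>" using s Z unfolding \<Z>_def by blast
      then have "\<phi> ` (\<sigma> ` Z) \<in> \<Z>" using \<phi> by blast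
      then obtain \<tau> Z' where t: "\<phi> ` (\<sigma> ` Z) = \<tau> ` Z'" "\<tau> \<in> A" "Z' \<in> \<D>" by (auto simp: \<Z>_def)
      then have "\<tau> p <#\<^bsub>orbit_group p\<^esub> Z' = \<tau> ` Z'" using translate_as_image DO[of Z'] by auto
      then show ?thesis using t kZ by (metis imageI orbit_def)
    qed
    then have "G.translates_onto \<phi> (orbit p) \<D>" using \<phi> by (simp add: G.translates_onto_def)
    then have rc: "G.right_commuting \<phi> (orbit p) (orbit p)" using D by (simp add: G.rigid_on_def)
    \<comment> \<open>At the unit \<open>p\<close>, commutation reads
      \<open>\<phi> y = \<phi> p \<otimes> y\<close>, so \<phi> agrees on the orbit with any element
      of \<open>A\<close> that moves \<open>p\<close> to \<open>\<phi> p\<close>.\<close>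
    have fp: "\<phi> p \<in> orbit p" using \<phi> base_in_orbit by (auto simp: bij_betw_def)
    then obtain \<sigma> where s: "\<sigma> \<in> A" "\<phi> p = \<sigma> p" by (auto simp: orbit_def)
    have "\<phi> y = \<sigma> y" if y: "y \<in> orbit p" for y
    proof -
      have "\<phi> (p \<otimes>\<^bsub>orbit_group p\<^esub> y) = \<phi> p \<otimes>\<^bsub>orbit_group p\<^esub> y"
        using rc base_in_orbit y by (auto simp: G.right_commuting_def)
      then show ?thesis using G.l_one[of y] y s mult_orbit_group[OF s(1) y] by simp
    qed
    then show "\<exists>\<sigma>\<in>A. \<forall>y\<in>orbit p. \<phi> y = \<sigma> y" using s by blast
  qed
  then show ?thesis using chain by blast
qed

text \<open>Both bijections of a two-point orbit come from \<open>A\<close>, so nothing has to be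
  excluded and the singletons do.\<close>

lemma orbit_family_two:
  assumes two: "card (orbit p) = 2"
  shows "\<exists>\<Z>. chain_family (orbit p) \<Z> \<and> rigid_family (orbit p) \<Z>"
proof -
  obtain x y where xy: "orbit p = {x, y}" "x \<noteq> y" using two by (auto simp: card_2_iff)
  obtain q where q: "orbit p = {p, q}" "p \<noteq> q"
  proof (cases "p = x")
    case True
    then show thesis using that[of y] xy by simp
  next
    case False
    then have py: "p = y" using base_in_orbit[of p] xy(1) by simp
    have "orbit p = {p, x}" using xy(1) py by blast
    then show thesis using that False by blast
  qed
  let ?Z = "{{p}, {q}}"
  have "chain_family (orbit p) ?Z"
    unfolding chain_family_def
  proof (intro conjI ballI)
    fix \<sigma> Z assume "\<sigma> \<in> A" "Z \<in> ?Z"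
    then show "\<sigma> ` Z \<in> ?Z" using orbit_closed[of \<sigma> p p] orbit_closed[of \<sigma> q p] q by auto
  qed (use q in auto)
  moreover have "rigid_family (orbit p) ?Z" unfolding rigid_family_def preserves_def
  proof (intro allI impI)
    fix \<phi> assume "bij_betw \<phi> (orbit p) (orbit p) \<and> (\<forall>Z\<in>?Z. \<phi> ` Z \<in> ?Z)"
    then have \<phi>: "\<phi> p \<in> orbit p" "\<phi> q \<in> {p, q}" "\<phi> p \<noteq> \<phi> q" "\<phi> p \<in> {p, q}"
      using q by (auto simp: bij_betw_def)
    then obtain \<sigma> where s: "\<sigma> \<in> A" "\<phi> p = \<sigma> p" by (auto simp: orbit_def)
    have "\<sigma> q \<in> {p, q}" "\<sigma> p \<noteq> \<sigma> q" using s orbit_closed[of \<sigma> q p] q inj_mem by (auto dest: injD)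
    then have "\<phi> q = \<sigma> q" using \<phi> s by auto
    then show "\<exists>\<sigma>\<in>A. \<forall>y\<in>orbit p. \<phi> y = \<sigma> y" using s q by auto
  qed
  ultimately show ?thesis by blast
qed

text \<open>The members of \<open>\<Z>\<close> are the edges of a cycle, whose symmetries form the
  dihedral group. With \<open>S = {p, a}\<close> and \<open>S' = {p}\<close>, the only nontrivial
  symmetry that keeps \<open>S\<close> swaps \<open>p\<close> and \<open>a\<close>; a group element
  that also moves \<open>p\<close> to \<open>a\<close> is the rotation by \<open>a\<close>, a full
  cycle.\<close>

lemma orbit_family_cyclic:
  assumes p: "p \<in> X" and c: "card (orbit p) \<in> {3, 4, 5}"
    and a: "a \<in> orbit p" "generate (orbit_group p) {a} = orbit p" "a \<otimes>\<^bsub>orbit_group p\<^esub> a \<noteq> p"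
  shows "\<exists>\<Z> S S'. chain_family (orbit p) \<Z> \<and> breaking_pair (orbit p) \<Z> S S' \<and> (\<exists>b\<in>A. cycle_on b (orbit p))"
proof -
  interpret G: group "orbit_group p" by (rule group_orbit_group)
  have fin: "finite (orbit p)" using orbit_subset[OF p] finite_points finite_subset by blast
  have ap: "a \<noteq> p" using a(3) G.l_one[of p] base_in_orbit by auto
  define \<Z> where "\<Z> = {\<sigma> ` {p, a} | \<sigma>. \<sigma> \<in> A}"
  have sub: "{p, a} \<subseteq> orbit p" using a base_in_orbit by auto
  have "card {p, a} = 2" using ap by simp
  then have "{p, a} \<noteq> orbit p" using c by auto
  then have psub: "{p, a} \<subset> orbit p" using sub by blast
  have \<Z>: "\<Z> = {\<sigma> ` Z | \<sigma> Z. \<sigma> \<in> A \<and> Z \<in> {{p, a}}}" by (auto simp: \<Z>_def)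
  have chain: "chain_family (orbit p) \<Z>" unfolding \<Z> using psub by (intro chain_family_images) auto
  have cyc: "cycle_on b (orbit p)" if b: "b \<in> A" "b p = a" for b
  proof -
    have bk: "(b ^^ k) p = a [^]\<^bsub>orbit_group p\<^esub> k" for k
    proof (induction k)
      case (Suc k)
      have "a [^]\<^bsub>orbit_group p\<^esub> k \<in> orbit p" using G.nat_pow_closed[of a] a by simp
      then have "b (a [^]\<^bsub>orbit_group p\<^esub> k) = a \<otimes>\<^bsub>orbit_group p\<^esub> a [^]\<^bsub>orbit_group p\<^esub> k"
        using mult_orbit_group[OF b(1), of "a [^]\<^bsub>orbit_group p\<^esub> k" p] b by simp
      then show ?case using Suc G.nat_pow_Suc2[of a] a by simp
    qed simp
    have "orbit p = {a [^]\<^bsub>orbit_group p\<^esub> k | k. k \<in> (UNIV :: nat set)}"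
      using G.generate_pow_on_finite_carrier[of a] a fin by simp
    then have "orbit p = range (\<lambda>k. (b ^^ k) p)" using bk by auto
    then show ?thesis using c base_in_orbit unfolding cycle_on_def by blast
  qed
  obtain b where b: "b \<in> A" "b p = a" using a by (auto simp: orbit_def)
  have "breaking_pair (orbit p) \<Z> {p, a} {p}" unfolding breaking_pair_def
  proof (intro conjI allI impI)
    have "card (orbit p) \<noteq> card {p}" using c by auto
    then have "{p} \<noteq> orbit p" by metis
    then show "{p} \<subset> orbit p" using base_in_orbit by blast
    fix \<phi> b
    assume *: "preserves (orbit p) \<Z> \<phi> \<and> \<phi> ` {p, a} = {p, a} \<and> b \<in> A \<and> \<phi> ` {p} = b ` {p}"
    then have bij: "bij_betw \<phi> (orbit p) (orbit p)" and pres: "\<And>Z. Z \<in> \<Z> \<Longrightarrow> \<phi> ` Z \<in> \<Z>"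
      by (auto simp: preserves_def)
    consider "\<phi> p = a" | "\<phi> p = p" "\<phi> a = a" using * ap by (auto simp: doubleton_eq_iff)
    then show "(\<forall>y\<in>orbit p. \<phi> y = y) \<or> cycle_on b (orbit p)"
    proof cases
      case 1
      then show ?thesis using * cyc by auto
    next
      case 2
      have edge: "\<exists>k\<in>orbit p. \<phi> ` (g <#\<^bsub>orbit_group p\<^esub> {p, a}) = k <#\<^bsub>orbit_group p\<^esub> {p, a}"
        if g: "g \<in> orbit p" for g
      proof -
        obtain \<sigma> where s: "\<sigma> \<in> A" "g = \<sigma> p" using g by (auto simp: orbit_def)
        have "\<phi> ` (g <#\<^bsub>orbit_group p\<^esub> {p, a}) \<in> \<Z>"
          using pres[of "\<sigma> ` {p, a}"] s translate_as_image[OF s(1) sub] by (auto simp: \<Z>_def)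
        then show ?thesis unfolding \<Z>_def using translates_orbit_group[OF sub] by auto
      qed
      have "\<phi> y = y" if "y \<in> orbit p" for y
      proof (rule G.cyclic_edges_fix[of a])
        show "inj_on \<phi> (carrier (orbit_group p))" "\<phi> \<in> carrier (orbit_group p) \<rightarrow> carrier (orbit_group p)"
          using bij by (auto simp: bij_betw_def)
      qed (use fin a edge 2 that in simp_all)
      then show ?thesis by blast
    qed
  qed (use psub ap in auto)
  then show ?thesis using chain cyc b by blast
qed

text \<open>Here \<open>\<Z>\<close> is a partition into two pairs. A symmetry that keeps
  \<open>S = {p, a, b}\<close> fixes the fourth point and its partner \<open>b\<close>, so it can at
  most swap \<open>p\<close> and \<open>a\<close>. The swap carries \<open>S' = {p, b}\<close> to
  \<open>{a, b}\<close>, whereas the images of \<open>S'\<close> under the group are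
  \<open>{p, b}\<close> and \<open>{a, a \<otimes> b}\<close>. The size of \<open>S\<close> and the
  involutivity are recorded for the case that this is the only nontrivial orbit.\<close>

lemma orbit_family_klein:
  assumes p: "p \<in> X" and c: "card (orbit p) = 4"
    and sq: "\<And>x. x \<in> orbit p \<Longrightarrow> x \<otimes>\<^bsub>orbit_group p\<^esub> x = p"
  shows "\<exists>\<Z> S S'. chain_family (orbit p) \<Z> \<and> breaking_pair (orbit p) \<Z> S S' \<and> card S = 3 \<and>
    (\<forall>\<sigma>\<in>A. \<forall>y\<in>orbit p. \<sigma> (\<sigma> y) = y)"
proof -
  interpret G: group "orbit_group p" by (rule group_orbit_group)
  let ?m = "\<lambda>x y. x \<otimes>\<^bsub>orbit_group p\<^esub> y"
  have "\<exists>a\<in>orbit p. \<exists>b\<in>orbit p. a \<noteq> p \<and> b \<noteq> p \<and> b \<noteq> a \<and> ?m a b = ?m b a \<and>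
    orbit p = {p, a, b, ?m a b} \<and> ?m a b \<notin> {p, a, b}"
    unfolding carrier_orbit_group[symmetric] by (rule G.four_elements[unfolded one_orbit_group]) (simp_all add: c sq)
  then obtain a b where ab: "a \<in> orbit p" "b \<in> orbit p" "a \<noteq> p" "b \<noteq> p" "b \<noteq> a" "?m a b = ?m b a"
    "orbit p = {p, a, b, ?m a b}" "?m a b \<notin> {p, a, b}"
    by (elim bexE conjE) (rule that)
  have inv2: "\<sigma> (\<sigma> y) = y" if s: "\<sigma> \<in> A" and y: "y \<in> orbit p" for \<sigma> y
  proof -
    have sp: "\<sigma> p \<in> orbit p" using s by (auto simp: orbit_def)
    have "\<sigma> (\<sigma> y) = ?m (\<sigma> p) (?m (\<sigma> p) y)"
      using mult_orbit_group[OF s] y orbit_closed[OF s y] by simp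
    also have "\<dots> = ?m (?m (\<sigma> p) (\<sigma> p)) y" using G.m_assoc[of "\<sigma> p" "\<sigma> p" y] sp y by simp
    also have "\<dots> = y" using sq[OF sp] G.l_one[of y] y by simp
    finally show ?thesis .
  qed
  define \<Z> where "\<Z> = {{p, a}, {b, ?m a b}}"
  have tr: "\<sigma> p = p \<and> \<sigma> a = a \<and> \<sigma> b = b \<and> \<sigma> (?m a b) = ?m a b
    \<or> \<sigma> p = a \<and> \<sigma> a = p \<and> \<sigma> b = ?m a b \<and> \<sigma> (?m a b) = b
    \<or> \<sigma> p = b \<and> \<sigma> a = ?m a b \<and> \<sigma> b = p \<and> \<sigma> (?m a b) = a
    \<or> \<sigma> p = ?m a b \<and> \<sigma> a = b \<and> \<sigma> b = a \<and> \<sigma> (?m a b) = p" if s: "\<sigma> \<in> A" for \<sigma>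
  proof -
    have sp: "\<sigma> p \<in> {p, a, b, ?m a b}" using s ab(7) by (auto simp: orbit_def)
    have v: "\<sigma> y = ?m (\<sigma> p) y" if "y \<in> orbit p" for y by (rule mult_orbit_group[OF s that, symmetric])
    have carr: "a \<in> carrier (orbit_group p)" "b \<in> carrier (orbit_group p)" using ab(1,2) by simp_all
    have ba: "?m b a = ?m a b" using ab(6) by (rule sym)
    have aa: "?m a a = p" "?m b b = p" using sq ab(1,2) by simp_all
    have e: "?m a (?m a b) = b" using G.m_assoc[OF carr(1,1,2)] aa carr G.l_one[OF carr(2)] by simp
    have e2: "?m b (?m a b) = a" using G.m_assoc[OF carr(2,2,1)] aa carr G.l_one[OF carr(1)] ba by simp
    have e3: "?m (?m a b) a = b" using G.m_assoc[OF carr(1,2,1)] e ba by simp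
    have e4: "?m (?m a b) b = a"
      using G.m_assoc[OF carr(1,2,2)] aa G.r_one[OF carr(1)] by simp
    have m: "?m a b \<in> orbit p" using G.m_closed[OF carr] by simp
    have e5: "?m (?m a b) (?m a b) = p" using sq[OF m] .
    have l1: "?m p a = a" "?m p b = b" "?m p (?m a b) = ?m a b"
      using G.l_one[of a] G.l_one[of b] G.l_one[of "?m a b"] ab(1,2) m by simp_all
    have vs: "\<sigma> a = ?m (\<sigma> p) a" "\<sigma> b = ?m (\<sigma> p) b" "\<sigma> (?m a b) = ?m (\<sigma> p) (?m a b)"
      by (rule v[OF ab(1)] v[OF ab(2)] v[OF m])+
    consider "\<sigma> p = p" | "\<sigma> p = a" | "\<sigma> p = b" | "\<sigma> p = ?m a b" using sp by blast
    then show ?thesis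
    proof cases
      case 1
      show ?thesis by (rule disjI1) (use vs[unfolded 1] 1 l1 in simp)
    next
      case 2
      show ?thesis by (rule disjI2, rule disjI1) (use vs[unfolded 2] 2 aa e in simp)
    next
      case 3
      show ?thesis by (rule disjI2, rule disjI2, rule disjI1) (use vs[unfolded 3] 3 aa ba e2 in simp)
    next
      case 4
      show ?thesis by (rule disjI2, rule disjI2, rule disjI2) (use vs[unfolded 4] 4 e3 e4 e5 in simp)
    qed
  qed
  define c where "c = ?m a b"
  have O: "orbit p = {p, a, b, c}" and ne: "a \<noteq> p" "b \<noteq> p" "b \<noteq> a" "c \<noteq> p" "c \<noteq> a" "c \<noteq> b"
    using ab(3-5,7,8) unfolding c_def[symmetric] by simp_all
  note tr = tr[folded c_def] and \<Z>_def = \<Z>_def[folded c_def]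
  have chain: "chain_family (orbit p) \<Z>" unfolding chain_family_def
  proof (intro conjI ballI)
    fix \<sigma> Z assume s: "\<sigma> \<in> A" and Z: "Z \<in> \<Z>"
    have m: "{p, a} \<in> \<Z>" "{a, p} \<in> \<Z>" "{b, c} \<in> \<Z>" "{c, b} \<in> \<Z>"
      by (simp_all add: \<Z>_def doubleton_eq_iff)
    have "{\<sigma> p, \<sigma> a} \<in> \<Z> \<and> {\<sigma> b, \<sigma> c} \<in> \<Z>"
      using tr[OF s] by (elim disjE conjE) (simp_all only: m simp_thms)
    then show "\<sigma> ` Z \<in> \<Z>" using Z by (auto simp: \<Z>_def)
  qed (use O ne in \<open>auto simp: \<Z>_def\<close>)
  have "breaking_pair (orbit p) \<Z> {p, a, b} {p, b}" unfolding breaking_pair_def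
  proof (intro conjI allI impI)
    show "{p, a, b} \<subset> orbit p" "{p, b} \<subset> orbit p" using O ne by auto
    show "card {p, a, b} = Suc (card {p, b})" using ne by auto
    fix \<phi> \<sigma>
    assume *: "preserves (orbit p) \<Z> \<phi> \<and> \<phi> ` {p, a, b} = {p, a, b} \<and> \<sigma> \<in> A \<and> \<phi> ` {p, b} = \<sigma> ` {p, b}"
    then have bij: "inj_on \<phi> (orbit p)" "\<phi> ` orbit p = orbit p" and pres: "\<phi> ` {b, c} \<in> \<Z>"
      by (auto simp: preserves_def bij_betw_def \<Z>_def)
    have "\<phi> c \<notin> \<phi> ` {p, a, b}"
    proof
      assume "\<phi> c \<in> \<phi> ` {p, a, b}"
      then obtain z where "z \<in> {p, a, b}" "\<phi> c = \<phi> z" by blast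
      then show False using inj_onD[OF bij(1), of c z] O ne by auto
    qed
    moreover have "\<phi> c \<in> {p, a, b, c}" using bij(2) unfolding O by blast
    ultimately have f1: "\<phi> c = c" using * by auto
    have "{\<phi> b, c} \<in> \<Z>" using pres f1 by simp
    then have f2: "\<phi> b = b" using ne by (auto simp: \<Z>_def doubleton_eq_iff)
    have "\<phi> p \<in> {p, a, b}" "\<phi> a \<in> {p, a, b}" using * by blast+
    moreover have "\<phi> p \<noteq> \<phi> b" "\<phi> a \<noteq> \<phi> b" "\<phi> p \<noteq> \<phi> a"
      using inj_onD[OF bij(1), of p b] inj_onD[OF bij(1), of a b] inj_onD[OF bij(1), of p a] O ne by auto
    ultimately consider "\<phi> p = p" "\<phi> a = a" | "\<phi> p = a" using f2 by auto
    then have "\<forall>y\<in>orbit p. \<phi> y = y"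
    proof cases
      case 1
      then show ?thesis using f1 f2 unfolding O by simp
    next
      case 2
      then have ab': "{a, b} = {\<sigma> p, \<sigma> b}" and s: "\<sigma> \<in> A" using * f2 by auto
      have "\<sigma> p = a \<or> \<sigma> p = b" "\<sigma> b = a \<or> \<sigma> b = b" using ab' by blast+
      then show ?thesis using tr[OF s] ne by metis
    qed
    then show "(\<forall>y\<in>orbit p. \<phi> y = y) \<or> cycle_on \<sigma> (orbit p)" by blast
  qed simp
  moreover have "card {p, a, b} = 3" using ne by auto
  ultimately show ?thesis using chain inv2 by blast
qed

lemma orbit_family:
  assumes p: "p \<in> X" and c: "card (orbit p) \<ge> 2"
  shows "\<exists>\<Z>. chain_family (orbit p) \<Z> \<and> (rigid_family (orbit p) \<Z> \<or>
    (\<exists>S S'. breaking_pair (orbit p) \<Z> S S' \<and> ((\<exists>b\<in>A. cycle_on b (orbit p)) \<or>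
       card (orbit p) = 4 \<and> card S = 3 \<and> (\<forall>\<sigma>\<in>A. \<forall>y\<in>orbit p. \<sigma> (\<sigma> y) = y))))"
proof -
  interpret G: group "orbit_group p" by (rule group_orbit_group)
  consider "card (orbit p) = 2" | "card (orbit p) \<ge> 6" | "card (orbit p) \<in> {3, 4, 5}" using c by force
  then show ?thesis
  proof cases
    case 1
    then show ?thesis using orbit_family_two by blast
  next
    case 2
    then show ?thesis using orbit_family_large[OF p] by blast
  next
    case 3
    then consider a where "a \<in> orbit p" "generate (orbit_group p) {a} = orbit p" "a \<otimes>\<^bsub>orbit_group p\<^esub> a \<noteq> p"
      | "card (orbit p) = 4" "\<And>x. x \<in> orbit p \<Longrightarrow> x \<otimes>\<^bsub>orbit_group p\<^esub> x = p"
      using G.cyclic_or_involutions by auto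
    then show ?thesis
    proof cases
      case 1
      then show ?thesis using orbit_family_cyclic[OF p 3] by blast
    next
      case 2
      then show ?thesis using orbit_family_klein[OF p] by metis
    qed
  qed
qed

end

section \<open>Chains of blocks\<close>

text \<open>
  The points \<open>fs\<close> and the blocks \<open>bs\<close> are stacked, and the sets used for a block contain everything
  below it. So a size determines the block, and the sizes of the initial segments become available
  for the extra sets \<open>\<G>\<close>: an initial segment whose size is in \<open>T\<close> is dropped. It is the intersection
  of the sets just above it and the union of the sets just below it; since \<open>T\<close> contains at most two
  consecutive sizes, one of these two descriptions does not involve \<open>T\<close>.
\<close>

locale block_chain =
  fixes fs :: "'a list" and bs :: "'a set list" and \<Z> :: "'a set \<Rightarrow> 'a set set"
    and \<G> :: "'a set set" and T :: "nat set" and w :: nat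
  assumes distinct_fs: "distinct fs"
    and finite_block: "B \<in> set bs \<Longrightarrow> finite B"
    and disjoint_blocks: "i < length bs \<Longrightarrow> j < length bs \<Longrightarrow> i \<noteq> j \<Longrightarrow> bs ! i \<inter> bs ! j = {}"
    and disjoint_fs: "B \<in> set bs \<Longrightarrow> B \<inter> set fs = {}"
    and family_nonempty: "B \<in> set bs \<Longrightarrow> \<Z> B \<noteq> {}"
    and family_proper: "B \<in> set bs \<Longrightarrow> Z \<in> \<Z> B \<Longrightarrow> Z \<noteq> {} \<and> Z \<subset> B"
    and family_spread: "B \<in> set bs \<Longrightarrow> Z \<in> \<Z> B \<Longrightarrow>
      \<Union>{Y \<in> \<Z> B. card Y = card Z} = B \<and> \<Inter>{Y \<in> \<Z> B. card Y = card Z} = {}"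
    and extra_card: "Y \<in> \<G> \<Longrightarrow> card Y \<in> T"
    and sizes_T: "T \<subseteq> {w, Suc w}"
    and large_T: "t \<in> T \<Longrightarrow> t > length fs"
begin

definition initial :: "nat \<Rightarrow> 'a set" where
  "initial j = set fs \<union> \<Union>(set (take j bs))"

text \<open>All of \<open>set fs\<close> appears as \<open>initial 0\<close>, and
  \<open>initial (length bs)\<close> is the set of all points, which every permutation preserves;
  hence the strict bounds.\<close>

definition chain :: "'a set set" where
  "chain = (\<lambda>j. set (take j fs)) ` {1..<length fs} \<union>
     {initial j | j. j < length bs \<and> card (initial j) \<notin> T} \<union>
     {initial j \<union> Z | j Z. j < length bs \<and> Z \<in> \<Z> (bs ! j)} \<union> \<G>"

definition points :: "'a set" where
  "points = set fs \<union> \<Union>(set bs)"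

section \<open>Sizes of the sets in a chain\<close>

lemma finite_initial [simp]: "finite (initial j)"
  using finite_block set_take_subset by (fastforce simp: initial_def)

lemma initial_0: "initial 0 = set fs" "card (initial 0) = length fs"
  by (simp_all add: initial_def distinct_card distinct_fs)

lemma initial_Suc: "j < length bs \<Longrightarrow> initial (Suc j) = initial j \<union> bs ! j"
  by (auto simp: initial_def take_Suc_conv_app_nth)

lemma initial_length: "initial (length bs) = points"
  by (simp add: initial_def points_def)

lemma block_disjoint_initial:
  assumes j: "j < length bs"
  shows "bs ! j \<inter> initial j = {}"
proof -
  have "bs ! j \<inter> B = {}" if B: "B \<in> set (take j bs)" for B
  proof -
    obtain i where "i < length (take j bs)" "take j bs ! i = B" using B unfolding in_set_conv_nth by blast
    then have "i < j" "B = bs ! i" by auto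
    then show ?thesis using disjoint_blocks[of j i] j by auto
  qed
  then show ?thesis using disjoint_fs[of "bs ! j"] j by (auto simp: initial_def)
qed

lemma card_between:
  assumes j: "j < length bs" and Z: "Z \<noteq> {}" "Z \<subset> bs ! j"
  shows "card (initial j) < card (initial j \<union> Z)" "card (initial j \<union> Z) < card (initial (Suc j))"
proof -
  have d: "Z \<inter> initial j = {}" using Z block_disjoint_initial[OF j] by auto
  have f: "finite (bs ! j)" using finite_block j by simp
  then have "finite Z" using Z by (auto intro: finite_subset)
  then show "card (initial j) < card (initial j \<union> Z)" using d Z
    by (intro psubset_card_mono) auto
  show "card (initial j \<union> Z) < card (initial (Suc j))"
    using Z f block_disjoint_initial[OF j] initial_Suc[OF j] by (intro psubset_card_mono) auto
qed

lemma card_initial_less_Suc: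
  assumes j: "j < length bs"
  shows "card (initial j) < card (initial (Suc j))"
proof -
  obtain Z where "Z \<in> \<Z> (bs ! j)" using family_nonempty[of "bs ! j"] j by auto
  then have "Z \<noteq> {}" "Z \<subset> bs ! j" using family_proper[of "bs ! j" Z] j by auto
  then show ?thesis using card_between[OF j, of Z] by linarith
qed

lemma card_initial_less: "i < j \<Longrightarrow> j \<le> length bs \<Longrightarrow> card (initial i) < card (initial j)"
proof (induction j)
  case (Suc j)
  then have "card (initial j) < card (initial (Suc j))" by (intro card_initial_less_Suc) simp
  then show ?case using Suc by (cases "i = j") auto
qed simp

lemma card_initial_ge: "j \<le> length bs \<Longrightarrow> length fs \<le> card (initial j)"
  using card_initial_less[of 0 j] initial_0 by (cases "j = 0") auto

lemma gap_unique:
  assumes i: "i < length bs" and j: "j < length bs"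
    and a: "card (initial i) < n" "n < card (initial (Suc i))"
    and b: "card (initial j) < n" "n < card (initial (Suc j))"
  shows "i = j"
proof (rule ccontr)
  assume "i \<noteq> j"
  then consider "Suc i \<le> j" | "Suc j \<le> i" by linarith
  then show False
  proof cases
    case 1
    then have "card (initial (Suc i)) \<le> card (initial j)"
      using card_initial_less[of "Suc i" j] j by (cases "Suc i = j") auto
    then show False using a b by linarith
  next
    case 2
    then have "card (initial (Suc j)) \<le> card (initial i)"
      using card_initial_less[of "Suc j" i] i by (cases "Suc j = i") auto
    then show False using a b by linarith
  qed
qed

lemma gap_not_initial:
  assumes i: "i < length bs" and j: "j \<le> length bs"
    and a: "card (initial i) < n" "n < card (initial (Suc i))"
  shows "n \<noteq> card (initial j)"
proof -
  consider "j = i" | "j < i" | "j = Suc i" | "Suc i < j" by linarith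
  then show ?thesis using a card_initial_less[of j i] card_initial_less[of "Suc i" j] i j by cases auto
qed

lemma chain_cases:
  assumes "Y \<in> chain"
  obtains (fixed) j where "1 \<le> j" "j < length fs" "Y = set (take j fs)" "card Y = j"
  | (initial) j where "j < length bs" "card (initial j) \<notin> T" "Y = initial j"
  | (block) j Z where "j < length bs" "Z \<in> \<Z> (bs ! j)" "Y = initial j \<union> Z"
      "card (initial j) < card Y" "card Y < card (initial (Suc j))"
  | (extra) "Y \<in> \<G>" "card Y \<in> T"
proof -
  consider (a) j where "1 \<le> j" "j < length fs" "Y = set (take j fs)"
    | (b) j where "j < length bs" "card (initial j) \<notin> T" "Y = initial j"
    | (c) j Z where "j < length bs" "Z \<in> \<Z> (bs ! j)" "Y = initial j \<union> Z" | (d) "Y \<in> \<G>"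
    using assms unfolding chain_def by force
  then show thesis
  proof cases
    case (a j)
    then show thesis using fixed[of j] distinct_fs by (simp add: distinct_card)
  next
    case (b j)
    then show thesis using initial by blast
  next
    case (c j Z)
    then show thesis
      using block[OF c] family_proper[of "bs ! j" Z] card_between[of j Z] by simp
  next
    case d
    then show thesis using extra extra_card by blast
  qed
qed

end

text \<open>Extra sets may have the size of a set of some block, so they are separated from it by
  shape, through \<open>extra_not_block\<close>. That condition ranges over all nonempty proper
  \<open>Z\<close> because it is applied to images and preimages under \<phi>, which are not yet
  known to be in the family.\<close>

locale block_chain_map = block_chain +
  fixes \<phi> :: "'a \<Rightarrow> 'a"
  assumes permutes_points: "\<phi> permutes points"
    and preserves_chain: "Y \<in> chain \<Longrightarrow> \<phi> ` Y \<in> chain"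
    and extra_not_block: "Y \<in> \<G> \<Longrightarrow> j < length bs \<Longrightarrow> Z \<noteq> {} \<Longrightarrow> Z \<subset> bs ! j \<Longrightarrow> Y \<noteq> initial j \<union> Z"
begin

section \<open>Permutations that preserve a chain\<close>

lemma inj_map: "inj \<phi>"
  using permutes_points permutes_inj by blast

lemma card_image_map: "card (\<phi> ` Y) = card Y"
  using inj_map by (intro card_image) (rule inj_on_subset, auto)

text \<open>A size strictly between two consecutive initial segments and outside \<open>T\<close>
  occurs for sets of block \<open>i\<close> only. So \<phi> maps these finitely many sets
  injectively into themselves.\<close>

lemma gap_image:
  assumes i: "i < length bs" and Z0: "Z0 \<in> \<Z> (bs ! i)" and T: "card (initial i \<union> Z0) \<notin> T"
  defines "N \<equiv> (\<lambda>Z. initial i \<union> Z) ` {Z \<in> \<Z> (bs ! i). card Z = card Z0}"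
  shows "(\<lambda>Y. \<phi> ` Y) ` N = N"
proof -
  have B: "bs ! i \<in> set bs" using i by simp
  have cu: "card (initial i \<union> Z) = card (initial i) + card Z" if "Z \<in> \<Z> (bs ! i)" for Z
    using family_proper[OF B that] block_disjoint_initial[OF i] finite_block[OF B]
    by (intro card_Un_disjoint) (auto intro: finite_subset)
  have bt: "card (initial i) < card (initial i \<union> Z)" "card (initial i \<union> Z) < card (initial (Suc i))"
    if "Z \<in> \<Z> (bs ! i)" for Z
    using card_between[OF i] family_proper[OF B that] by auto
  have "finite (\<Z> (bs ! i))"
    using family_proper[OF B] finite_block[OF B] by (auto intro: finite_subset[of _ "Pow (bs ! i)"])
  then have fin: "finite N" by (simp add: N_def)
  have "(\<lambda>Y. \<phi> ` Y) ` N \<subseteq> N"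
  proof
    fix Y' assume "Y' \<in> (\<lambda>Y. \<phi> ` Y) ` N"
    then obtain Z where Z: "Z \<in> \<Z> (bs ! i)" "card Z = card Z0" "Y' = \<phi> ` (initial i \<union> Z)"
      by (auto simp: N_def)
    have "initial i \<union> Z \<in> chain" using Z i unfolding chain_def by blast
    then have mem: "Y' \<in> chain" using Z preserves_chain by simp
    have cY: "card Y' = card (initial i \<union> Z)" using Z card_image_map by simp
    then have nT: "card Y' \<notin> T" using T cu Z Z0 by simp
    show "Y' \<in> N"
      using mem
    proof (cases rule: chain_cases)
      case (fixed j)
      then show ?thesis using bt(1)[OF Z(1)] cY card_initial_ge[of i] i by linarith
    next
      case (initial j)
      then show ?thesis using gap_not_initial[OF i _ bt[OF Z(1)], of j] cY by simp
    next
      case (block j Z')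
      then have "i = j" using gap_unique[OF i block(1) bt[OF Z(1)]] cY by simp
      then have "card Z' = card Z0" using block cu[OF Z(1)] cu[of Z'] Z(2) cY by simp
      then show ?thesis using block \<open>i = j\<close> by (auto simp: N_def)
    next
      case extra
      then show ?thesis using nT by simp
    qed
  qed
  moreover have "inj_on (\<lambda>Y. \<phi> ` Y) N" using inj_map by (simp add: inj_on_def inj_image_eq_iff)
  ultimately show ?thesis using fin by (metis endo_inj_surj)
qed

lemma initial_preserved:
  assumes j: "j \<le> length bs"
  shows "\<phi> ` initial j = initial j"
proof -
  consider "j = length bs" | "j < length bs" "card (initial j) \<notin> T" | "j < length bs" "card (initial j) \<in> T"
    using j by linarith
  then show ?thesis
  proof cases
    case 1
    then show ?thesis using permutes_image[OF permutes_points] initial_length by simp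
  next
    case 2
    then have "initial j \<in> chain" unfolding chain_def by blast
    then have "\<phi> ` initial j \<in> chain" by (rule preserves_chain)
    then show ?thesis
    proof (cases rule: chain_cases)
      case (fixed i)
      then show ?thesis using card_image_map[of "initial j"] card_initial_ge[of j] j by linarith
    next
      case (initial i)
      then have "card (initial i) = card (initial j)" using card_image_map by metis
      then have "i = j"
        using card_initial_less[of i j] card_initial_less[of j i] initial j by (cases i j rule: linorder_cases) auto
      then show ?thesis using initial by simp
    next
      case (block i Z)
      then show ?thesis using gap_not_initial[OF block(1) j block(4,5)] card_image_map[of "initial j"] by simp
    next
      case extra
      then show ?thesis using card_image_map 2 by simp
    qed
  next
    case 3
    show ?thesis
    \<comment> \<open>For size \<open>Suc w\<close> the sets just above the segment exceed all sizes
      in \<open>T\<close>; for size \<open>w\<close> the sets just below it are smaller than all of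
      them.\<close>
    proof (cases "card (initial j) = Suc w")
      case True
      have B: "bs ! j \<in> set bs" using 3 by simp
      then obtain Z0 where Z0: "Z0 \<in> \<Z> (bs ! j)" using family_nonempty by blast
      have "card (initial j \<union> Z0) > Suc w" using card_between(1)[OF 3(1)] family_proper[OF B Z0] True by auto
      then have nT: "card (initial j \<union> Z0) \<notin> T" using sizes_T by auto
      let ?M = "{Z \<in> \<Z> (bs ! j). card Z = card Z0}"
      let ?N = "(\<lambda>Z. initial j \<union> Z) ` ?M"
      have im: "(\<lambda>Y. \<phi> ` Y) ` ?N = ?N" using gap_image[OF 3(1) Z0 nT] .
      have "\<Inter>?M = {}" using family_spread[OF B Z0] by simp
      moreover have "?M \<noteq> {}" using Z0 by blast
      ultimately have int: "\<Inter>?N = initial j" by auto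
      have "\<phi> ` initial j \<subseteq> Y" if Y: "Y \<in> ?N" for Y
      proof -
        have "Y \<in> (\<lambda>Y. \<phi> ` Y) ` ?N" unfolding im by (rule Y)
        then obtain Y' where Y': "Y' \<in> ?N" "Y = \<phi> ` Y'" by (rule imageE)
        have "initial j \<subseteq> Y'" using Y'(1) by blast
        then show ?thesis unfolding Y'(2) by (rule image_mono)
      qed
      then have "\<phi> ` initial j \<subseteq> \<Inter>?N" by (rule Inter_greatest)
      then have "\<phi> ` initial j \<subseteq> initial j" unfolding int .
      then show ?thesis using card_image_map by (intro card_subset_eq) auto
    next
      case False
      then have cw: "card (initial j) = w" using 3 sizes_T by auto
      \<comment> \<open>Sizes in \<open>T\<close> exceed \<open>length fs\<close>, so there is a
        block below this segment.\<close>
      have "j \<noteq> 0"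
      proof
        assume "j = 0"
        then show False using large_T[OF 3(2)] initial_0 by simp
      qed
      then obtain i where i: "j = Suc i" "i < length bs" using 3 by (cases j) auto
      have B: "bs ! i \<in> set bs" using i by simp
      then obtain Z0 where Z0: "Z0 \<in> \<Z> (bs ! i)" using family_nonempty by blast
      have "card (initial i \<union> Z0) < w" using card_between(2)[OF i(2)] family_proper[OF B Z0] cw i by auto
      then have nT: "card (initial i \<union> Z0) \<notin> T" using sizes_T by auto
      let ?M = "{Z \<in> \<Z> (bs ! i). card Z = card Z0}"
      let ?N = "(\<lambda>Z. initial i \<union> Z) ` ?M"
      have im: "(\<lambda>Y. \<phi> ` Y) ` ?N = ?N" using gap_image[OF i(2) Z0 nT] .
      have "\<Union>?M = bs ! i" using family_spread[OF B Z0] by simp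
      moreover have "?M \<noteq> {}" using Z0 by blast
      ultimately have un: "\<Union>?N = initial j" using initial_Suc[OF i(2)] i by auto
      have "\<phi> ` (\<Union>?N) = \<Union>((\<lambda>Y. \<phi> ` Y) ` ?N)" by (rule image_Union)
      then show ?thesis unfolding im un .
    qed
  qed
qed

lemma block_preserved:
  assumes j: "j < length bs"
  shows "\<phi> ` (bs ! j) = bs ! j"
proof -
  have e: "bs ! j = initial (Suc j) - initial j"
    using initial_Suc[OF j] block_disjoint_initial[OF j] by blast
  have "\<phi> ` (initial (Suc j) - initial j) = \<phi> ` initial (Suc j) - \<phi> ` initial j"
    using inj_map by (rule image_set_diff)
  then show ?thesis unfolding e using initial_preserved j by simp
qed

lemma family_preserved:
  assumes j: "j < length bs" and Z: "Z \<in> \<Z> (bs ! j)"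
  shows "\<phi> ` Z \<in> \<Z> (bs ! j)"
proof -
  have B: "bs ! j \<in> set bs" using j by simp
  have Zp: "Z \<noteq> {}" "Z \<subset> bs ! j" using family_proper[OF B Z] by auto
  have "\<phi> ` Z \<subset> \<phi> ` (bs ! j)"
    using Zp inj_map by (intro image_strict_mono) (auto intro: inj_on_subset)
  then have p: "\<phi> ` Z \<noteq> {}" "\<phi> ` Z \<subset> bs ! j" using Zp block_preserved[OF j] by auto
  have bt: "card (initial j) < card (initial j \<union> \<phi> ` Z)" "card (initial j \<union> \<phi> ` Z) < card (initial (Suc j))"
    using card_between[OF j p] .
  have "initial j \<union> Z \<in> chain" using Z j unfolding chain_def by blast
  then have "\<phi> ` (initial j \<union> Z) \<in> chain" by (rule preserves_chain)
  then have "initial j \<union> \<phi> ` Z \<in> chain" using initial_preserved[of j] j by (simp add: image_Un)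
  then show ?thesis
  proof (cases rule: chain_cases)
    case (fixed i)
    then show ?thesis using bt card_initial_ge[of j] j by linarith
  next
    case (initial i)
    then show ?thesis using gap_not_initial[OF j _ bt, of i] by simp
  next
    case (block i Z')
    then have "j = i" using gap_unique[OF j block(1) bt] by simp
    moreover have "Z' \<inter> initial i = {}" "\<phi> ` Z \<inter> initial j = {}"
      using family_proper[of "bs ! i" Z'] block block_disjoint_initial[of i] p block_disjoint_initial[of j] j
      by auto
    ultimately have "\<phi> ` Z = Z'" using block(3) by blast
    then show ?thesis using block \<open>j = i\<close> by simp
  next
    case extra
    then show ?thesis using extra_not_block[OF extra(1) j p] by simp
  qed
qed

lemma extra_preserved:
  assumes Y: "Y \<in> \<G>"
  shows "\<phi> ` Y \<in> \<G>"
proof -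
  have "Y \<in> chain" using Y by (simp add: chain_def)
  then have "\<phi> ` Y \<in> chain" by (rule preserves_chain)
  moreover have cT: "card (\<phi> ` Y) \<in> T" using Y extra_card card_image_map by simp
  ultimately show ?thesis
  proof (cases rule: chain_cases)
    case (fixed j)
    then show ?thesis using cT large_T by fastforce
  next
    case (initial j)
    then show ?thesis using cT by simp
  next
    case (block j Z)
    define Z' where "Z' = {x \<in> bs ! j. \<phi> x \<in> Z}"
    have Z: "Z \<noteq> {}" "Z \<subset> bs ! j" using family_proper[of "bs ! j" Z] block by auto
    then have im: "\<phi> ` Z' = Z" using block_preserved[OF block(1)] by (auto simp: Z'_def)
    have "Z' \<noteq> {}" using im Z(1) by blast
    moreover have "Z' \<noteq> bs ! j" using im Z(2) block_preserved[OF block(1)] by auto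
    then have "Z' \<subset> bs ! j" unfolding Z'_def by blast
    moreover have "\<phi> ` Y = \<phi> ` (initial j \<union> Z')"
      using block im initial_preserved[of j] by (simp add: image_Un)
    then have "Y = initial j \<union> Z'" using inj_map by (simp add: inj_image_eq_iff)
    ultimately show ?thesis using extra_not_block[OF Y block(1)] by blast
  qed
qed

lemma fixed_preserved:
  assumes x: "x \<in> set fs"
  shows "\<phi> x = x"
proof -
  have V: "\<phi> ` set (take j fs) = set (take j fs)" if j: "j \<le> length fs" for j
  proof -
    consider "j = 0" | "j = length fs" | "1 \<le> j" "j < length fs" using j by linarith
    then show ?thesis
    proof cases
      case 2
      then show ?thesis using initial_preserved[of 0] initial_0 by simp
    next
      case 3
      then have "set (take j fs) \<in> chain" by (auto simp: chain_def)
      then have m: "\<phi> ` set (take j fs) \<in> chain" by (rule preserves_chain)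
      have c: "card (\<phi> ` set (take j fs)) = j"
        using card_image_map 3 distinct_fs by (simp add: distinct_card)
      show ?thesis using m
      proof (cases rule: chain_cases)
        case (fixed i)
        then show ?thesis using c by simp
      next
        case (initial i)
        then show ?thesis using c card_initial_ge[of i] 3 by simp
      next
        case (block i Z)
        then show ?thesis using c card_initial_ge[of i] 3 by linarith
      next
        case extra
        then show ?thesis using c large_T 3 by fastforce
      qed
    qed simp
  qed
  obtain i where i: "i < length fs" "x = fs ! i" using x by (auto simp: in_set_conv_nth)
  have e: "{x} = set (take (Suc i) fs) - set (take i fs)"
    using i distinct_fs by (auto simp: take_Suc_conv_app_nth in_set_conv_nth nth_eq_iff_index_eq)
  have "\<phi> ` {x} = \<phi> ` set (take (Suc i) fs) - \<phi> ` set (take i fs)"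
    unfolding e using inj_map by (rule image_set_diff)
  also have "\<dots> = {x}" using V[of "Suc i"] V[of i] i(1) unfolding e by simp
  finally show ?thesis by simp
qed

end

section \<open>Boolean functions and exceptional groups\<close>

lemma perm_group_members:
  assumes "perm_group G"
  shows "fst G \<ge> 1" "\<And>\<sigma>. \<sigma> \<in> snd G \<Longrightarrow> \<sigma> permutes {1..fst G}" "id \<in> snd G"
    "\<And>\<sigma> \<tau>. \<sigma> \<in> snd G \<Longrightarrow> \<tau> \<in> snd G \<Longrightarrow> \<sigma> \<circ> \<tau> \<in> snd G" "\<And>\<sigma>. \<sigma> \<in> snd G \<Longrightarrow> inv' \<sigma> \<in> snd G"
proof -
  have sg: "subgroup (snd G) (sym_group (fst G))" using assms by (simp add: perm_group_def)
  show "fst G \<ge> 1" using assms by (simp add: perm_group_def)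
  show p: "\<sigma> permutes {1..fst G}" if "\<sigma> \<in> snd G" for \<sigma>
    using subgroup.mem_carrier[OF sg that] by (simp add: sym_group_carrier)
  show "id \<in> snd G" using subgroup.one_closed[OF sg] by (simp add: sym_group_one)
  show "\<sigma> \<circ> \<tau> \<in> snd G" if "\<sigma> \<in> snd G" "\<tau> \<in> snd G" for \<sigma> \<tau>
    using subgroup.m_closed[OF sg that] by (simp add: sym_group_mult)
  show "inv' \<sigma> \<in> snd G" if "\<sigma> \<in> snd G" for \<sigma>
    using subgroup.m_inv_closed[OF sg that] subgroup.mem_carrier[OF sg that]
    by (simp add: sym_group_inv_equality)
qed

lemma perm_groupI:
  assumes "n \<ge> 1" "\<And>\<sigma>. \<sigma> \<in> A \<Longrightarrow> \<sigma> permutes {1..n}" "id \<in> A"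
    "\<And>\<sigma> \<tau>. \<sigma> \<in> A \<Longrightarrow> \<tau> \<in> A \<Longrightarrow> \<sigma> \<circ> \<tau> \<in> A" "\<And>\<sigma>. \<sigma> \<in> A \<Longrightarrow> inv' \<sigma> \<in> A"
  shows "perm_group (n, A)"
proof -
  have "subgroup A (sym_group n)"
  proof
    show "A \<subseteq> carrier (sym_group n)" using assms(2) by (auto simp: sym_group_carrier)
    show "inv\<^bsub>sym_group n\<^esub> \<sigma> \<in> A" if "\<sigma> \<in> A" for \<sigma>
      using assms(2,5)[OF that] by (simp add: sym_group_carrier flip: sym_group_inv_equality)
  qed (use assms in \<open>simp_all add: sym_group_one sym_group_mult\<close>)
  then show ?thesis using assms(1) by (simp add: perm_group_def)
qed

text \<open>Boolean vectors are replaced by their supports. The action on vectors becomes the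
  inverse image on supports, which amounts to the same invariance condition.\<close>

definition colour_preserving :: "nat \<Rightarrow> (nat set \<Rightarrow> nat) \<Rightarrow> (nat \<Rightarrow> nat) set" where
  "colour_preserving n c = {\<sigma>. \<sigma> permutes {1..n} \<and> (\<forall>Y\<subseteq>{1..n}. c (\<sigma> ` Y) = c Y)}"

lemma indicator_cube: "(\<lambda>i\<in>{1..n}. if i \<in> Y then 1 else 0) \<in> cube n"
  by (auto simp: cube_def)

lemma cube_indicator:
  assumes "x \<in> cube n"
  shows "(\<lambda>i\<in>{1..n}. if i \<in> {j \<in> {1..n}. x j = 1} then 1 else 0) = x"
proof
  fix i
  show "(\<lambda>i\<in>{1..n}. if i \<in> {j \<in> {1..n}. x j = 1} then 1 else 0) i = x i"
    using assms by (cases "i \<in> {1..n}") (auto simp: cube_def PiE_def Pi_def extensional_def)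
qed

lemma support_act:
  assumes "\<sigma> permutes {1..n}"
  shows "{i \<in> {1..n}. act x \<sigma> i = 1} = inv' \<sigma> ` {i \<in> {1..n}. x i = 1}"
proof -
  have "i \<in> inv' \<sigma> ` {i \<in> {1..n}. x i = 1} \<longleftrightarrow> \<sigma> i \<in> {i \<in> {1..n}. x i = 1}" for i
    using permutes_inverses[OF assms] by (metis (mono_tags, lifting) image_iff)
  then show ?thesis using permutes_in_image[OF assms] by (auto simp: act_def)
qed

lemma act_indicator:
  assumes s: "\<sigma> permutes {1..n}"
  shows "act (\<lambda>i\<in>{1..n}. if i \<in> \<sigma> ` Y then 1 else 0) \<sigma> = (\<lambda>i\<in>{1..n}. if i \<in> Y then 1 else 0 :: nat)"
proof
  fix i
  have "\<sigma> i \<in> \<sigma> ` Y \<longleftrightarrow> i \<in> Y" using permutes_inj[OF s] by (rule inj_image_mem_iff)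
  then show "act (\<lambda>i\<in>{1..n}. if i \<in> \<sigma> ` Y then 1 else 0) \<sigma> i = (\<lambda>i\<in>{1..n}. if i \<in> Y then 1 else 0 :: nat) i"
    using permutes_in_image[OF s, of i] by (simp add: act_def)
qed

lemma BGR_iff:
  "G \<in> BGR k \<longleftrightarrow> fst G \<ge> 1 \<and> (\<exists>c. (\<forall>Y\<subseteq>{1..fst G}. c Y < k) \<and> snd G = colour_preserving (fst G) c)"
proof
  assume "G \<in> BGR k"
  then obtain n f where G: "G = symmetry_group n f" "n \<ge> 1" "f \<in> cube n \<rightarrow> {0..<k}"
    by (auto simp: BGR_def)
  define c where "c Y = f (\<lambda>i\<in>{1..n}. if i \<in> Y then 1 else 0)" for Y
  have "c Y < k" for Y using G(3) indicator_cube[of Y n] by (auto simp: c_def Pi_iff)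
  moreover have "(\<forall>x\<in>cube n. f (act x \<sigma>) = f x) \<longleftrightarrow> (\<forall>Y\<subseteq>{1..n}. c (\<sigma> ` Y) = c Y)"
    if s: "\<sigma> permutes {1..n}" for \<sigma>
  proof
    assume a: "\<forall>x\<in>cube n. f (act x \<sigma>) = f x"
    have "c (\<sigma> ` Y) = c Y" for Y
    proof -
      have "f (act (\<lambda>i\<in>{1..n}. if i \<in> \<sigma> ` Y then 1 else 0) \<sigma>) = c (\<sigma> ` Y)"
        unfolding c_def using a indicator_cube by blast
      then show ?thesis unfolding act_indicator[OF s] by (simp add: c_def)
    qed
    then show "\<forall>Y\<subseteq>{1..n}. c (\<sigma> ` Y) = c Y" by blast
  next
    assume a: "\<forall>Y\<subseteq>{1..n}. c (\<sigma> ` Y) = c Y"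
    show "\<forall>x\<in>cube n. f (act x \<sigma>) = f x"
    proof
      fix x assume x: "x \<in> cube n"
      define Y where "Y = {i \<in> {1..n}. act x \<sigma> i = 1}"
      have Y': "\<sigma> ` Y = {i \<in> {1..n}. x i = 1}"
        unfolding Y_def support_act[OF s] image_image using permutes_inverses[OF s] by simp
      have x': "(\<lambda>i\<in>{1..n}. if i \<in> \<sigma> ` Y then 1 else 0) = x" unfolding Y' using cube_indicator[OF x] .
      have "Y \<subseteq> {1..n}" unfolding Y_def by blast
      then have "c (\<sigma> ` Y) = c Y" using a by blast
      moreover have "act x \<sigma> = (\<lambda>i\<in>{1..n}. if i \<in> Y then 1 else 0)"
        using act_indicator[OF s, of Y] x' by simp
      ultimately show "f (act x \<sigma>) = f x" using x' by (simp add: c_def)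
    qed
  qed
  ultimately show "fst G \<ge> 1 \<and> (\<exists>c. (\<forall>Y\<subseteq>{1..fst G}. c Y < k) \<and> snd G = colour_preserving (fst G) c)"
    using G by (auto simp: symmetry_group_def colour_preserving_def intro!: exI[of _ c])
next
  assume "fst G \<ge> 1 \<and> (\<exists>c. (\<forall>Y\<subseteq>{1..fst G}. c Y < k) \<and> snd G = colour_preserving (fst G) c)"
  then obtain c where n: "fst G \<ge> 1" and c: "\<forall>Y\<subseteq>{1..fst G}. c Y < k" "snd G = colour_preserving (fst G) c"
    by blast
  define n where "n = fst G"
  define f where "f x = c {i \<in> {1..n}. x i = 1}" for x :: "nat \<Rightarrow> nat"
  have "(\<forall>x\<in>cube n. f (act x \<sigma>) = f x) \<longleftrightarrow> (\<forall>Y\<subseteq>{1..n}. c (\<sigma> ` Y) = c Y)"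
    if s: "\<sigma> permutes {1..n}" for \<sigma>
  proof
    assume a: "\<forall>x\<in>cube n. f (act x \<sigma>) = f x"
    show "\<forall>Y\<subseteq>{1..n}. c (\<sigma> ` Y) = c Y"
    proof (intro allI impI)
      fix Y assume Y: "Y \<subseteq> {1..n}"
      have i: "{i \<in> {1..n}. (\<lambda>i\<in>{1..n}. if i \<in> Z then 1 else 0 :: nat) i = 1} = Z" if "Z \<subseteq> {1..n}" for Z
        using that by auto
      have "\<sigma> ` Y \<subseteq> {1..n}" using Y permutes_image[OF s] by blast
      moreover have "f (act (\<lambda>i\<in>{1..n}. if i \<in> \<sigma> ` Y then 1 else 0) \<sigma>) = f (\<lambda>i\<in>{1..n}. if i \<in> \<sigma> ` Y then 1 else 0)"
        using a indicator_cube by blast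
      ultimately show "c (\<sigma> ` Y) = c Y" unfolding act_indicator[OF s] unfolding f_def using i Y by simp
    qed
  next
    assume a: "\<forall>Y\<subseteq>{1..n}. c (\<sigma> ` Y) = c Y"
    show "\<forall>x\<in>cube n. f (act x \<sigma>) = f x"
    proof
      fix x assume "x \<in> cube n"
      let ?Y = "inv' \<sigma> ` {i \<in> {1..n}. x i = 1}"
      have "?Y \<subseteq> {1..n}" by (rule subset_trans[OF equalityD2[OF support_act[OF s]]]) blast
      then have "c (\<sigma> ` ?Y) = c ?Y" using a by blast
      moreover have "\<sigma> ` ?Y = {i \<in> {1..n}. x i = 1}"
        unfolding image_image using permutes_inverses[OF s] by simp
      ultimately show "f (act x \<sigma>) = f x" unfolding f_def support_act[OF s] by (simp only:)
    qed
  qed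
  then have "G = symmetry_group n f"
    using c n_def by (cases G) (auto simp: symmetry_group_def colour_preserving_def)
  moreover have "f x < k" for x
  proof -
    have "{i \<in> {1..n}. x i = 1} \<subseteq> {1..fst G}" unfolding n_def by blast
    then show ?thesis using c(1) unfolding f_def by blast
  qed
  then have "f \<in> cube n \<rightarrow> {0..<k}" by auto
  ultimately show "G \<in> BGR k" using n by (auto simp: BGR_def n_def)
qed

text \<open>A two-valued function is the indicator of a family. This is the link from the
  combinatorial constructions to \<open>BGR\<close>.\<close>

lemma BGR_two_family:
  assumes G: "perm_group G" and inv: "\<And>\<sigma> Y. \<sigma> \<in> snd G \<Longrightarrow> Y \<in> F \<Longrightarrow> \<sigma> ` Y \<in> F"
    and rigid: "\<And>\<phi>. \<phi> permutes {1..fst G} \<Longrightarrow> (\<And>Y. Y \<in> F \<Longrightarrow> \<phi> ` Y \<in> F) \<Longrightarrow> \<phi> \<in> snd G"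
    and F: "F \<subseteq> Pow {1..fst G}"
  shows "G \<in> BGR 2"
proof -
  note m = perm_group_members[OF G]
  define c where "c Y = (if Y \<in> F then 1 else 0 :: nat)" for Y
  have "snd G = colour_preserving (fst G) c"
  proof (intro equalityI subsetI)
    fix \<sigma> assume s: "\<sigma> \<in> snd G"
    have "\<sigma> ` Y \<in> F \<longleftrightarrow> Y \<in> F" for Y
    proof
      assume "\<sigma> ` Y \<in> F"
      then have "inv' \<sigma> ` (\<sigma> ` Y) \<in> F" using inv[OF m(5)[OF s]] by blast
      then show "Y \<in> F" unfolding image_image using permutes_inverses[OF m(2)[OF s]] by simp
    qed (use inv s in blast)
    then show "\<sigma> \<in> colour_preserving (fst G) c" using m(2)[OF s] by (simp add: colour_preserving_def c_def)
  next
    fix \<sigma> assume s: "\<sigma> \<in> colour_preserving (fst G) c"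
    have "\<sigma> ` Y \<in> F" if "Y \<in> F" for Y
    proof -
      have "c (\<sigma> ` Y) = c Y" using s F that by (auto simp: colour_preserving_def)
      then show ?thesis using that by (auto simp: c_def split: if_splits)
    qed
    then show "\<sigma> \<in> snd G" using s rigid by (auto simp: colour_preserving_def)
  qed
  then show ?thesis unfolding BGR_iff using m(1) by (intro conjI exI[of _ c]) (auto simp: c_def)
qed

lemma perm_iso_sym:
  assumes "perm_iso G H"
  shows "perm_iso H G"
proof -
  obtain \<pi> where p: "\<pi> permutes {1..fst G}" "snd H = (\<lambda>\<sigma>. \<pi> \<circ> \<sigma> \<circ> inv' \<pi>) ` snd G" "fst G = fst H"
    using assms by (auto simp: perm_iso_def)
  have i: "inv' (inv' \<pi>) = \<pi>" using permutes_inv_inv[OF p(1)] .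
  have "inv' \<pi> \<circ> (\<pi> \<circ> \<sigma> \<circ> inv' \<pi>) \<circ> \<pi> = \<sigma>" for \<sigma>
    using permutes_inverses[OF p(1)] by (simp add: fun_eq_iff)
  then have G: "snd G = (\<lambda>\<sigma>. inv' \<pi> \<circ> \<sigma> \<circ> inv' (inv' \<pi>)) ` snd H"
    unfolding p(2) i image_image by simp
  show ?thesis unfolding perm_iso_def
  proof (intro conjI exI[of _ "inv' \<pi>"] G)
    show "inv' \<pi> permutes {1..fst H}" using permutes_inv[OF p(1)] p(3) by simp
  qed (simp add: p(3))
qed

lemma BGR_perm_iso:
  assumes iso: "perm_iso G H" and G: "G \<in> BGR k"
  shows "H \<in> BGR k"
proof -
  define n where "n = fst G"
  obtain \<pi> where p: "\<pi> permutes {1..n}" "snd H = (\<lambda>\<sigma>. \<pi> \<circ> \<sigma> \<circ> inv' \<pi>) ` snd G" "fst H = n"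
    using iso unfolding perm_iso_def n_def by metis
  obtain c where c: "n \<ge> 1" "\<forall>Y\<subseteq>{1..n}. c Y < k" "snd G = colour_preserving n c"
    using G unfolding BGR_iff n_def by blast
  define c' where "c' Y = c (inv' \<pi> ` Y)" for Y
  have pi: "inv' \<pi> permutes {1..n}" using permutes_inv p by blast
  note pp = permutes_inverses[OF p(1)]
  have sub: "inv' \<pi> ` Y \<subseteq> {1..n}" "\<pi> ` Y \<subseteq> {1..n}" if "Y \<subseteq> {1..n}" for Y
    using that permutes_image[OF pi] permutes_image[OF p(1)] by auto
  have "snd H = colour_preserving n c'"
  proof (intro equalityI subsetI)
    fix \<tau> assume "\<tau> \<in> snd H"
    then obtain \<sigma> where s: "\<sigma> permutes {1..n}" "\<And>Y. Y \<subseteq> {1..n} \<Longrightarrow> c (\<sigma> ` Y) = c Y" "\<tau> = \<pi> \<circ> \<sigma> \<circ> inv' \<pi>"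
      using p(2) c(3) by (auto simp: colour_preserving_def)
    have "c' (\<tau> ` Y) = c' Y" if Y: "Y \<subseteq> {1..n}" for Y
    proof -
      have "inv' \<pi> ` (\<tau> ` Y) = \<sigma> ` (inv' \<pi> ` Y)" unfolding s(3) image_image using pp by simp
      then show ?thesis using s(2)[OF sub(1)[OF Y]] by (simp add: c'_def)
    qed
    moreover have "\<tau> permutes {1..n}" unfolding s(3) using s(1) p(1) pi by (intro permutes_compose)
    ultimately show "\<tau> \<in> colour_preserving n c'" by (simp add: colour_preserving_def)
  next
    fix \<tau> assume "\<tau> \<in> colour_preserving n c'"
    then have t: "\<tau> permutes {1..n}" "\<And>Y. Y \<subseteq> {1..n} \<Longrightarrow> c' (\<tau> ` Y) = c' Y"
      by (auto simp: colour_preserving_def)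
    let ?s = "inv' \<pi> \<circ> \<tau> \<circ> \<pi>"
    have "c (?s ` Y) = c Y" if Y: "Y \<subseteq> {1..n}" for Y
    proof -
      have "c' (\<tau> ` (\<pi> ` Y)) = c' (\<pi> ` Y)" using t(2)[OF sub(2)[OF Y]] .
      then show ?thesis unfolding c'_def image_image using pp by (simp add: image_comp)
    qed
    moreover have "?s permutes {1..n}" using t(1) p(1) pi by (intro permutes_compose)
    ultimately have "?s \<in> snd G" using c(3) by (simp add: colour_preserving_def)
    moreover have "\<pi> \<circ> ?s \<circ> inv' \<pi> = \<tau>" using pp by (simp add: fun_eq_iff)
    ultimately show "\<tau> \<in> snd H" unfolding p(2) by (metis imageI)
  qed
  then show ?thesis unfolding BGR_iff p(3) using c(1,2) sub by (intro conjI exI[of _ c']) (auto simp: c'_def)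
qed

text \<open>An invariant colouring is constant on the orbits of \<open>G\<close> on subsets, and
  \<rho> keeps each subset in its orbit, whatever the number of colours.\<close>

lemma not_BGR_if_orbit_equivalent:
  assumes "\<rho> permutes {1..fst G}" "\<rho> \<notin> snd G" "\<And>Y. Y \<subseteq> {1..fst G} \<Longrightarrow> \<exists>\<tau>\<in>snd G. \<rho> ` Y = \<tau> ` Y"
  shows "G \<notin> BGR k"
proof
  assume "G \<in> BGR k"
  then obtain c where c: "snd G = colour_preserving (fst G) c" by (auto simp: BGR_iff)
  have "c (\<rho> ` Y) = c Y" if "Y \<subseteq> {1..fst G}" for Y
    using assms(3)[OF that] c that by (auto simp: colour_preserving_def)
  then show False using assms(1,2) c by (simp add: colour_preserving_def)
qed

section \<open>Subgroups of sums of regular groups\<close>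

definition has_normal_stabilizers :: "perm_grp \<Rightarrow> bool" where
  "has_normal_stabilizers G \<longleftrightarrow> (\<forall>\<sigma>\<in>snd G. \<forall>\<tau>\<in>snd G. \<forall>i. \<sigma> i = i \<longrightarrow> \<sigma> (\<tau> i) = \<tau> i)"

text \<open>The second conjunct is carried along for the induction: as exactly 0 goes to 0 and the
  initial interval is respected, an element of a direct sum acts separately on the two
  parts.\<close>

lemma sum_of_regular_normal_stabilizers:
  assumes "sum_of_regular G"
  shows "has_normal_stabilizers G \<and>
    (\<forall>\<sigma>\<in>snd G. \<forall>i. (\<sigma> i = 0 \<longleftrightarrow> i = 0) \<and> (\<sigma> i \<le> fst G \<longleftrightarrow> i \<le> fst G))"
proof -
  have reg: "has_normal_stabilizers G \<and>
    (\<forall>\<sigma>\<in>snd G. \<forall>i. (\<sigma> i = 0 \<longleftrightarrow> i = 0) \<and> (\<sigma> i \<le> fst G \<longleftrightarrow> i \<le> fst G))"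
    if r: "regular G" for G
  proof (intro conjI ballI allI)
    note m = perm_group_members(2)[of G]
    have pg: "perm_group G" using r by (simp add: regular_def)
    show "has_normal_stabilizers G" unfolding has_normal_stabilizers_def
    proof (intro ballI allI impI)
      fix \<sigma> \<tau> i assume s: "\<sigma> \<in> snd G" and t: "\<tau> \<in> snd G" and i: "\<sigma> i = i"
      show "\<sigma> (\<tau> i) = \<tau> i"
      proof (cases "i \<in> {1..fst G}")
        case True
        then have "{\<sigma> \<in> snd G. \<sigma> i = i} = {id}" using r by (simp add: regular_def)
        then have "\<sigma> = id" using s i by blast
        then show ?thesis by simp
      next
        case False
        then have "\<tau> i = i" using m[OF pg t] by (simp add: permutes_not_in)
        then show ?thesis using i by simp
      qed
    qed
    fix \<sigma> i assume s: "\<sigma> \<in> snd G"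
    have p: "\<sigma> i \<in> {1..fst G} \<longleftrightarrow> i \<in> {1..fst G}" using permutes_in_image[OF m[OF pg s]] .
    have q: "i \<notin> {1..fst G} \<Longrightarrow> \<sigma> i = i" using permutes_not_in[OF m[OF pg s]] .
    show "\<sigma> i = 0 \<longleftrightarrow> i = 0" using p q by (cases "i \<in> {1..fst G}") auto
    show "\<sigma> i \<le> fst G \<longleftrightarrow> i \<le> fst G" using p q by (cases "i \<in> {1..fst G}") auto
  qed
  show ?thesis using assms
  proof induction
    case (single G)
    then show ?case by (rule reg)
  next
    case (add G H)
    define m where "m = fst G"
    note G = add.IH and H = reg[OF add.hyps(2)]
    have fst: "fst (direct_sum G H) = m + fst H" by (simp add: direct_sum_def m_def)
    have ex: "\<exists>a\<in>snd G. \<exists>b\<in>snd H. \<sigma> = (\<lambda>i. if i \<le> m then a i else b (i - m) + m)"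
      if "\<sigma> \<in> snd (direct_sum G H)" for \<sigma>
      using that unfolding direct_sum_def m_def snd_conv by blast
    show ?case
    proof (intro conjI ballI allI)
      show "has_normal_stabilizers (direct_sum G H)" unfolding has_normal_stabilizers_def
      proof (intro ballI allI impI)
        fix \<sigma> \<tau> i assume s: "\<sigma> \<in> snd (direct_sum G H)" and t: "\<tau> \<in> snd (direct_sum G H)" and i: "\<sigma> i = i"
        obtain a b where ab: "a \<in> snd G" "b \<in> snd H" "\<sigma> = (\<lambda>i. if i \<le> m then a i else b (i - m) + m)"
          using ex[OF s] by blast
        obtain c d where cd: "c \<in> snd G" "d \<in> snd H" "\<tau> = (\<lambda>i. if i \<le> m then c i else d (i - m) + m)"
          using ex[OF t] by blast
        show "\<sigma> (\<tau> i) = \<tau> i"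
        proof (cases "i \<le> m")
          case True
          then have "a (c i) = c i" "c i \<le> m"
            using G i ab cd by (auto simp: has_normal_stabilizers_def m_def)
          then show ?thesis using True by (simp add: ab(3) cd(3))
        next
          case False
          then have "b (i - m) = i - m" using i by (simp add: ab(3))
          then have "b (d (i - m)) = d (i - m)" using H ab cd by (auto simp: has_normal_stabilizers_def)
          moreover have "d (i - m) \<noteq> 0" using H cd False by auto
          ultimately show ?thesis using False by (simp add: ab(3) cd(3))
        qed
      qed
      fix \<sigma> i assume s: "\<sigma> \<in> snd (direct_sum G H)"
      obtain a b where ab: "a \<in> snd G" "b \<in> snd H" "\<sigma> = (\<lambda>i. if i \<le> m then a i else b (i - m) + m)"
        using ex[OF s] by blast
      have a: "(a i = 0 \<longleftrightarrow> i = 0) \<and> (a i \<le> m \<longleftrightarrow> i \<le> m)" using G ab(1) by (simp add: m_def)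
      have b: "(b (i - m) = 0 \<longleftrightarrow> i - m = 0) \<and> (b (i - m) \<le> fst H \<longleftrightarrow> i - m \<le> fst H)" using H ab(2) by simp
      show "\<sigma> i = 0 \<longleftrightarrow> i = 0" using a b by (auto simp: ab(3))
      show "\<sigma> i \<le> fst (direct_sum G H) \<longleftrightarrow> i \<le> fst (direct_sum G H)"
        unfolding fst using a b by (auto simp: ab(3))
    qed
  qed
qed

lemma has_normal_stabilizers_perm_iso:
  assumes iso: "perm_iso B C" and C: "has_normal_stabilizers C"
  shows "has_normal_stabilizers B"
proof -
  obtain \<pi> where p: "\<pi> permutes {1..fst B}" "snd C = (\<lambda>\<sigma>. \<pi> \<circ> \<sigma> \<circ> inv' \<pi>) ` snd B"
    using iso by (auto simp: perm_iso_def)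
  note pp = permutes_inverses[OF p(1)]
  show ?thesis unfolding has_normal_stabilizers_def
  proof (intro ballI allI impI)
    fix \<sigma> \<tau> i assume s: "\<sigma> \<in> snd B" and t: "\<tau> \<in> snd B" and i: "\<sigma> i = i"
    have "\<pi> \<circ> \<sigma> \<circ> inv' \<pi> \<in> snd C" "\<pi> \<circ> \<tau> \<circ> inv' \<pi> \<in> snd C" using s t p(2) by auto
    moreover have "(\<pi> \<circ> \<sigma> \<circ> inv' \<pi>) (\<pi> i) = \<pi> i" using i pp by simp
    ultimately have "(\<pi> \<circ> \<sigma> \<circ> inv' \<pi>) ((\<pi> \<circ> \<tau> \<circ> inv' \<pi>) (\<pi> i)) = (\<pi> \<circ> \<tau> \<circ> inv' \<pi>) (\<pi> i)"
      using C unfolding has_normal_stabilizers_def by blast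
    then have "\<pi> (\<sigma> (\<tau> i)) = \<pi> (\<tau> i)" using pp by simp
    then show "\<sigma> (\<tau> i) = \<tau> i" using permutes_inj[OF p(1)] by (simp add: inj_eq)
  qed
qed

section \<open>The Klein four-group\<close>

lemma atLeastAtMost_1_4: "{1..4::nat} = {1, 2, 3, 4}"
  by auto

lemma K4_mem_iff:
  "\<sigma> \<in> snd K4 \<longleftrightarrow> \<sigma> permutes {1..4} \<and>
    (\<sigma> 1 = 1 \<and> \<sigma> 2 = 2 \<and> \<sigma> 3 = 3 \<and> \<sigma> 4 = 4 \<or> \<sigma> 1 = 2 \<and> \<sigma> 2 = 1 \<and> \<sigma> 3 = 4 \<and> \<sigma> 4 = 3 \<or>
     \<sigma> 1 = 3 \<and> \<sigma> 2 = 4 \<and> \<sigma> 3 = 1 \<and> \<sigma> 4 = 2 \<or> \<sigma> 1 = 4 \<and> \<sigma> 2 = 3 \<and> \<sigma> 3 = 2 \<and> \<sigma> 4 = 1)"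
  (is "_ \<longleftrightarrow> _ \<and> ?R \<sigma>")
proof
  assume "\<sigma> \<in> snd K4"
  then have s: "\<sigma> \<in> {id, transpose 1 2 \<circ> transpose 3 4, transpose 1 3 \<circ> transpose 2 4,
    transpose 1 4 \<circ> transpose 2 3}"
    by (simp add: K4_def)
  have t: "transpose a b \<circ> transpose c d permutes {1..4}"
    if "a \<in> {1..4}" "b \<in> {1..4}" "c \<in> {1..4}" "d \<in> {1..4}" for a b c d :: nat
    using that by (intro permutes_compose permutes_swap_id)
  have "\<sigma> permutes {1..4}"
    using s by (elim insertE emptyE) (simp_all only: permutes_id, (rule t; simp)+)
  moreover have "?R \<sigma>" using s by (elim insertE emptyE) (simp_all add: transpose_def)
  ultimately show "\<sigma> permutes {1..4} \<and> ?R \<sigma>" by blast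
next
  assume a: "\<sigma> permutes {1..4} \<and> ?R \<sigma>"
  have eq: "\<sigma> = \<tau>" if "\<And>i. i \<in> {1, 2, 3, 4} \<Longrightarrow> \<sigma> i = \<tau> i" "\<And>i. i \<notin> {1, 2, 3, 4} \<Longrightarrow> \<tau> i = i" for \<tau>
  proof
    fix i
    show "\<sigma> i = \<tau> i"
      using that a permutes_not_in[of \<sigma> "{1..4}" i] unfolding atLeastAtMost_1_4 by (cases "i \<in> {1, 2, 3, 4}") auto
  qed
  have "\<sigma> = id \<or> \<sigma> = transpose 1 2 \<circ> transpose 3 4 \<or> \<sigma> = transpose 1 3 \<circ> transpose 2 4 \<or>
    \<sigma> = transpose 1 4 \<circ> transpose 2 3"
    using a
  proof (elim conjE disjE)
    assume "\<sigma> 1 = 1" "\<sigma> 2 = 2" "\<sigma> 3 = 3" "\<sigma> 4 = 4"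
    then have "\<sigma> = id" by (intro eq) auto
    then show ?thesis by blast
  next
    assume "\<sigma> 1 = 2" "\<sigma> 2 = 1" "\<sigma> 3 = 4" "\<sigma> 4 = 3"
    then have "\<sigma> = transpose 1 2 \<circ> transpose 3 4" by (intro eq) (auto simp: transpose_def)
    then show ?thesis by blast
  next
    assume "\<sigma> 1 = 3" "\<sigma> 2 = 4" "\<sigma> 3 = 1" "\<sigma> 4 = 2"
    then have "\<sigma> = transpose 1 3 \<circ> transpose 2 4" by (intro eq) (auto simp: transpose_def)
    then show ?thesis by blast
  next
    assume "\<sigma> 1 = 4" "\<sigma> 2 = 3" "\<sigma> 3 = 2" "\<sigma> 4 = 1"
    then have "\<sigma> = transpose 1 4 \<circ> transpose 2 3" by (intro eq) (auto simp: transpose_def)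
    then show ?thesis by blast
  qed
  then show "\<sigma> \<in> snd K4" by (simp add: K4_def)
qed

text \<open>\<open>P\<close> and \<open>Q\<close> are two of the three partitions of four points
  into pairs. The permutations that preserve both form \<open>K4\<close>, the kernel of the action
  of the symmetric group on these partitions. Different colours prevent \<open>P\<close> and
  \<open>Q\<close> from being interchanged.\<close>

lemma K4_in_BGR_3: "K4 \<in> BGR 3"
proof -
  define P where "P = {{1, 2}, {3, 4::nat}}"
  define Q where "Q = {{1, 3}, {2, 4::nat}}"
  define c where "c Y = (if Y \<in> P then 1 else if Y \<in> Q then 2 else 0 :: nat)" for Y
  have PQ: "P \<inter> Q = {}" by (auto simp: P_def Q_def doubleton_eq_iff)
  have "snd K4 = colour_preserving 4 c"
  proof (intro equalityI subsetI)
    fix \<sigma> assume "\<sigma> \<in> snd K4"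
    then have p: "\<sigma> permutes {1..4}" and im: "(\<lambda>Y. \<sigma> ` Y) ` P = P" "(\<lambda>Y. \<sigma> ` Y) ` Q = Q"
      unfolding K4_mem_iff by (auto simp: P_def Q_def insert_commute)
    have mem: "\<sigma> ` Y \<in> (\<lambda>Y. \<sigma> ` Y) ` R \<longleftrightarrow> Y \<in> R" for Y R
      using permutes_inj[OF p] by (auto simp: inj_image_eq_iff)
    have "c (\<sigma> ` Y) = c Y" for Y using mem[of Y P] mem[of Y Q] unfolding im by (simp add: c_def)
    then show "\<sigma> \<in> colour_preserving 4 c" using p by (simp add: colour_preserving_def)
  next
    fix \<sigma> assume "\<sigma> \<in> colour_preserving 4 c"
    then have p: "\<sigma> permutes {1..4}" and s: "\<And>Y. Y \<subseteq> {1..4} \<Longrightarrow> c (\<sigma> ` Y) = c Y"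
      by (auto simp: colour_preserving_def)
    have cP: "\<sigma> ` Y \<in> P" if "Y \<in> P" for Y
    proof -
      have "Y \<subseteq> {1..4}" using that by (auto simp: P_def)
      then have "c (\<sigma> ` Y) = 1" using s that by (simp add: c_def)
      then show ?thesis by (auto simp: c_def split: if_splits)
    qed
    have cQ: "\<sigma> ` Y \<in> Q" if "Y \<in> Q" for Y
    proof -
      have "Y \<subseteq> {1..4}" using that by (auto simp: Q_def)
      moreover have "Y \<notin> P" using that PQ by blast
      ultimately have "c (\<sigma> ` Y) = 2" using s that by (simp add: c_def)
      then show ?thesis by (auto simp: c_def split: if_splits)
    qed
    have "{\<sigma> 1, \<sigma> 2} \<in> P" "{\<sigma> 3, \<sigma> 4} \<in> P" "{\<sigma> 1, \<sigma> 3} \<in> Q"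
      using cP[of "{1, 2}"] cP[of "{3, 4}"] cQ[of "{1, 3}"] by (simp_all add: P_def Q_def)
    then have "\<sigma> 1 = 1 \<and> \<sigma> 2 = 2 \<or> \<sigma> 1 = 2 \<and> \<sigma> 2 = 1 \<or> \<sigma> 1 = 3 \<and> \<sigma> 2 = 4 \<or> \<sigma> 1 = 4 \<and> \<sigma> 2 = 3"
      "\<sigma> 3 = 1 \<and> \<sigma> 4 = 2 \<or> \<sigma> 3 = 2 \<and> \<sigma> 4 = 1 \<or> \<sigma> 3 = 3 \<and> \<sigma> 4 = 4 \<or> \<sigma> 3 = 4 \<and> \<sigma> 4 = 3"
      "\<sigma> 1 = 1 \<and> \<sigma> 3 = 3 \<or> \<sigma> 1 = 3 \<and> \<sigma> 3 = 1 \<or> \<sigma> 1 = 2 \<and> \<sigma> 3 = 4 \<or> \<sigma> 1 = 4 \<and> \<sigma> 3 = 2"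
      unfolding P_def Q_def by (simp_all add: doubleton_eq_iff disj_assoc)
    then show "\<sigma> \<in> snd K4" unfolding K4_mem_iff using p by (elim disjE conjE) simp_all
  qed
  then show ?thesis unfolding BGR_iff by (intro conjI exI[of _ c]) (auto simp: c_def K4_def)
qed

text \<open>Apart from the identity, \<sigma> is an involution of four points without fixed points,
  hence a product of two disjoint transpositions.\<close>

lemma K4_if_involution:
  assumes p: "\<sigma> permutes {1..4}" and inv: "\<And>y. y \<in> {1..4} \<Longrightarrow> \<sigma> (\<sigma> y) = y"
    and fp: "\<And>y. y \<in> {1..4} \<Longrightarrow> \<sigma> y = y \<Longrightarrow> \<sigma> = id"
  shows "\<sigma> \<in> snd K4"
proof (cases "\<sigma> = id")
  case True
  then show ?thesis by (simp add: K4_def)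
next
  case False
  have "\<sigma> y \<in> {1, 2, 3, 4}" if "y \<in> {1, 2, 3, 4}" for y
    using permutes_in_image[OF p, of y] that unfolding atLeastAtMost_1_4 by blast
  then have v: "\<sigma> 1 \<in> {1, 2, 3, 4}" "\<sigma> 2 \<in> {1, 2, 3, 4}" "\<sigma> 3 \<in> {1, 2, 3, 4}" "\<sigma> 4 \<in> {1, 2, 3, 4}" by auto
  have i: "\<sigma> (\<sigma> 1) = 1" "\<sigma> (\<sigma> 2) = 2" "\<sigma> (\<sigma> 3) = 3" "\<sigma> (\<sigma> 4) = 4" using inv by auto
  have n: "\<sigma> 1 \<noteq> 1" "\<sigma> 2 \<noteq> 2" "\<sigma> 3 \<noteq> 3" "\<sigma> 4 \<noteq> 4" using fp[of 1] fp[of 2] fp[of 3] fp[of 4] False by auto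
  consider "\<sigma> 1 = 2" | "\<sigma> 1 = 3" | "\<sigma> 1 = 4" using v(1) n(1) by blast
  then show ?thesis
  proof cases
    case 1
    then have "\<sigma> 2 = 1" using i(1) by simp
    moreover have "\<sigma> 3 = 4" using v(3) n(3) i(3) 1 \<open>\<sigma> 2 = 1\<close> by auto
    moreover have "\<sigma> 4 = 3" using \<open>\<sigma> 3 = 4\<close> i(3) by simp
    ultimately show ?thesis unfolding K4_mem_iff using p 1 by simp
  next
    case 2
    then have "\<sigma> 3 = 1" using i(1) by simp
    moreover have "\<sigma> 2 = 4" using v(2) n(2) i(2) 2 \<open>\<sigma> 3 = 1\<close> by auto
    moreover have "\<sigma> 4 = 2" using \<open>\<sigma> 2 = 4\<close> i(2) by simp
    ultimately show ?thesis unfolding K4_mem_iff using p 2 by simp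
  next
    case 3
    then have "\<sigma> 4 = 1" using i(1) by simp
    moreover have "\<sigma> 2 = 3" using v(2) n(2) i(2) 3 \<open>\<sigma> 4 = 1\<close> by auto
    moreover have "\<sigma> 3 = 2" using \<open>\<sigma> 2 = 3\<close> i(2) by simp
    ultimately show ?thesis unfolding K4_mem_iff using p 3 by simp
  qed
qed

section \<open>Cyclic groups of degree three, four and five\<close>

definition cyc :: "nat \<Rightarrow> nat \<Rightarrow> nat" where
  "cyc p = cycle_of_list [1..<Suc p]"

lemma cyclic_perm_group_eq: "cyclic_perm_group p = (p, generate (sym_group p) {cyc p})"
  by (simp only: cyclic_perm_group_def cyc_def)

lemma cyc_apply:
  assumes "p \<in> {3, 4, 5}"
  shows "cyc p i = (if 1 \<le> i \<and> i < p then Suc i else if i = p then 1 else i)"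
proof -
  have "[1..<Suc 3] = [1, 2, 3]" "[1..<Suc 4] = [1, 2, 3, 4]" "[1..<Suc 5] = [1, 2, 3, 4, 5]"
    by code_simp+
  then have "cyc 3 = transpose 1 2 \<circ> transpose 2 3"
    "cyc 4 = transpose 1 2 \<circ> (transpose 2 3 \<circ> transpose 3 4)"
    "cyc 5 = transpose 1 2 \<circ> (transpose 2 3 \<circ> (transpose 3 4 \<circ> transpose 4 5))"
    unfolding cyc_def by simp_all
  then show ?thesis using assms by (elim insertE emptyE) (simp_all add: transpose_def)
qed

lemma cyc_permutes: "cyc p permutes {1..p}"
  using cycle_permutes[of "[1..<Suc p]"] unfolding cyc_def set_upt atLeastLessThanSuc_atLeastAtMost .

lemma cyc_power:
  assumes p: "p \<in> {3, 4, 5}"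
  shows "(cyc p ^^ j) i = (if 1 \<le> i \<and> i \<le> p then Suc ((i - 1 + j) mod p) else i)"
proof (induction j)
  case (Suc j)
  show ?case
  proof (cases "1 \<le> i \<and> i \<le> p")
    case True
    have "p > 0" using p by auto
    then have l: "(i - 1 + j) mod p < p" by simp
    have "(cyc p ^^ Suc j) i = cyc p (Suc ((i - 1 + j) mod p))" using Suc True by simp
    also have "\<dots> = Suc ((i - 1 + Suc j) mod p)"
      unfolding cyc_apply[OF p] using l by (auto simp: mod_Suc)
    finally show ?thesis using True by simp
  next
    case False
    then show ?thesis using Suc p by (auto simp: cyc_apply)
  qed
qed auto

text \<open>Commuting with the cycle is the property by which the reflection is later seen to lie
  outside the group.\<close>

lemma cyclic_perm_group_commute:
  assumes "\<sigma> \<in> snd (cyclic_perm_group p)"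
  shows "\<sigma> \<circ> cyc p = cyc p \<circ> \<sigma>" "\<sigma> permutes {1..p}"
proof -
  have "\<sigma> \<in> generate (sym_group p) {cyc p}" using assms by (simp add: cyclic_perm_group_eq)
  then have "\<sigma> \<circ> cyc p = cyc p \<circ> \<sigma> \<and> \<sigma> permutes {1..p}"
  proof induction
    case one
    show ?case unfolding sym_group_one by (intro conjI permutes_id) simp
  next
    case (incl h)
    then show ?case using cyc_permutes by simp
  next
    case (inv h)
    then have h: "h = cyc p" by simp
    have "cyc p \<in> carrier (sym_group p)" using cyc_permutes by (simp add: sym_group_carrier)
    then show ?case unfolding h
      using permutes_inv_o[OF cyc_permutes[of p]] permutes_inv[OF cyc_permutes[of p]] by simp
  next
    case (eng h1 h2)
    then have "h1 \<circ> h2 \<circ> cyc p = cyc p \<circ> (h1 \<circ> h2)" by (metis comp_assoc)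
    then show ?case using eng.IH unfolding sym_group_mult by (blast intro: permutes_compose)
  qed
  then show "\<sigma> \<circ> cyc p = cyc p \<circ> \<sigma>" "\<sigma> permutes {1..p}" by auto
qed

lemma cyc_power_mem: "cyc p ^^ j \<in> snd (cyclic_perm_group p)"
proof (induction j)
  case 0
  show ?case using generate.one[of "sym_group p" "{cyc p}"]
    by (simp only: cyclic_perm_group_eq snd_conv funpow.simps(1) sym_group_one)
next
  case (Suc j)
  then have "cyc p \<otimes>\<^bsub>sym_group p\<^esub> (cyc p ^^ j) \<in> generate (sym_group p) {cyc p}"
    by (intro generate.eng) (auto simp: cyclic_perm_group_eq intro: generate.incl)
  then show ?case unfolding cyclic_perm_group_eq sym_group_mult by (simp only: snd_conv funpow.simps(2))
qed

definition reflection :: "nat \<Rightarrow> nat \<Rightarrow> nat" where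
  "reflection p i = (if 1 \<le> i \<and> i \<le> p then Suc p - i else i)"

lemma reflection_permutes: "p \<le> n \<Longrightarrow> reflection p permutes {1..n}"
proof (rule bij_imp_permutes)
  assume "p \<le> n"
  then show "bij_betw (reflection p) {1..n} {1..n}"
    by (intro bij_betw_byWitness[where f' = "reflection p"]) (auto simp: reflection_def)
qed (auto simp: reflection_def)

text \<open>Up to five points on a cycle, every subset is its own mirror image up to rotation; there
  are few enough subsets to check them by evaluation. On six points \<open>{1, 2, 4}\<close> fails,
  which is the triple used in \<open>rigid_on_cyclic\<close>.\<close>

lemma reflection_is_rotation_on_subsets:
  assumes p: "p \<in> {3, 4, 5}" and Z: "Z \<subseteq> {1..p}"
  shows "\<exists>j. reflection p ` Z = (cyc p ^^ j) ` Z"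
proof -
  have chk: "\<forall>p\<in>{3, 4, 5}. \<forall>zs\<in>set (subseqs [1..<Suc p]). \<exists>j\<in>{0..<p}.
    (\<lambda>i. Suc p - i) ` set zs = (\<lambda>i. Suc ((i - 1 + j) mod p)) ` set zs"
    by code_simp
  have "Z \<in> set ` set (subseqs [1..<Suc p])" unfolding subseqs_powset using Z by auto
  then obtain zs where zs: "zs \<in> set (subseqs [1..<Suc p])" "Z = set zs" by blast
  obtain j where "(\<lambda>i. Suc p - i) ` Z = (\<lambda>i. Suc ((i - 1 + j) mod p)) ` Z"
    using chk p zs by blast
  moreover have "reflection p ` Z = (\<lambda>i. Suc p - i) ` Z" using Z by (intro image_cong) (auto simp: reflection_def)
  moreover have "(cyc p ^^ j) ` Z = (\<lambda>i. Suc ((i - 1 + j) mod p)) ` Z"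
    using Z by (intro image_cong) (auto simp: cyc_power[OF p])
  ultimately show ?thesis by metis
qed

text \<open>A suitable power of the cycle has the same image as the reflection on the part of
  \<open>Y\<close> in \<open>{1..p}\<close>, and both fix all other points. The commutation at 1
  fails for the reflection because \<open>p\<close> is at least 3. The hypotheses cover the cyclic
  group alone as well as with a second summand.\<close>

lemma not_BGR_if_cyclic_summand:
  assumes p: "p \<in> {3, 4, 5}" "p \<le> fst G" and pow: "\<And>j. cyc p ^^ j \<in> snd G"
    and comm: "\<And>\<sigma>. \<sigma> \<in> snd G \<Longrightarrow> \<sigma> (cyc p 1) = cyc p (\<sigma> 1)"
  shows "G \<notin> BGR k"
proof (rule not_BGR_if_orbit_equivalent)
  show "reflection p permutes {1..fst G}" using p(2) by (rule reflection_permutes)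
  show "reflection p \<notin> snd G"
  proof
    assume "reflection p \<in> snd G"
    then have "reflection p (cyc p 1) = cyc p (reflection p 1)" by (rule comm)
    then show False using p(1) by (auto simp: cyc_apply reflection_def)
  qed
  fix Y :: "nat set"
  obtain j where j: "reflection p ` (Y \<inter> {1..p}) = (cyc p ^^ j) ` (Y \<inter> {1..p})"
    using reflection_is_rotation_on_subsets[OF p(1), of "Y \<inter> {1..p}"] by auto
  have "reflection p ` (Y - {1..p}) = (cyc p ^^ j) ` (Y - {1..p})"
    by (intro image_cong) (auto simp: reflection_def cyc_power[OF p(1)])
  then have "reflection p ` (Y \<inter> {1..p} \<union> (Y - {1..p})) = (cyc p ^^ j) ` (Y \<inter> {1..p} \<union> (Y - {1..p}))"
    unfolding image_Un using j by simp
  moreover have "Y \<inter> {1..p} \<union> (Y - {1..p}) = Y" by blast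
  ultimately show "\<exists>\<tau>\<in>snd G. reflection p ` Y = \<tau> ` Y" using pow by auto
qed

lemma cyclic_perm_group_not_BGR:
  assumes "p \<in> {3, 4, 5}"
  shows "cyclic_perm_group p \<notin> BGR k"
proof (rule not_BGR_if_cyclic_summand[OF assms _ cyc_power_mem])
  fix \<sigma> assume "\<sigma> \<in> snd (cyclic_perm_group p)"
  from cyclic_perm_group_commute(1)[OF this] show "\<sigma> (cyc p 1) = cyc p (\<sigma> 1)" by (rule comp_eq_dest)
qed (simp add: cyclic_perm_group_eq)

lemma cyclic_direct_sum_not_BGR:
  assumes p: "p \<in> {3, 4, 5}" and D: "perm_group D"
  shows "direct_sum (cyclic_perm_group p) D \<notin> BGR k"
proof (rule not_BGR_if_cyclic_summand[OF p])
  have fst: "fst (cyclic_perm_group p) = p" by (simp add: cyclic_perm_group_eq)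
  show "p \<le> fst (direct_sum (cyclic_perm_group p) D)" by (simp add: direct_sum_def fst)
  show "cyc p ^^ j \<in> snd (direct_sum (cyclic_perm_group p) D)" for j
  proof -
    have "cyc p ^^ j = (\<lambda>i. if i \<le> p then (cyc p ^^ j) i else id (i - p) + p)"
      by (auto simp: fun_eq_iff cyc_power[OF p])
    then show ?thesis
      using cyc_power_mem[of j p] perm_group_members(3)[OF D] unfolding direct_sum_def fst snd_conv by blast
  qed
  fix \<sigma> assume "\<sigma> \<in> snd (direct_sum (cyclic_perm_group p) D)"
  then obtain a b where a: "a \<in> snd (cyclic_perm_group p)"
    and s: "\<sigma> = (\<lambda>i. if i \<le> p then a i else b (i - p) + p)"
    unfolding direct_sum_def fst snd_conv by blast
  have "a (cyc p 1) = cyc p (a 1)" using cyclic_perm_group_commute(1)[OF a] by (rule comp_eq_dest)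
  moreover have "cyc p 1 \<le> p" "1 \<le> p" using p by (auto simp: cyc_apply)
  ultimately show "\<sigma> (cyc p 1) = cyc p (\<sigma> 1)" by (simp add: s)
qed

lemma exceptional_cases:
  assumes "exceptional A"
  shows "(\<forall>k\<ge>2. A \<notin> BGR k) \<or> (perm_iso A K4 \<and> A \<in> BGR 3)"
proof -
  have "A \<notin> BGR k" if "perm_iso A G" "G \<notin> BGR k" for G k using BGR_perm_iso that by blast
  moreover have "A \<in> BGR 3" if "perm_iso A K4" using BGR_perm_iso[OF perm_iso_sym[OF that] K4_in_BGR_3] .
  ultimately show ?thesis
    using assms cyclic_perm_group_not_BGR cyclic_direct_sum_not_BGR unfolding exceptional_def by blast
qed

section \<open>Combining the orbits\<close>

context normal_stabilizers
begin

section \<open>Fixed points and nontrivial orbits\<close>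

definition fixed_points :: "'a set" where
  "fixed_points = {i \<in> X. \<forall>\<sigma>\<in>A. \<sigma> i = i}"

text \<open>One-point orbits have no nonempty proper subsets and cannot serve as blocks, so they are
  gathered in \<open>fixed_points\<close>.\<close>

definition orbits :: "'a set set" where
  "orbits = {orbit p | p. p \<in> X \<and> card (orbit p) \<ge> 2}"

lemma orbit_eq: "y \<in> orbit p \<Longrightarrow> orbit y = orbit p"
proof -
  assume "y \<in> orbit p"
  then obtain \<sigma> where s: "\<sigma> \<in> A" "y = \<sigma> p" by (auto simp: orbit_def)
  have "p = inv' \<sigma> y" using s inv_apply(1) by simp
  then have "p \<in> orbit y" using orbit_closed[OF inv_mem[OF s(1)] base_in_orbit] by metis
  have "z \<in> orbit b" if z: "z \<in> orbit a" and a: "a \<in> orbit b" for a b z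
  proof -
    obtain \<tau> where "\<tau> \<in> A" "z = \<tau> a" using z by (auto simp: orbit_def)
    then show ?thesis using orbit_closed a by simp
  qed
  then show ?thesis using \<open>p \<in> orbit y\<close> \<open>y \<in> orbit p\<close> by blast
qed

lemma orbitsE:
  assumes "B \<in> orbits"
  obtains p where "p \<in> X" "B = orbit p" "card B \<ge> 2"
  using assms unfolding orbits_def by blast

lemma card_orbits: "B \<in> orbits \<Longrightarrow> card B \<ge> 2"
  by (elim orbitsE)

lemma orbits_as_orbit: "B \<in> orbits \<Longrightarrow> y \<in> B \<Longrightarrow> B = orbit y"
  using orbitsE orbit_eq by metis

lemma orbits_nonempty: "B \<in> orbits \<Longrightarrow> B \<noteq> {}"
  using orbitsE base_in_orbit by (metis empty_iff)

lemma orbits_disjoint: "B \<in> orbits \<Longrightarrow> B' \<in> orbits \<Longrightarrow> B \<noteq> B' \<Longrightarrow> B \<inter> B' = {}"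
  using orbits_as_orbit by (metis disjoint_iff)

lemma orbits_subset: "B \<in> orbits \<Longrightarrow> B \<subseteq> X"
  using orbitsE orbit_subset by metis

lemma orbits_image: "B \<in> orbits \<Longrightarrow> \<sigma> \<in> A \<Longrightarrow> \<sigma> ` B = B"
  using orbitsE orbit_image by metis

lemma finite_orbits: "finite orbits" "B \<in> orbits \<Longrightarrow> finite B"
proof -
  have "orbits \<subseteq> Pow X" using orbits_subset by blast
  then show "finite orbits" using finite_points by (auto intro: finite_subset)
  show "B \<in> orbits \<Longrightarrow> finite B" using orbits_subset finite_points finite_subset by blast
qed

lemma orbits_fixed_points: "B \<in> orbits \<Longrightarrow> B \<inter> fixed_points = {}"
proof -
  assume B: "B \<in> orbits"
  have False if x: "x \<in> B" "x \<in> fixed_points" for x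
  proof -
    have "orbit x = {x}" using x(2) base_in_orbit[of x] by (auto simp: orbit_def fixed_points_def)
    then have "card B = 1" using orbits_as_orbit[OF B x(1)] by simp
    then show False using B by (elim orbitsE) simp
  qed
  then show ?thesis by blast
qed

lemma points_partition: "X = fixed_points \<union> \<Union>orbits"
proof (intro equalityI subsetI)
  fix x assume x: "x \<in> X"
  show "x \<in> fixed_points \<union> \<Union>orbits"
  proof (cases "card (orbit x) \<ge> 2")
    case True
    then have "orbit x \<in> orbits" using x by (auto simp: orbits_def)
    then show ?thesis using base_in_orbit by blast
  next
    case False
    have fin: "finite (orbit x)" using orbit_subset[OF x] finite_points finite_subset by blast
    have "\<sigma> x = x" if "\<sigma> \<in> A" for \<sigma>
    proof (rule ccontr)
      assume n: "\<sigma> x \<noteq> x"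
      have "{x, \<sigma> x} \<subseteq> orbit x" using base_in_orbit orbit_closed[OF that base_in_orbit] by blast
      then have "card {x, \<sigma> x} \<le> card (orbit x)" using fin card_mono by blast
      then show False using n False by simp
    qed
    then show ?thesis using x by (simp add: fixed_points_def)
  qed
qed (use orbits_subset in \<open>auto simp: fixed_points_def\<close>)

lemma agree_everywhere:
  assumes "\<phi> permutes X" "a \<in> A" "\<And>x. x \<in> fixed_points \<Longrightarrow> \<phi> x = x"
    and "\<And>B y. B \<in> orbits \<Longrightarrow> y \<in> B \<Longrightarrow> \<phi> y = a y"
  shows "\<phi> = a"
proof
  fix x
  consider "x \<notin> X" | "x \<in> fixed_points" | B where "B \<in> orbits" "x \<in> B" using points_partition by blast
  then show "\<phi> x = a x"
  proof cases
    case 1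
    then show ?thesis using assms(1) permutes[OF assms(2)] by (simp add: permutes_not_in)
  next
    case 2
    then have "a x = x" using assms(2) by (simp add: fixed_points_def)
    then show ?thesis using assms(3)[OF 2] by simp
  next
    case 3
    then show ?thesis using assms(4) by blast
  qed
qed

lemma trivial_on_orbit:
  assumes "B \<in> orbits" "\<sigma> \<in> A" "x \<in> B" "\<sigma> x = x" "y \<in> B"
  shows "\<sigma> y = y"
  using agree_on_orbit[OF assms(2) id_mem, of x y] orbits_as_orbit[OF assms(1,3)] assms by simp

lemma card_image_mem: "\<sigma> \<in> A \<Longrightarrow> card (\<sigma> ` Y) = card Y"
  by (rule card_image, rule inj_on_subset[OF inj_mem]) simp_all

text \<open>The members of a given size form an \<open>A\<close>-invariant family, so their union
  and their intersection are invariant under \<open>A\<close>, which is transitive on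
  \<open>B\<close>. Since members are nonempty and proper, the union is all of \<open>B\<close> and
  the intersection is empty.\<close>

lemma chain_family_spread:
  assumes B: "B \<in> orbits" and c: "chain_family B \<Z>" and Z: "Z \<in> \<Z>"
  shows "\<Union>{Y \<in> \<Z>. card Y = card Z} = B \<and> \<Inter>{Y \<in> \<Z>. card Y = card Z} = {}"
proof -
  let ?M = "{Y \<in> \<Z>. card Y = card Z}"
  have inv: "\<sigma> ` Y \<in> ?M" if "\<sigma> \<in> A" "Y \<in> ?M" for \<sigma> Y
    using that c card_image_mem by (auto simp: chain_family_def)
  have proper: "Y \<noteq> {} \<and> Y \<subset> B" if "Y \<in> \<Z>" for Y using c that by (simp add: chain_family_def)
  have move: "\<exists>\<sigma>\<in>A. z = \<sigma> y" if "y \<in> B" "z \<in> B" for y z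
    using orbits_as_orbit[OF B that(1)] that(2) by (auto simp: orbit_def)
  obtain y where y: "y \<in> Z" "y \<in> B" using proper[OF Z] by blast
  have "z \<in> \<Union>?M" if z: "z \<in> B" for z
  proof -
    obtain \<sigma> where s: "\<sigma> \<in> A" "z = \<sigma> y" using move[OF y(2) z] by blast
    then have "\<sigma> ` Z \<in> ?M" using inv Z by blast
    moreover have "z \<in> \<sigma> ` Z" using s y by blast
    ultimately show ?thesis by blast
  qed
  then have 1: "\<Union>?M = B" using proper by blast
  have False if x: "x \<in> \<Inter>?M" for x
  proof -
    have xB: "x \<in> B" using x Z proper by blast
    have "z \<in> Z" if z: "z \<in> B" for z
    proof -
      obtain \<sigma> where s: "\<sigma> \<in> A" "z = \<sigma> x" using move[OF xB z] by blast
      have "inv' \<sigma> ` Z \<in> ?M" using inv[OF inv_mem[OF s(1)]] Z by blast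
      then have "x \<in> inv' \<sigma> ` Z" using x by blast
      then obtain v where "v \<in> Z" "x = inv' \<sigma> v" by blast
      then show ?thesis using s inv_apply(2)[OF s(1)] by simp
    qed
    then show False using proper[OF Z] by blast
  qed
  then show ?thesis using 1 by blast
qed

text \<open>The enumerations of fixed points and orbits are chosen inside the proof. Therefore
  \<open>nb\<close> speaks of an arbitrary \<open>U\<close> that contains the fixed points and is
  compatible with the orbits, in place of an initial segment.\<close>

lemma family_from_chain:
  assumes chains: "\<And>B. B \<in> orbits \<Longrightarrow> chain_family B (\<Z> B)"
    and \<G>: "\<And>Y. Y \<in> \<G> \<Longrightarrow> Y \<subseteq> X \<and> card Y \<in> T" "\<And>\<sigma> Y. \<sigma> \<in> A \<Longrightarrow> Y \<in> \<G> \<Longrightarrow> \<sigma> ` Y \<in> \<G>"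
    and T: "T \<subseteq> {w, Suc w}" "\<And>t. t \<in> T \<Longrightarrow> t > card fixed_points"
    and nb: "\<And>Y U Z B. Y \<in> \<G> \<Longrightarrow> B \<in> orbits \<Longrightarrow> Z \<subset> B \<Longrightarrow> fixed_points \<subseteq> U \<Longrightarrow>
      (\<And>B'. B' \<in> orbits \<Longrightarrow> B' \<subseteq> U \<or> B' \<inter> U = {}) \<Longrightarrow> Y \<noteq> U \<union> Z"
    and rigid: "\<And>\<phi>. \<phi> permutes X \<Longrightarrow> (\<And>x. x \<in> fixed_points \<Longrightarrow> \<phi> x = x) \<Longrightarrow>
      (\<And>B. B \<in> orbits \<Longrightarrow> preserves B (\<Z> B) \<phi>) \<Longrightarrow> (\<And>Y. Y \<in> \<G> \<Longrightarrow> \<phi> ` Y \<in> \<G>) \<Longrightarrow> \<phi> \<in> A"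
  shows "\<exists>F\<subseteq>Pow X. (\<forall>\<sigma>\<in>A. \<forall>Y\<in>F. \<sigma> ` Y \<in> F) \<and> (\<forall>\<phi>. \<phi> permutes X \<longrightarrow> (\<forall>Y\<in>F. \<phi> ` Y \<in> F) \<longrightarrow> \<phi> \<in> A)"
proof -
  have "finite fixed_points" using finite_points by (simp add: fixed_points_def)
  then obtain fs where fs: "set fs = fixed_points" "distinct fs" using finite_distinct_list by blast
  obtain bs where bs: "set bs = orbits" "distinct bs" using finite_distinct_list[OF finite_orbits(1)] by blast
  have len: "length fs = card fixed_points" using fs distinct_card by metis
  interpret C: block_chain fs bs \<Z> \<G> T w
  proof
    show "bs ! i \<inter> bs ! j = {}" if "i < length bs" "j < length bs" "i \<noteq> j" for i j
      using that bs by (intro orbits_disjoint) (auto simp: nth_eq_iff_index_eq simp flip: bs(1))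
    show "\<Z> B \<noteq> {}" if "B \<in> set bs" for B using chains that bs by (simp add: chain_family_def)
    show "Z \<noteq> {} \<and> Z \<subset> B" if "B \<in> set bs" "Z \<in> \<Z> B" for B Z
      using chains[of B] that bs by (simp add: chain_family_def)
    show "\<Union>{Y \<in> \<Z> B. card Y = card Z} = B \<and> \<Inter>{Y \<in> \<Z> B. card Y = card Z} = {}"
      if "B \<in> set bs" "Z \<in> \<Z> B" for B Z
      using that bs chains by (intro chain_family_spread) auto
  qed (use fs bs finite_orbits orbits_fixed_points \<G> T len in auto)
  have points: "C.points = X" using points_partition fs bs by (simp add: C.points_def)
  have initial_image: "\<sigma> ` C.initial j = C.initial j" if "\<sigma> \<in> A" for \<sigma> j
  proof -
    have "\<sigma> x = x" if "x \<in> set fs" for x using that \<open>\<sigma> \<in> A\<close> fs by (simp add: fixed_points_def)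
    then have "\<sigma> ` set fs = set fs" by simp
    moreover have "\<sigma> ` B = B" if "B \<in> set (take j bs)" for B
      using orbits_image[OF _ \<open>\<sigma> \<in> A\<close>] that set_take_subset bs by (metis subset_iff)
    then have "\<sigma> ` \<Union>(set (take j bs)) = \<Union>(set (take j bs))" unfolding image_Union by simp
    ultimately show ?thesis by (simp add: C.initial_def image_Un)
  qed
  have initial_sub: "C.initial j \<subseteq> X" for j
  proof -
    have "set (take j bs) \<subseteq> set bs" by (rule set_take_subset)
    then have "C.initial j \<subseteq> C.points" unfolding C.initial_def C.points_def by blast
    then show ?thesis using points by simp
  qed
  show ?thesis
  proof (intro exI[of _ C.chain] conjI ballI allI impI)
    show "C.chain \<subseteq> Pow X"
    proof
      fix Y assume "Y \<in> C.chain"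
      then show "Y \<in> Pow X"
      proof (cases rule: C.chain_cases)
        case (fixed j)
        then have "Y \<subseteq> set fs" using set_take_subset by metis
        then show ?thesis using fs points_partition by blast
      next
        case (initial j)
        then show ?thesis using initial_sub by simp
      next
        case (block j Z)
        then have B: "bs ! j \<in> orbits" using bs(1) nth_mem by metis
        then have "Z \<subseteq> X" using C.family_proper[of "bs ! j" Z] block orbits_subset[OF B] bs by auto
        then show ?thesis using block initial_sub by simp
      next
        case extra
        then show ?thesis using \<G> by blast
      qed
    qed
  next
    fix \<sigma> Y assume s: "\<sigma> \<in> A" and Y: "Y \<in> C.chain"
    from Y show "\<sigma> ` Y \<in> C.chain"
    proof (cases rule: C.chain_cases)
      case (fixed j)
      have "\<sigma> x = x" if "x \<in> Y" for x
        using that fixed fs s set_take_subset[of j fs] by (auto simp: fixed_points_def)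
      then have "\<sigma> ` Y = Y" by simp
      then show ?thesis using Y by simp
    next
      case (initial j)
      then show ?thesis using initial_image[OF s] Y by simp
    next
      case (block j Z)
      then have B: "bs ! j \<in> orbits" using bs(1) nth_mem by metis
      then have "\<sigma> ` Z \<in> \<Z> (bs ! j)" using chains[OF B] block s by (simp add: chain_family_def)
      moreover have "\<sigma> ` Y = C.initial j \<union> \<sigma> ` Z" using initial_image[OF s] block by (simp add: image_Un)
      ultimately show ?thesis using block(1) unfolding C.chain_def by blast
    next
      case extra
      then show ?thesis using \<G>(2)[OF s] unfolding C.chain_def by blast
    qed
  next
    fix \<phi> assume p: "\<phi> permutes X" and F: "\<forall>Y\<in>C.chain. \<phi> ` Y \<in> C.chain"
    interpret M: block_chain_map fs bs \<Z> \<G> T w \<phi>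
    proof
      show "\<phi> permutes C.points" using p points by simp
      show "\<phi> ` Y \<in> C.chain" if "Y \<in> C.chain" for Y using F that by blast
      fix Y j Z assume Y: "Y \<in> \<G>" and j: "j < length bs" and Z: "Z \<subset> bs ! j"
      show "Y \<noteq> C.initial j \<union> Z"
      proof (rule nb[OF Y])
        show "bs ! j \<in> orbits" using j bs(1) nth_mem by metis
        show "Z \<subset> bs ! j" by (rule Z)
        show "fixed_points \<subseteq> C.initial j" using fs by (auto simp: C.initial_def)
        fix B' assume B': "B' \<in> orbits"
        show "B' \<subseteq> C.initial j \<or> B' \<inter> C.initial j = {}"
        proof (cases "B' \<in> set (take j bs)")
          case True
          then show ?thesis by (auto simp: C.initial_def)
        next
          case False
          have "B' \<inter> B = {}" if "B \<in> set (take j bs)" for B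
          proof (rule orbits_disjoint[OF B'])
            show "B \<in> orbits" using that set_take_subset bs by (metis subset_iff)
            show "B' \<noteq> B" using that False by blast
          qed
          moreover have "B' \<inter> set fs = {}" using orbits_fixed_points[OF B'] fs by simp
          ultimately show ?thesis by (auto simp: C.initial_def)
        qed
      qed
    qed
    show "\<phi> \<in> A"
    proof (rule rigid[OF p])
      show "\<phi> x = x" if "x \<in> fixed_points" for x using M.fixed_preserved that fs by simp
      show "\<phi> ` Y \<in> \<G>" if "Y \<in> \<G>" for Y using M.extra_preserved that by blast
      fix B assume "B \<in> orbits"
      then obtain j where j: "j < length bs" "B = bs ! j" using bs by (metis in_set_conv_nth)
      have "inj_on \<phi> B" using M.inj_map by (rule inj_on_subset) simp
      then show "preserves B (\<Z> B) \<phi>"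
        using M.block_preserved[OF j(1)] M.family_preserved[OF j(1)] j(2)
        by (simp add: preserves_def bij_betw_def)
    qed
  qed
qed

section \<open>Excluding the extra symmetries\<close>

definition klein_like :: bool where
  "klein_like \<longleftrightarrow> card X = 4 \<and> (\<forall>p\<in>X. orbit p = X) \<and> (\<forall>\<sigma>\<in>A. \<forall>y\<in>X. \<sigma> (\<sigma> y) = y)"

definition cyclic_factor :: "('a \<Rightarrow> 'a) \<Rightarrow> 'a set \<Rightarrow> bool" where
  "cyclic_factor b B \<longleftrightarrow> b \<in> A \<and> B \<in> orbits \<and> cycle_on b B \<and> (\<forall>x\<in>X - B. b x = x)"

text \<open>If \<open>S\<close> were invariant under \<open>b\<close>, so would be
  \<open>B - S\<close>. One of them contains the starting point \<open>p\<close>, whose images under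
  powers of \<open>b\<close> fill \<open>B\<close>.\<close>

lemma cycle_on_image:
  assumes "cycle_on b B" "S \<subset> B" "S \<noteq> {}" "b \<in> A"
  shows "b ` S \<noteq> S"
proof
  assume e: "b ` S = S"
  obtain p where p: "p \<in> B" "B = range (\<lambda>k. (b ^^ k) p)" using assms(1) by (auto simp: cycle_on_def)
  obtain x where x: "x \<in> S" using assms(3) by blast
  have fin: "finite B" using assms(1) by (auto simp: cycle_on_def intro: card_ge_0_finite)
  then have "finite (B - S)" by simp
  have bB: "b ` B \<subseteq> B"
  proof
    fix y assume "y \<in> b ` B"
    then obtain k where "y = (b ^^ Suc k) p" using p(2) by auto
    then show "y \<in> B" unfolding p(2) by (rule range_eqI)
  qed
  have inj: "inj b" using inj_mem assms(4) .
  have "b ` (B - S) \<subseteq> B - S"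
  proof
    fix y assume "y \<in> b ` (B - S)"
    then obtain z where z: "z \<in> B" "z \<notin> S" "y = b z" by blast
    have "b z \<notin> b ` S" using z(2) inj_image_mem_iff[OF inj, of z S] by simp
    then show "y \<in> B - S" using bB z e by auto
  qed
  then have pw: "(b ^^ k) y \<in> B - S" if "y \<in> B - S" for k y
    using that by (induction k) auto
  have pS: "(b ^^ k) y \<in> S" if "y \<in> S" for k y
    using that e by (induction k) auto
  show False
  proof (cases "p \<in> S")
    case True
    then have "B \<subseteq> S" using pS p(2) by blast
    then show False using assms(2) by blast
  next
    case False
    then have "B \<subseteq> B - S" using pw[of p] p by blast
    then show False using x assms(2) by blast
  qed
qed

text \<open>With at most one nontrivial orbit there are no actions to be tied together, so rigidity
  alone suffices and no extra sets are added.\<close>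

lemma invariant_family_single:
  assumes one: "\<And>B B'. B \<in> orbits \<Longrightarrow> B' \<in> orbits \<Longrightarrow> B = B'"
    and Z: "\<And>B. B \<in> orbits \<Longrightarrow> chain_family B (\<Z> B) \<and> rigid_family B (\<Z> B)"
  shows "\<exists>F\<subseteq>Pow X. (\<forall>\<sigma>\<in>A. \<forall>Y\<in>F. \<sigma> ` Y \<in> F) \<and> (\<forall>\<phi>. \<phi> permutes X \<longrightarrow> (\<forall>Y\<in>F. \<phi> ` Y \<in> F) \<longrightarrow> \<phi> \<in> A)"
proof (rule family_from_chain[of \<Z> "{}" "{}" 0])
  fix \<phi> assume p: "\<phi> permutes X" and f: "\<And>x. x \<in> fixed_points \<Longrightarrow> \<phi> x = x"
    and B: "\<And>B. B \<in> orbits \<Longrightarrow> preserves B (\<Z> B) \<phi>"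
  show "\<phi> \<in> A"
  proof (cases "orbits = {}")
    case True
    then have "\<phi> = id" using agree_everywhere[OF p id_mem f] by simp
    then show ?thesis using id_mem by simp
  next
    case False
    then obtain B0 where B0: "B0 \<in> orbits" by blast
    then obtain a where a: "a \<in> A" "\<And>y. y \<in> B0 \<Longrightarrow> \<phi> y = a y"
      using Z B unfolding rigid_family_def by blast
    have "\<phi> = a" using a one[OF _ B0] by (intro agree_everywhere[OF p a(1) f]) auto
    then show ?thesis using a by simp
  qed
qed (use Z in auto)

text \<open>Here \<open>E\<close> collects the orbits without a rigid family. The hypothesis
  \<open>several\<close> serves two purposes: it makes the extra sets larger than the set of fixed
  points, as the chain requires, and it distinguishes them from the sets belonging to a
  block.\<close>

lemma invariant_family_several:
  assumes Z: "\<And>B. B \<in> orbits \<Longrightarrow> chain_family B (\<Z> B)"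
    and good: "\<And>B. B \<in> orbits - E \<Longrightarrow> rigid_family B (\<Z> B) \<and> (\<exists>x\<in>B. S B = {x})"
    and bad: "\<And>B. B \<in> E \<Longrightarrow> B \<in> orbits \<and> breaking_pair B (\<Z> B) (S B) (S' B)"
    and several: "(\<exists>B1\<in>orbits. \<exists>B2\<in>orbits. B1 \<noteq> B2) \<or>
      fixed_points \<noteq> {} \<and> (\<exists>B\<in>E. orbits = {B} \<and> card (S B) = 3)"
    and no_factor: "\<And>b B. \<not> cyclic_factor b B"
  shows "\<exists>F\<subseteq>Pow X. (\<forall>\<sigma>\<in>A. \<forall>Y\<in>F. \<sigma> ` Y \<in> F) \<and> (\<forall>\<phi>. \<phi> permutes X \<longrightarrow> (\<forall>Y\<in>F. \<phi> ` Y \<in> F) \<longrightarrow> \<phi> \<in> A)"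
proof -
  have S: "S B \<noteq> {} \<and> S B \<subset> B" if B: "B \<in> orbits" for B
  proof (cases "B \<in> E")
    case True
    then have "S B \<subset> B" "card (S B) = Suc (card (S' B))" using bad by (auto simp: breaking_pair_def)
    then show ?thesis by auto
  next
    case False
    then obtain x where "x \<in> B" "S B = {x}" using good B by blast
    moreover have "B \<noteq> {x}" using card_orbits[OF B] by auto
    ultimately show ?thesis by auto
  qed
  have S': "S' B \<noteq> {} \<and> S' B \<subset> B \<and> card (S B) = Suc (card (S' B)) \<and> B \<in> orbits" if "B \<in> E" for B
    using bad[OF that] by (auto simp: breaking_pair_def)
  \<comment> \<open>If there is only one block, omitting a fixed point is what distinguishes the extra sets from the
    sets of the chain.\<close>
  define D where "D = (if fixed_points = {} then {} else {SOME d. d \<in> fixed_points})"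
  have D: "D \<subseteq> fixed_points" "card D \<le> 1" "fixed_points \<noteq> {} \<Longrightarrow> D \<noteq> {}"
    by (auto simp: D_def some_in_eq)
  \<comment> \<open>A generalized transversal with a part in every orbit: its image ties the actions
    on the different orbits to one group element.\<close>
  define tr where "tr s = (fixed_points - D) \<union> (\<Union>B\<in>orbits. s B)" for s :: "'a set \<Rightarrow> 'a set"
  define ok where "ok s \<longleftrightarrow> (\<forall>B\<in>orbits. s B \<noteq> {} \<and> s B \<subset> B)" for s :: "'a set \<Rightarrow> 'a set"
  have okS: "ok S" using S by (simp add: ok_def)
  have okS': "ok (S(B := S' B))" if "B \<in> E" for B using S S'[OF that] by (simp add: ok_def)
  have tr_sub: "tr s \<subseteq> X" if "ok s" for s
    using that points_partition unfolding tr_def ok_def by blast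
  have tr_inter: "\<sigma> ` tr s \<inter> B = \<sigma> ` s B" if "\<sigma> \<in> A" "ok s" "B \<in> orbits" for \<sigma> s B
  proof -
    have "\<sigma> ` tr s \<inter> \<sigma> ` B = \<sigma> ` (tr s \<inter> B)" using inj_mem[OF that(1)] by (simp add: image_Int)
    moreover have "tr s \<inter> B = s B"
    proof
      show "s B \<subseteq> tr s \<inter> B" using that(2,3) by (auto simp: tr_def ok_def)
      show "tr s \<inter> B \<subseteq> s B"
      proof
        fix x assume x: "x \<in> tr s \<inter> B"
        then have "x \<notin> fixed_points" using orbits_fixed_points[OF that(3)] by blast
        then obtain B' where B': "B' \<in> orbits" "x \<in> s B'" using x by (auto simp: tr_def)
        then have "x \<in> B'" using that(2) by (auto simp: ok_def)
        then have "B' = B" using orbits_disjoint[OF B'(1) that(3)] x by blast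
        then show "x \<in> s B" using B' by simp
      qed
    qed
    ultimately show ?thesis using orbits_image[OF that(3,1)] by simp
  qed
  have fin_fixed: "finite fixed_points" using finite_points by (simp add: fixed_points_def)
  have tr_card: "card (tr s) = card (fixed_points - D) + (\<Sum>B\<in>orbits. card (s B))" if "ok s" for s
  proof -
    have sB: "s B \<subseteq> B" if "B \<in> orbits" for B using \<open>ok s\<close> that by (auto simp: ok_def)
    have "card (\<Union>B\<in>orbits. s B) = (\<Sum>B\<in>orbits. card (s B))"
    proof (rule card_UN_disjoint)
      show "\<forall>B\<in>orbits. finite (s B)" using sB finite_orbits(2) finite_subset by blast
      show "\<forall>B\<in>orbits. \<forall>B'\<in>orbits. B \<noteq> B' \<longrightarrow> s B \<inter> s B' = {}"
        using sB orbits_disjoint by blast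
    qed (rule finite_orbits)
    moreover have "card (tr s) = card (fixed_points - D) + card (\<Union>B\<in>orbits. s B)"
      unfolding tr_def
    proof (rule card_Un_disjoint)
      show "finite (\<Union>B\<in>orbits. s B)" using sB finite_orbits finite_subset by blast
      show "(fixed_points - D) \<inter> (\<Union>B\<in>orbits. s B) = {}" using sB orbits_fixed_points by blast
    qed (use fin_fixed in simp)
    ultimately show ?thesis by simp
  qed
  define w where "w = card (tr S)"
  have card_S': "Suc (card (tr (S(B := S' B)))) = w" if B: "B \<in> E" for B
  proof -
    have Bo: "B \<in> orbits" and c: "card (S B) = Suc (card (S' B))" using S'[OF B] by auto
    have "(\<Sum>C\<in>orbits. card (S C)) = card (S B) + (\<Sum>C\<in>orbits - {B}. card (S C))"
      using finite_orbits(1) Bo by (rule sum.remove)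
    moreover have "(\<Sum>C\<in>orbits. card ((S(B := S' B)) C)) = card (S' B) + (\<Sum>C\<in>orbits - {B}. card (S C))"
      using sum.remove[OF finite_orbits(1) Bo, of "\<lambda>C. card ((S(B := S' B)) C)"] by simp
    ultimately show ?thesis unfolding w_def tr_card[OF okS] tr_card[OF okS'[OF B]] using c by simp
  qed
  define T where "T = (if E = {} then {w} else {w - 1, w})"
  have cS1: "card (S B) \<ge> 1" if "B \<in> orbits" for B
    using S[OF that] finite_orbits(2)[OF that] by (metis Suc_leI One_nat_def card_gt_0_iff finite_subset psubset_imp_subset)
  have cS2: "card (S B) \<ge> 2" if "B \<in> E" for B
  proof -
    have "finite (S' B)" using S'[OF that] finite_orbits(2) finite_subset by blast
    then have "card (S' B) \<ge> 1" using S'[OF that] by (metis Suc_leI One_nat_def card_gt_0_iff)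
    then show ?thesis using S'[OF that] by simp
  qed
  have cD: "card (fixed_points - D) + 1 \<ge> card fixed_points"
    using D fin_fixed by (simp add: card_Diff_subset finite_subset)
  \<comment> \<open>Omitting \<open>D\<close> costs at most one point. In return every orbit
    contributes at least one point and an orbit in \<open>E\<close> at least two; a single orbit in
    \<open>E\<close> contributes three. The variants lose one point again.\<close>
  have large: "w > card fixed_points \<and> (E \<noteq> {} \<longrightarrow> w - 1 > card fixed_points)"
    using several
  proof
    assume "\<exists>B1\<in>orbits. \<exists>B2\<in>orbits. B1 \<noteq> B2"
    then obtain B1 B2 where B12: "B1 \<in> orbits" "B2 \<in> orbits" "B1 \<noteq> B2" by blast
    have two: "(\<Sum>C\<in>orbits. card (S C)) \<ge> card (S B) + 1" if B: "B \<in> orbits" for B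
    proof -
      obtain B' where B': "B' \<in> orbits - {B}" using B12 by blast
      have "(\<Sum>C\<in>orbits. card (S C)) = card (S B) + (\<Sum>C\<in>orbits - {B}. card (S C))"
        using finite_orbits(1) B by (rule sum.remove)
      moreover have "card (S B') \<le> (\<Sum>C\<in>orbits - {B}. card (S C))"
        using B' finite_orbits(1) by (intro member_le_sum) auto
      moreover have "card (S B') \<ge> 1" using cS1 B' by blast
      ultimately show ?thesis by linarith
    qed
    have "w > card fixed_points" using two[OF B12(1)] cS1[OF B12(1)] cD unfolding w_def tr_card[OF okS] by linarith
    moreover have "w - 1 > card fixed_points" if ne: "E \<noteq> {}"
    proof -
      obtain B where "B \<in> E" using ne by blast
      then show ?thesis using two[of B] cS2[of B] S'[of B] cD unfolding w_def tr_card[OF okS] by linarith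
    qed
    ultimately show ?thesis by blast
  next
    assume "fixed_points \<noteq> {} \<and> (\<exists>B\<in>E. orbits = {B} \<and> card (S B) = 3)"
    then have "(\<Sum>B\<in>orbits. card (S B)) = 3" by auto
    then show ?thesis using cD unfolding w_def tr_card[OF okS] by linarith
  qed
  \<comment> \<open>A variant changes \<open>S\<close> on a single orbit, so the other orbits still
    control the group element involved.\<close>
  define \<G> where "\<G> = {\<sigma> ` tr S | \<sigma>. \<sigma> \<in> A} \<union> {\<sigma> ` tr (S(B := S' B)) | \<sigma> B. \<sigma> \<in> A \<and> B \<in> E}"
  have GE: "\<exists>\<sigma>\<in>A. \<exists>s. Y = \<sigma> ` tr s \<and> ok s \<and> (s = S \<or> (\<exists>B\<in>E. s = S(B := S' B)))" if "Y \<in> \<G>" for Y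
    using that okS okS' unfolding \<G>_def by blast
  show ?thesis
  proof (rule family_from_chain[of \<Z> \<G> T "w - 1"])
    fix Y assume "Y \<in> \<G>"
    then obtain \<sigma> s where Y: "\<sigma> \<in> A" "Y = \<sigma> ` tr s" "ok s" "s = S \<or> (\<exists>B\<in>E. s = S(B := S' B))"
      using GE by blast
    have "Y \<subseteq> X" using Y tr_sub[OF Y(3)] permutes_image[OF permutes[OF Y(1)]] by blast
    moreover have "card Y = card (tr s)" using Y card_image_mem by simp
    moreover have "card (tr s) = w \<or> E \<noteq> {} \<and> card (tr s) = w - 1" using Y(4) card_S' w_def by fastforce
    ultimately show "Y \<subseteq> X \<and> card Y \<in> T" by (auto simp: T_def)
  next
    fix \<sigma> Y assume s: "\<sigma> \<in> A" and Y: "Y \<in> \<G>"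
    consider (S) \<tau> where "\<tau> \<in> A" "Y = \<tau> ` tr S" | (S') \<tau> B where "\<tau> \<in> A" "B \<in> E" "Y = \<tau> ` tr (S(B := S' B))"
      using Y unfolding \<G>_def by blast
    then show "\<sigma> ` Y \<in> \<G>"
    proof cases
      case S
      have "\<sigma> ` Y = (\<sigma> \<circ> \<tau>) ` tr S" unfolding S(2) image_comp ..
      then show ?thesis using comp_mem[OF s S(1)] unfolding \<G>_def by blast
    next
      case S'
      have "\<sigma> ` Y = (\<sigma> \<circ> \<tau>) ` tr (S(B := S' B))" unfolding S'(3) image_comp ..
      then show ?thesis using comp_mem[OF s S'(1)] S'(2) unfolding \<G>_def by blast
    qed
  next
    show "T \<subseteq> {w - 1, Suc (w - 1)}" using large by (auto simp: T_def)
    show "t > card fixed_points" if "t \<in> T" for t using that large by (auto simp: T_def split: if_splits)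
  next
    fix Y U Z B assume Y: "Y \<in> \<G>" and B: "B \<in> orbits" and Z: "Z \<subset> B" and U: "fixed_points \<subseteq> U"
      "\<And>B'. B' \<in> orbits \<Longrightarrow> B' \<subseteq> U \<or> B' \<inter> U = {}"
    obtain \<sigma> s where Y': "\<sigma> \<in> A" "Y = \<sigma> ` tr s" "ok s" using GE[OF Y] by blast
    show "Y \<noteq> U \<union> Z"
    proof
      assume eq: "Y = U \<union> Z"
      show False using several
      proof
        \<comment> \<open>A second orbit lies inside \<open>U \<union> Z\<close> or is disjoint from
          it, but it meets every extra set in a nonempty proper part.\<close>
        assume "\<exists>B1\<in>orbits. \<exists>B2\<in>orbits. B1 \<noteq> B2"
        then obtain B' where B': "B' \<in> orbits" "B' \<noteq> B" using B by blast
        then have "B' \<inter> Z = {}" using orbits_disjoint[OF B'(1) B B'(2)] Z by blast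
        then have "Y \<inter> B' = {} \<or> Y \<inter> B' = B'" using U(2)[OF B'(1)] eq by blast
        moreover have "Y \<inter> B' = \<sigma> ` s B'" using tr_inter[OF Y'(1,3) B'(1)] Y'(2) by simp
        moreover have "s B' \<noteq> {}" "s B' \<noteq> B'" using Y'(3) B'(1) by (auto simp: ok_def)
        moreover have "\<sigma> ` s B' = B' \<Longrightarrow> s B' = B'"
          using orbits_image[OF B'(1) Y'(1)] inj_mem[OF Y'(1)] by (metis inj_image_eq_iff)
        ultimately show False by auto
      next
        \<comment> \<open>The set \<open>U\<close> contains the point omitted through
          \<open>D\<close>, which no extra set contains.\<close>
        assume "fixed_points \<noteq> {} \<and> (\<exists>B\<in>E. orbits = {B} \<and> card (S B) = 3)"
        then obtain d where d: "d \<in> D" "d \<in> fixed_points" using D by blast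
        then have "d \<in> \<sigma> ` tr s" using U eq Y'(2) by blast
        then obtain x where x: "x \<in> tr s" "d = \<sigma> x" by blast
        moreover have "\<sigma> d = d" using d(2) Y'(1) by (simp add: fixed_points_def)
        ultimately have "d \<in> tr s" using inj_mem[OF Y'(1)] by (metis injD)
        then obtain C where C: "C \<in> orbits" "d \<in> s C" using d by (auto simp: tr_def)
        then have "d \<in> C" using Y'(3) by (auto simp: ok_def)
        then show False using orbits_fixed_points[OF C(1)] d(2) by blast
      qed
    qed
  next
    fix \<phi> assume p: "\<phi> permutes X" and f: "\<And>x. x \<in> fixed_points \<Longrightarrow> \<phi> x = x"
      and pB: "\<And>B. B \<in> orbits \<Longrightarrow> preserves B (\<Z> B) \<phi>" and pG: "\<And>Y. Y \<in> \<G> \<Longrightarrow> \<phi> ` Y \<in> \<G>"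
    have pcard: "card (\<phi> ` Y) = card Y" for Y :: "'a set"
      by (rule card_image, rule inj_on_subset[OF permutes_inj[OF p]]) simp
    have w0: "w > 0" using large by simp
    have memS: "tr S \<in> \<G>" unfolding \<G>_def using id_mem by (metis (mono_tags, lifting) UnI1 image_id id_apply mem_Collect_eq)
    have "\<phi> ` tr S \<in> \<G>" using pG memS by blast
    \<comment> \<open>Variants have one point fewer, so the image of \<open>tr S\<close> must be an
      image of \<open>tr S\<close> under the group.\<close>
    then obtain a where a: "a \<in> A" "\<phi> ` tr S = a ` tr S"
      unfolding \<G>_def
    proof (elim UnE CollectE exE conjE)
      fix \<sigma> B assume x: "\<phi> ` tr S = \<sigma> ` tr (S(B := S' B))" "\<sigma> \<in> A" "B \<in> E"
      then have "card (tr S) = card (tr (S(B := S' B)))" using pcard card_image_mem by metis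
      then show thesis using card_S'[OF x(3)] w_def by simp
    qed
    have SB: "\<phi> ` S B = a ` S B" if B: "B \<in> orbits" for B
    proof -
      have "\<phi> ` (tr S \<inter> B) = \<phi> ` tr S \<inter> \<phi> ` B" using permutes_inj[OF p] by (simp add: image_Int)
      also have "\<phi> ` B = B" using pB[OF B] by (simp add: preserves_def bij_betw_def)
      also have "tr S \<inter> B = S B" using tr_inter[OF id_mem okS B] by simp
      finally show ?thesis using a(2) tr_inter[OF a(1) okS B] by simp
    qed
    \<comment> \<open>After this normalization every \<open>S B\<close> is mapped onto itself, and
      it remains to show that \<psi> is the identity on every orbit.\<close>
    define \<psi> where "\<psi> = inv' a \<circ> \<phi>"
    note ai = inv_mem[OF a(1)]
    have \<psi>S: "\<psi> ` S B = S B" if B: "B \<in> orbits" for B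
      unfolding \<psi>_def image_comp[symmetric] SB[OF B] using inv_apply(1)[OF a(1)] by (simp add: image_image)
    have \<psi>B: "preserves B (\<Z> B) \<psi>" if B: "B \<in> orbits" for B
    proof -
      have "bij_betw \<phi> B B" using pB[OF B] by (simp add: preserves_def)
      moreover have "bij_betw (inv' a) B B"
        using orbits_image[OF B ai] inj_on_subset[OF inj_mem[OF ai]] by (simp add: bij_betw_def)
      ultimately have "bij_betw \<psi> B B" unfolding \<psi>_def by (rule bij_betw_trans)
      moreover have "\<psi> ` Y \<in> \<Z> B" if "Y \<in> \<Z> B" for Y
        using pB[OF B] Z[OF B] ai that unfolding \<psi>_def preserves_def chain_family_def image_comp[symmetric] by blast
      ultimately show ?thesis by (simp add: preserves_def)
    qed
    have good_trivial: "\<forall>y\<in>B. \<psi> y = y" if B: "B \<in> orbits" "B \<notin> E" for B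
    proof -
      obtain x where x: "x \<in> B" "S B = {x}" using good B by blast
      obtain \<tau> where t: "\<tau> \<in> A" "\<And>y. y \<in> B \<Longrightarrow> \<psi> y = \<tau> y"
        using good[of B] B \<psi>B[OF B(1)] unfolding rigid_family_def by blast
      have "\<tau> x = x" using \<psi>S[OF B(1)] x t by auto
      then show ?thesis using trivial_on_orbit[OF B(1) t(1) x(1)] t(2) by simp
    qed
    \<comment> \<open>On an orbit in \<open>E\<close> the breaking pair is applied with
      \<open>c\<close> both as the symmetry and as the group element; the alternative of a full
      cycle is impossible because it would move \<open>S B\<close>.\<close>
    have A_trivial: "\<forall>y\<in>B. c y = y" if c: "c \<in> A" and B: "B \<in> orbits" and cS: "c ` S B = S B" for c B
    proof (cases "B \<in> E")
      case False
      then obtain x where x: "x \<in> B" "S B = {x}" using good B by blast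
      then have "c x = x" using cS by simp
      then show ?thesis using trivial_on_orbit[OF B c x(1)] by simp
    next
      case True
      have "preserves B (\<Z> B) c"
        using orbits_image[OF B c] inj_on_subset[OF inj_mem[OF c]] Z[OF B] c
        by (simp add: preserves_def bij_betw_def chain_family_def)
      then have "(\<forall>y\<in>B. c y = y) \<or> cycle_on c B"
        using bad[OF True] cS c unfolding breaking_pair_def by blast
      then show ?thesis using cycle_on_image[of c B "S B"] S[OF B] cS c by blast
    qed
    have bad_trivial: "\<forall>y\<in>B. \<psi> y = y" if B: "B \<in> E" for B
    proof -
      have Bo: "B \<in> orbits" using S'[OF B] by blast
      let ?s = "S(B := S' B)"
      have "id ` tr ?s \<in> \<G>" unfolding \<G>_def using id_mem B by blast
      then have "\<phi> ` tr ?s \<in> \<G>" using pG by simp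
      then obtain c0 B' where c0: "c0 \<in> A" "B' \<in> E" "\<phi> ` tr ?s = c0 ` tr (S(B' := S' B'))"
        unfolding \<G>_def
      proof (elim UnE CollectE exE conjE)
        fix \<sigma> assume x: "\<phi> ` tr ?s = \<sigma> ` tr S" "\<sigma> \<in> A"
        then have "card (tr ?s) = card (tr S)" using pcard card_image_mem by metis
        then show thesis using card_S'[OF B] w_def by simp
      qed
      define c where "c = inv' a \<circ> c0"
      have c: "c \<in> A" unfolding c_def using ai c0(1) by (rule comp_mem)
      have eq: "\<psi> ` tr ?s = c ` tr (S(B' := S' B'))"
        unfolding \<psi>_def c_def image_comp[symmetric] c0(3) ..
      have inter: "\<psi> ` ?s C = c ` (S(B' := S' B')) C" if C: "C \<in> orbits" for C
      proof -
        have "inj \<psi>" unfolding \<psi>_def using inj_mem[OF ai] permutes_inj[OF p] by (rule inj_compose)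
        then have "\<psi> ` (tr ?s \<inter> C) = \<psi> ` tr ?s \<inter> \<psi> ` C" by (rule image_Int)
        also have "\<psi> ` C = C" using \<psi>B[OF C] by (simp add: preserves_def bij_betw_def)
        also have "tr ?s \<inter> C = ?s C" using tr_inter[OF id_mem okS'[OF B] C] by simp
        finally have "\<psi> ` ?s C = \<psi> ` tr ?s \<inter> C" .
        also have "\<dots> = c ` (S(B' := S' B')) C" unfolding eq by (rule tr_inter[OF c okS'[OF c0(2)] C])
        finally show ?thesis .
      qed
      \<comment> \<open>Otherwise the images of \<open>S' B\<close> and \<open>S B\<close> would
        coincide, although their sizes differ by one.\<close>
      have "B' = B"
      proof (rule ccontr)
        assume "B' \<noteq> B"
        then have e: "\<psi> ` S' B = c ` S B" using inter[OF Bo] by simp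
        have "finite (S' B)" using S'[OF B] finite_orbits(2) finite_subset by blast
        then have "card (\<psi> ` S' B) \<le> card (S' B)" by (rule card_image_le)
        then show False using e card_image_mem[OF c] S'[OF B] by simp
      qed
      then have "\<psi> ` S' B = c ` S' B" using inter[OF Bo] by simp
      then have "(\<forall>y\<in>B. \<psi> y = y) \<or> cycle_on c B"
        using bad[OF B] \<psi>B[OF Bo] \<psi>S[OF Bo] c unfolding breaking_pair_def by blast
      \<comment> \<open>On each other orbit \<open>c\<close> keeps \<open>S\<close>, so it is
        trivial there. If \<open>c\<close> were a full cycle of \<open>B\<close>, it would be a
        cyclic factor.\<close>
      moreover have "c x = x" if x: "x \<in> X - B" for x
      proof -
        consider "x \<in> fixed_points" | C where "C \<in> orbits" "x \<in> C" using x points_partition by blast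
        then show ?thesis
        proof cases
          case 1
          then show ?thesis using c by (simp add: fixed_points_def)
        next
          case 2
          then have "C \<noteq> B" using x by blast
          then have "c ` S C = S C" using inter[OF 2(1)] \<open>B' = B\<close> \<psi>S[OF 2(1)] by simp
          then show ?thesis using A_trivial[OF c 2(1)] 2(2) by blast
        qed
      qed
      ultimately show ?thesis using no_factor[of c B] c Bo unfolding cyclic_factor_def by blast
    qed
    have "\<phi> = a"
    proof (rule agree_everywhere[OF p a(1) f])
      fix B y assume B: "B \<in> orbits" and y: "y \<in> B"
      then have "\<psi> y = y" using good_trivial bad_trivial by blast
      then have "a (\<psi> y) = a y" by simp
      then show "\<phi> y = a y" unfolding \<psi>_def comp_apply inv_apply(2)[OF a(1)] .
    qed
    then show "\<phi> \<in> A" using a by simp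
  qed (rule Z)
qed

text \<open>Outside the scope of \<open>invariant_family_several\<close> there is at most one
  nontrivial orbit. A rigid one needs no extra sets, a cyclic one without a rigid family gives a
  cyclic factor, and a Klein one leads to \<open>klein_like\<close> unless there are fixed
  points.\<close>

theorem invariant_family_exists:
  "(\<exists>b B. cyclic_factor b B) \<or> klein_like \<or>
   (\<exists>F\<subseteq>Pow X. (\<forall>\<sigma>\<in>A. \<forall>Y\<in>F. \<sigma> ` Y \<in> F) \<and> (\<forall>\<phi>. \<phi> permutes X \<longrightarrow> (\<forall>Y\<in>F. \<phi> ` Y \<in> F) \<longrightarrow> \<phi> \<in> A))"
proof (cases "\<exists>b B. cyclic_factor b B")
  case False
  define alt where "alt B \<Z> S S' \<longleftrightarrow> breaking_pair B \<Z> S S' \<and> ((\<exists>b\<in>A. cycle_on b B) \<or>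
       card B = 4 \<and> card S = 3 \<and> (\<forall>\<sigma>\<in>A. \<forall>y\<in>B. \<sigma> (\<sigma> y) = y))" for B \<Z> S S'
  have "\<forall>B\<in>orbits. \<exists>\<Z>. chain_family B \<Z> \<and> (rigid_family B \<Z> \<or> (\<exists>S S'. alt B \<Z> S S'))"
  proof
    fix B assume "B \<in> orbits"
    then obtain p where "p \<in> X" "B = orbit p" "card (orbit p) \<ge> 2" by (auto elim: orbitsE)
    then show "\<exists>\<Z>. chain_family B \<Z> \<and> (rigid_family B \<Z> \<or> (\<exists>S S'. alt B \<Z> S S'))"
      using orbit_family[of p] unfolding alt_def by blast
  qed
  from bchoice[OF this] obtain \<Z> where
    Z': "\<forall>B\<in>orbits. chain_family B (\<Z> B) \<and> (rigid_family B (\<Z> B) \<or> (\<exists>S S'. alt B (\<Z> B) S S'))" ..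
  note Z = bspec[OF Z']
  define E where "E = {B \<in> orbits. \<not> rigid_family B (\<Z> B)}"
  have "\<forall>B\<in>E. \<exists>SS. alt B (\<Z> B) (fst SS) (snd SS)" using Z by (fastforce simp: E_def)
  from bchoice[OF this] obtain SS where SS': "\<forall>B\<in>E. alt B (\<Z> B) (fst (SS B)) (snd (SS B))" ..
  note SS = bspec[OF SS']
  define S where "S B = (if B \<in> E then fst (SS B) else {SOME x. x \<in> B})" for B
  have good: "rigid_family B (\<Z> B) \<and> (\<exists>x\<in>B. S B = {x})" if "B \<in> orbits - E" for B
    using that orbits_nonempty some_in_eq by (auto simp: S_def E_def)
  have bad: "B \<in> orbits \<and> breaking_pair B (\<Z> B) (S B) (snd (SS B))" if "B \<in> E" for B
    using that SS[OF that] by (simp add: S_def E_def alt_def)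
  have main: "\<exists>F\<subseteq>Pow X. (\<forall>\<sigma>\<in>A. \<forall>Y\<in>F. \<sigma> ` Y \<in> F) \<and> (\<forall>\<phi>. \<phi> permutes X \<longrightarrow> (\<forall>Y\<in>F. \<phi> ` Y \<in> F) \<longrightarrow> \<phi> \<in> A)"
    if sev: "(\<exists>B1\<in>orbits. \<exists>B2\<in>orbits. B1 \<noteq> B2) \<or>
      fixed_points \<noteq> {} \<and> (\<exists>B\<in>E. orbits = {B} \<and> card (S B) = 3)"
  proof (rule invariant_family_several[of \<Z> E S "\<lambda>B. snd (SS B)"])
    show "chain_family B (\<Z> B)" if "B \<in> orbits" for B using Z[OF that] ..
    show "\<not> cyclic_factor b B" for b B using False by blast
  qed (fact good bad sev)+
  consider (several) "\<exists>B1\<in>orbits. \<exists>B2\<in>orbits. B1 \<noteq> B2" | (good) "E = {}" "\<And>B B'. B \<in> orbits \<Longrightarrow> B' \<in> orbits \<Longrightarrow> B = B'"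
    | (bad) B where "B \<in> E" "orbits = {B}"
    unfolding E_def by blast
  then show ?thesis
  proof cases
    case several
    then show ?thesis using main by simp
  next
    case g: good
    then show ?thesis using invariant_family_single[of \<Z>] Z by (auto simp: E_def)
  next
    case b: (bad B)
    \<comment> \<open>All points outside the only nontrivial orbit are fixed, so a full cycle of it
      would be a cyclic factor.\<close>
    have ncyc: "\<not> (\<exists>b\<in>A. cycle_on b B)"
    proof
      assume "\<exists>b\<in>A. cycle_on b B"
      then obtain c where c: "c \<in> A" "cycle_on c B" by blast
      have "c x = x" if "x \<in> X - B" for x
        using that points_partition b(2) c(1) by (auto simp: fixed_points_def)
      then show False using False c b(2) unfolding cyclic_factor_def by blast
    qed
    then have K: "card B = 4" "card (S B) = 3" "\<And>\<sigma> y. \<sigma> \<in> A \<Longrightarrow> y \<in> B \<Longrightarrow> \<sigma> (\<sigma> y) = y"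
      using SS[OF b(1)] b(1) by (auto simp: alt_def S_def)
    show ?thesis
    proof (cases "fixed_points = {}")
      case True
      then have BX: "B = X" using points_partition b(2) by auto
      have "orbit p = X" if "p \<in> X" for p using orbits_as_orbit[of B p] b(2) that BX by simp
      then have klein_like using K(1,3) unfolding klein_like_def BX by blast
      then show ?thesis by blast
    next
      case nonempty: False
      then show ?thesis
        using main b K(2) by simp
    qed
  qed
qed blast

end

section \<open>Recognizing the exceptional groups\<close>

lemma normal_stabilizers_perm_group:
  assumes "perm_group G" "has_normal_stabilizers G"
  shows "normal_stabilizers {1..fst G} (snd G)"
proof
  fix \<sigma> \<tau> i assume "\<sigma> \<in> snd G" "\<tau> \<in> snd G" "\<sigma> i = i"
  then show "\<sigma> (\<tau> i) = \<tau> i" using assms(2) by (simp add: has_normal_stabilizers_def)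
qed (use perm_group_members[OF assms(1)] in auto)

context normal_stabilizers
begin

lemma power_mem: "b \<in> A \<Longrightarrow> b ^^ k \<in> A"
proof (induction k)
  case 0
  show ?case using id_mem by (simp only: funpow.simps(1))
next
  case (Suc k)
  then show ?case using comp_mem by (simp only: funpow.simps(2))
qed

text \<open>The least period of \<open>b\<close> at \<open>p\<close> equals \<open>card B\<close>.
  The exponent \<open>i - 1\<close> adapts the enumeration to the standard cycle, whose points start
  at 1.\<close>

lemma cycle_on_enumeration:
  assumes b: "b \<in> A" and c: "cycle_on b B"
  obtains p where "p \<in> B" "B = range (\<lambda>k. (b ^^ k) p)" "(b ^^ card B) p = p"
    "bij_betw (\<lambda>i. (b ^^ (i - 1)) p) {1..card B} B" "card B \<in> {3, 4, 5}"
proof -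
  obtain p where p: "p \<in> B" "B = range (\<lambda>k. (b ^^ k) p)" and cB: "card B \<in> {3, 4, 5}"
    using c by (auto simp: cycle_on_def)
  have fin: "finite B" using cB by (auto intro: card_ge_0_finite)
  have inj: "inj (b ^^ k)" for k using inj_mem[OF power_mem[OF b]] .
  have period: "(b ^^ (j - i)) p = p" if "i < j" "(b ^^ i) p = (b ^^ j) p" for i j
  proof -
    have "(b ^^ i) ((b ^^ (j - i)) p) = (b ^^ (i + (j - i))) p" by (simp add: funpow_add)
    also have "\<dots> = (b ^^ i) p" using that by simp
    finally show ?thesis using inj[of i] by (simp add: inj_eq)
  qed
  have "\<not> inj (\<lambda>k. (b ^^ k) p)" using fin p(2) range_inj_infinite by metis
  then obtain i j where "i \<noteq> j" "(b ^^ i) p = (b ^^ j) p" by (auto simp: inj_def)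
  then have ex: "\<exists>d. d > 0 \<and> (b ^^ d) p = p"
    using period[of i j] period[of j i] by (metis linorder_neqE_nat zero_less_diff)
  define d where "d = (LEAST d. d > 0 \<and> (b ^^ d) p = p)"
  have d: "d > 0" "(b ^^ d) p = p" using LeastI_ex[OF ex] by (auto simp: d_def)
  have least: "e \<ge> d" if "e > 0" "(b ^^ e) p = p" for e unfolding d_def using that by (intro Least_le) simp
  have injd: "inj_on (\<lambda>k. (b ^^ k) p) {..<d}"
  proof (rule inj_onI)
    fix i j assume ij: "i \<in> {..<d}" "j \<in> {..<d}" "(b ^^ i) p = (b ^^ j) p"
    have "\<not> k < l" if "l < d" "(b ^^ k) p = (b ^^ l) p" for k l
      using least[of "l - k"] period[of k l] that by auto
    from this[of j i] this[of i j] show "i = j" using ij by auto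
  qed
  have B: "B = (\<lambda>k. (b ^^ k) p) ` {..<d}"
  proof (intro equalityI subsetI)
    fix y assume "y \<in> B"
    then obtain k where "y = (b ^^ k) p" using p(2) by blast
    then have "y = (b ^^ (k mod d)) p" using funpow_mod_eq[OF d(2)] by simp
    moreover have "k mod d < d" using d(1) by simp
    ultimately show "y \<in> (\<lambda>k. (b ^^ k) p) ` {..<d}" by blast
  next
    fix y assume "y \<in> (\<lambda>k. (b ^^ k) p) ` {..<d}"
    then show "y \<in> B" using p(2) by blast
  qed
  then have dB: "card B = d" using card_image[OF injd] by simp
  have "bij_betw (\<lambda>k. (b ^^ k) p) {..<d} B" using injd B by (simp add: bij_betw_def)
  moreover have "bij_betw (\<lambda>i. i - 1) {1..d} {..<d}"
    by (rule bij_betw_byWitness[where f' = Suc]) auto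
  ultimately have "bij_betw ((\<lambda>k. (b ^^ k) p) \<circ> (\<lambda>i. i - 1)) {1..d} B" by (rule bij_betw_trans[rotated])
  then have "bij_betw (\<lambda>i. (b ^^ (i - 1)) p) {1..card B} B" by (simp add: comp_def dB)
  then show thesis using that[OF p(1) p(2)] d(2) dB cB by simp
qed

end

lemma cyclic_perm_group_subset:
  assumes G: "perm_group (n, A)" and c: "cyc p \<in> A"
  shows "snd (cyclic_perm_group p) \<subseteq> A"
proof
  fix \<sigma> assume "\<sigma> \<in> snd (cyclic_perm_group p)"
  then have "\<sigma> \<in> generate (sym_group p) {cyc p}" by (simp add: cyclic_perm_group_eq)
  then show "\<sigma> \<in> A"
  proof induction
    case one
    show ?case using perm_group_members(3)[OF G] by (simp only: sym_group_one snd_conv)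
  next
    case (incl h)
    then show ?case using c by simp
  next
    case (inv h)
    then have h: "h = cyc p" by simp
    have "cyc p \<in> carrier (sym_group p)" using cyc_permutes by (simp add: sym_group_carrier)
    then have "inv\<^bsub>sym_group p\<^esub> h = inv' (cyc p)" unfolding h by (rule sym_group_inv_equality)
    then show ?case using perm_group_members(5)[OF G, of "cyc p"] c by simp
  next
    case (eng h1 h2)
    then show ?case using perm_group_members(4)[OF G] by (simp only: sym_group_mult snd_conv)
  qed
qed

text \<open>The second summand consists of the elements that fix \<open>{1..p}\<close> pointwise,
  shifted down by \<open>p\<close>. By \<open>rot\<close>, every element becomes one of these after
  removing a power of the cycle.\<close>

lemma cyclic_normal_form:
  assumes p: "p \<in> {3, 4, 5}" "p \<le> n" and G: "perm_group (n, A)" and c: "cyc p \<in> A"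
    and rot: "\<And>\<sigma>. \<sigma> \<in> A \<Longrightarrow> \<exists>k. \<forall>i\<in>{1..p}. \<sigma> i = (cyc p ^^ k) i"
  shows "(n, A) = cyclic_perm_group p \<or> (\<exists>D. perm_group D \<and> (n, A) = direct_sum (cyclic_perm_group p) D)"
proof -
  note m = perm_group_members[OF G, unfolded fst_conv snd_conv]
  have pow: "cyc p ^^ k \<in> A" for k using cyclic_perm_group_subset[OF G c] cyc_power_mem by blast
  have fstC: "fst (cyclic_perm_group p) = p" by (simp add: cyclic_perm_group_eq)
  show ?thesis
  proof (cases "n = p")
    case True
    have "A \<subseteq> snd (cyclic_perm_group p)"
    proof
      fix \<sigma> assume s: "\<sigma> \<in> A"
      obtain k where k: "\<forall>i\<in>{1..p}. \<sigma> i = (cyc p ^^ k) i" using rot[OF s] by blast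
      have "\<sigma> i = (cyc p ^^ k) i" for i
      proof (cases "i \<in> {1..p}")
        case False
        then have "\<sigma> i = i" using permutes_not_in[OF m(2)[OF s]] True by simp
        moreover have "(cyc p ^^ k) i = i" unfolding cyc_power[OF p(1)] using False by auto
        ultimately show ?thesis by simp
      qed (use k in simp)
      then have "\<sigma> = cyc p ^^ k" by (rule ext)
      then show "\<sigma> \<in> snd (cyclic_perm_group p)" using cyc_power_mem by simp
    qed
    then have "(n, A) = cyclic_perm_group p"
      using cyclic_perm_group_subset[OF G c] True fstC by (intro prod_eqI) auto
    then show ?thesis ..
  next
    case False
    then have pn: "p < n" using p by simp
    define A' where "A' = {\<sigma> \<in> A. \<forall>i\<in>{1..p}. \<sigma> i = i}"
    define sh where "sh \<sigma> i = (if i = 0 then 0 else \<sigma> (i + p) - p)" for \<sigma> :: "nat \<Rightarrow> nat" and i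
    have low: "\<sigma> i = i" if "\<sigma> \<in> A'" "i \<le> p" for \<sigma> i
    proof (cases "i = 0")
      case True
      then show ?thesis using permutes_not_in[OF m(2), of \<sigma> i] that by (simp add: A'_def)
    next
      case False
      then show ?thesis using that by (simp add: A'_def)
    qed
    have high: "\<sigma> i > p" if s: "\<sigma> \<in> A'" and i: "i > p" for \<sigma> i
    proof (rule ccontr)
      assume "\<not> \<sigma> i > p"
      then have "\<sigma> (\<sigma> i) = \<sigma> i" using low[OF s] by simp
      moreover have "inj \<sigma>" using permutes_inj[OF m(2)] s by (simp add: A'_def)
      ultimately have "\<sigma> i = i" by (simp add: inj_eq)
      then show False using \<open>\<not> \<sigma> i > p\<close> i by simp
    qed
    have sh_add: "sh \<sigma> (i - p) + p = \<sigma> i" if "\<sigma> \<in> A'" "i > p" for \<sigma> i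
      using high[OF that] that(2) by (simp add: sh_def)
    have sh_comp: "sh \<sigma> \<circ> sh \<tau> = sh (\<sigma> \<circ> \<tau>)" if s: "\<sigma> \<in> A'" and t: "\<tau> \<in> A'" for \<sigma> \<tau>
    proof
      fix i show "(sh \<sigma> \<circ> sh \<tau>) i = sh (\<sigma> \<circ> \<tau>) i"
        using high[OF t, of "i + p"] by (cases "i = 0") (auto simp: sh_def)
    qed
    have idA': "id \<in> A'" using m(3) by (simp add: A'_def)
    have compA': "\<sigma> \<circ> \<tau> \<in> A'" if "\<sigma> \<in> A'" "\<tau> \<in> A'" for \<sigma> \<tau> using that m(4) by (simp add: A'_def)
    have invA': "inv' \<sigma> \<in> A'" if "\<sigma> \<in> A'" for \<sigma>
    proof -
      have s: "\<sigma> \<in> A" "\<forall>i\<in>{1..p}. \<sigma> i = i" using that by (auto simp: A'_def)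
      have "inv' \<sigma> i = i" if "i \<in> {1..p}" for i
        using permutes_inverses(2)[OF m(2)[OF s(1)], of i] s(2) that by simp
      then show ?thesis using m(5)[OF s(1)] by (simp add: A'_def)
    qed
    have sh_id: "sh id = id" by (auto simp: sh_def fun_eq_iff)
    have sh_inv: "sh \<sigma> \<circ> sh (inv' \<sigma>) = id" "sh (inv' \<sigma>) \<circ> sh \<sigma> = id" if s: "\<sigma> \<in> A'" for \<sigma>
    proof -
      have sp: "\<sigma> permutes {1..n}" using s m(2) by (simp add: A'_def)
      show "sh \<sigma> \<circ> sh (inv' \<sigma>) = id" "sh (inv' \<sigma>) \<circ> sh \<sigma> = id"
        unfolding sh_comp[OF s invA'[OF s]] sh_comp[OF invA'[OF s] s] permutes_inv_o[OF sp] by (rule sh_id)+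
    qed
    define D where "D = (n - p, sh ` A')"
    have D: "perm_group D" unfolding D_def
    proof (rule perm_groupI)
      show "n - p \<ge> 1" using pn by simp
    next
      fix \<tau> assume "\<tau> \<in> sh ` A'"
      then obtain \<sigma> where s: "\<sigma> \<in> A'" "\<tau> = sh \<sigma>" by blast
      have "\<tau> i = i" if "i \<notin> {1..n - p}" for i
      proof (cases "i = 0")
        case True
        then show ?thesis by (simp add: s(2) sh_def)
      next
        case False
        then have "i + p \<notin> {1..n}" using that by auto
        then have "\<sigma> (i + p) = i + p" using s(1) permutes_not_in[OF m(2)] by (simp add: A'_def)
        then show ?thesis using False by (simp add: s(2) sh_def)
      qed
      moreover have "\<exists>!x. \<tau> x = y" for y
      proof (rule ex1I[of _ "sh (inv' \<sigma>) y"])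
        show "\<tau> (sh (inv' \<sigma>) y) = y" using fun_cong[OF sh_inv(1)[OF s(1)], of y] s(2) by simp
        fix x assume "\<tau> x = y"
        then show "x = sh (inv' \<sigma>) y" using fun_cong[OF sh_inv(2)[OF s(1)], of x] s(2) by auto
      qed
      ultimately show "\<tau> permutes {1..n - p}" by (simp add: permutes_def)
    next
      show "id \<in> sh ` A'" using sh_id idA' by (metis imageI)
      show "\<sigma> \<circ> \<tau> \<in> sh ` A'" if st: "\<sigma> \<in> sh ` A'" "\<tau> \<in> sh ` A'" for \<sigma> \<tau>
      proof -
        obtain a b where ab: "a \<in> A'" "\<sigma> = sh a" "b \<in> A'" "\<tau> = sh b" using st by blast
        show ?thesis unfolding ab(2,4) sh_comp[OF ab(1,3)] using compA'[OF ab(1,3)] by (rule imageI)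
      qed
      show "inv' \<sigma> \<in> sh ` A'" if s: "\<sigma> \<in> sh ` A'" for \<sigma>
      proof -
        obtain a where a: "a \<in> A'" "\<sigma> = sh a" using s by blast
        have "inv' \<sigma> = sh (inv' a)" unfolding a(2) using sh_inv[OF a(1)] by (intro inv_unique_comp)
        then show ?thesis using invA'[OF a(1)] by simp
      qed
    qed
    have glue: "(\<lambda>i. if i \<le> p then \<sigma> i else sh \<tau> (i - p) + p) = \<sigma> \<circ> \<tau>"
      if s: "\<sigma> \<in> snd (cyclic_perm_group p)" and t: "\<tau> \<in> A'" for \<sigma> \<tau>
    proof
      fix i
      show "(if i \<le> p then \<sigma> i else sh \<tau> (i - p) + p) = (\<sigma> \<circ> \<tau>) i"
      proof (cases "i \<le> p")
        case True
        then show ?thesis using low[OF t] by simp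
      next
        case False
        then have "\<tau> i \<notin> {1..p}" using high[OF t, of i] by simp
        then have "\<sigma> (\<tau> i) = \<tau> i" using cyclic_perm_group_commute(2)[OF s] by (rule permutes_not_in[rotated])
        then show ?thesis using False sh_add[OF t, of i] by simp
      qed
    qed
    have snd_sum: "snd (direct_sum (cyclic_perm_group p) D) =
      {\<lambda>i. if i \<le> p then \<sigma> i else sh \<tau> (i - p) + p | \<sigma> \<tau>. \<sigma> \<in> snd (cyclic_perm_group p) \<and> \<tau> \<in> A'}"
      unfolding direct_sum_def fstC D_def snd_conv by blast
    have "A = snd (direct_sum (cyclic_perm_group p) D)"
    proof (intro equalityI subsetI)
      fix \<sigma> assume s: "\<sigma> \<in> A"
      obtain k where k: "\<forall>i\<in>{1..p}. \<sigma> i = (cyc p ^^ k) i" using rot[OF s] by blast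
      define \<tau> where "\<tau> = inv' (cyc p ^^ k) \<circ> \<sigma>"
      note cp = permutes_inverses[OF m(2)[OF pow[of k]]]
      have "\<tau> i = i" if "i \<in> {1..p}" for i using k that cp(2) by (simp add: \<tau>_def)
      then have t: "\<tau> \<in> A'" using m(4)[OF m(5)[OF pow[of k]] s] by (simp add: A'_def \<tau>_def)
      have "(cyc p ^^ k) \<circ> \<tau> = \<sigma>" unfolding \<tau>_def fun_eq_iff comp_apply cp(1) by simp
      then show "\<sigma> \<in> snd (direct_sum (cyclic_perm_group p) D)"
        unfolding snd_sum using glue[OF cyc_power_mem[of k p] t] cyc_power_mem[of k p] t
        by (intro CollectI exI[of _ "cyc p ^^ k"] exI[of _ \<tau>]) simp
    next
      fix \<sigma> assume "\<sigma> \<in> snd (direct_sum (cyclic_perm_group p) D)"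
      then obtain a \<tau> where a: "\<sigma> = (\<lambda>i. if i \<le> p then a i else sh \<tau> (i - p) + p)"
        "a \<in> snd (cyclic_perm_group p)" "\<tau> \<in> A'"
        unfolding snd_sum by blast
      have "\<sigma> = a \<circ> \<tau>" unfolding a(1) by (rule glue[OF a(2,3)])
      moreover have "a \<in> A" using cyclic_perm_group_subset[OF G c] a(2) by blast
      ultimately show "\<sigma> \<in> A" using m(4) a(3) by (simp add: A'_def)
    qed
    moreover have "n = fst (direct_sum (cyclic_perm_group p) D)" using pn by (simp add: direct_sum_def fstC D_def)
    ultimately have "(n, A) = direct_sum (cyclic_perm_group p) D" by (intro prod_eqI) auto
    then show ?thesis using D by blast
  qed
qed

lemma perm_group_conjugate:
  assumes G: "perm_group (n, A)" and g: "\<gamma> permutes {1..n}"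
  shows "perm_group (n, (\<lambda>\<sigma>. \<gamma> \<circ> \<sigma> \<circ> inv' \<gamma>) ` A)"
proof (rule perm_groupI)
  note m = perm_group_members[OF G, unfolded fst_conv snd_conv]
  note gi = permutes_inverses[OF g]
  let ?c = "\<lambda>\<sigma>. \<gamma> \<circ> \<sigma> \<circ> inv' \<gamma>"
  show "n \<ge> 1" using m by simp
  show "\<sigma> permutes {1..n}" if "\<sigma> \<in> ?c ` A" for \<sigma>
    using that m(2) g permutes_inv[OF g] by (auto intro!: permutes_compose)
  have "?c id = id" using gi by (simp add: fun_eq_iff)
  then show "id \<in> ?c ` A" using m(3) by (metis imageI)
  show "\<sigma> \<circ> \<tau> \<in> ?c ` A" if st: "\<sigma> \<in> ?c ` A" "\<tau> \<in> ?c ` A" for \<sigma> \<tau>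
  proof -
    obtain a b where ab: "a \<in> A" "\<sigma> = ?c a" "b \<in> A" "\<tau> = ?c b" using st by blast
    have "?c a \<circ> ?c b = ?c (a \<circ> b)" using gi by (simp add: fun_eq_iff)
    then have "\<sigma> \<circ> \<tau> = ?c (a \<circ> b)" unfolding ab(2,4) .
    then show ?thesis using m(4)[OF ab(1,3)] by (rule image_eqI)
  qed
  show "inv' \<sigma> \<in> ?c ` A" if s: "\<sigma> \<in> ?c ` A" for \<sigma>
  proof -
    obtain a where a: "a \<in> A" "\<sigma> = ?c a" using s by blast
    note ai = permutes_inverses[OF m(2)[OF a(1)]]
    have "inv' (?c a) = ?c (inv' a)"
      by (rule inv_unique_comp) (simp_all add: fun_eq_iff gi ai)
    then have "inv' \<sigma> = ?c (inv' a)" unfolding a(2) .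
    then show ?thesis using m(5)[OF a(1)] by (rule image_eqI)
  qed
qed

text \<open>By regularity an element of \<open>A\<close> acts on \<open>B\<close> as the power of
  \<open>b\<close> that has the same value at \<open>q\<close>. Numbering \<open>B\<close> along
  \<open>b\<close> and the remaining points arbitrarily turns \<open>b\<close> into the standard
  cycle and brings \<open>A\<close> into the scope of \<open>cyclic_normal_form\<close>.\<close>

lemma exceptional_if_cyclic_factor:
  assumes G: "perm_group (n, A)" and N: "has_normal_stabilizers (n, A)"
    and f: "normal_stabilizers.cyclic_factor {1..n} A b B"
  shows "exceptional (n, A)"
proof -
  interpret N: normal_stabilizers "{1..n}" A
    by (rule normal_stabilizers_perm_group[OF G N, unfolded fst_conv snd_conv])
  note m = perm_group_members[OF G, unfolded fst_conv snd_conv]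
  have b: "b \<in> A" and B: "B \<in> N.orbits" and cy: "N.cycle_on b B" and outside: "\<And>x. x \<in> {1..n} - B \<Longrightarrow> b x = x"
    using f unfolding N.cyclic_factor_def by blast+
  obtain q where q: "q \<in> B" "B = range (\<lambda>k. (b ^^ k) q)" "(b ^^ card B) q = q"
    "bij_betw (\<lambda>i. (b ^^ (i - 1)) q) {1..card B} B" "card B \<in> {3, 4, 5}"
    using N.cycle_on_enumeration[OF b cy] by blast
  define p where "p = card B"
  have p: "p \<in> {3, 4, 5}" using q(5) by (simp add: p_def)
  have BX: "B \<subseteq> {1..n}" using N.orbits_subset[OF B] .
  then have pn: "p \<le> n" unfolding p_def using card_mono[of "{1..n}" B] by simp
  have "card ({1..n} - B) = card {p + 1..n}" using BX by (simp add: card_Diff_subset finite_subset p_def)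
  then obtain h where h: "bij_betw h {p + 1..n} ({1..n} - B)"
    by (metis finite_Diff finite_atLeastAtMost finite_same_card_bij)
  define \<gamma> where "\<gamma> i = (if i \<in> {1..p} then (b ^^ (i - 1)) q else if i \<in> {p + 1..n} then h i else i)" for i
  have "bij_betw \<gamma> ({1..p} \<union> {p + 1..n}) (B \<union> ({1..n} - B))"
  proof (rule bij_betw_combine)
    show "bij_betw \<gamma> {1..p} B" using q(4) unfolding p_def[symmetric]
      by (rule bij_betw_cong[THEN iffD1, rotated]) (simp add: \<gamma>_def)
    show "bij_betw \<gamma> {p + 1..n} ({1..n} - B)" using h
      by (rule bij_betw_cong[THEN iffD1, rotated]) (auto simp: \<gamma>_def)
  qed blast
  moreover have "{1..p} \<union> {p + 1..n} = {1..n}" "B \<union> ({1..n} - B) = {1..n}" using pn BX by auto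
  ultimately have g: "\<gamma> permutes {1..n}" by (intro bij_imp_permutes) (auto simp: \<gamma>_def)
  note gi = permutes_inverses[OF g]
  have gB: "\<gamma> i \<in> B" if "i \<in> {1..p}" for i unfolding \<gamma>_def using that q(2) by auto
  have conj: "inv' \<gamma> \<circ> b \<circ> \<gamma> = cyc p"
  proof
    fix i
    have "b (\<gamma> i) = \<gamma> (cyc p i)"
    proof -
      consider "i \<in> {1..p}" "i < p" | "i = p" | "i \<in> {p + 1..n}" | "i \<notin> {1..n}" "i \<notin> {1..p}"
        using pn by fastforce
      then show ?thesis
      proof cases
        case 1
        then have "cyc p i = Suc i" by (simp add: cyc_apply[OF p])
        moreover have "b ((b ^^ (i - 1)) q) = (b ^^ i) q" using 1 by (cases i) auto
        ultimately show ?thesis using 1 by (simp add: \<gamma>_def)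
      next
        case 2
        then have "cyc p i = 1" by (simp add: cyc_apply[OF p])
        moreover have "b ((b ^^ (p - 1)) q) = (b ^^ p) q" using p by (cases p) auto
        moreover have "1 \<le> p" using p by auto
        ultimately show ?thesis using 2 q(3) by (simp add: \<gamma>_def p_def[symmetric])
      next
        case 3
        then have "\<gamma> i \<in> {1..n} - B" using h by (auto simp: \<gamma>_def bij_betw_def)
        then have "b (\<gamma> i) = \<gamma> i" by (rule outside)
        moreover have "cyc p i = i" using 3 by (simp add: cyc_apply[OF p])
        ultimately show ?thesis by simp
      next
        case 4
        then have "\<gamma> i = i" "b i = i" using permutes_not_in[OF g] permutes_not_in[OF m(2)[OF b]] by auto
        moreover have "cyc p i = i" using 4(2) p by (auto simp: cyc_apply[OF p])
        ultimately show ?thesis by simp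
      qed
    qed
    then show "(inv' \<gamma> \<circ> b \<circ> \<gamma>) i = cyc p i" using gi by simp
  qed
  have conj_pow: "inv' \<gamma> \<circ> (b ^^ k) \<circ> \<gamma> = cyc p ^^ k" for k
  proof (induction k)
    case 0
    show ?case using gi by (simp add: fun_eq_iff)
  next
    case (Suc k)
    have "inv' \<gamma> \<circ> (b ^^ Suc k) \<circ> \<gamma> = (inv' \<gamma> \<circ> b \<circ> \<gamma>) \<circ> (inv' \<gamma> \<circ> (b ^^ k) \<circ> \<gamma>)"
      using gi by (simp add: fun_eq_iff)
    then show ?case unfolding Suc conj by (simp only: funpow.simps(2))
  qed
  define \<pi> where "\<pi> = inv' \<gamma>"
  have pi: "\<pi> permutes {1..n}" "inv' \<pi> = \<gamma>"
    using permutes_inv[OF g] permutes_inv_inv[OF g] by (auto simp: \<pi>_def)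
  define A1 where "A1 = (\<lambda>\<sigma>. \<pi> \<circ> \<sigma> \<circ> inv' \<pi>) ` A"
  have iso: "perm_iso (n, A) (n, A1)" unfolding perm_iso_def A1_def using pi(1) by auto
  have "(n, A1) = cyclic_perm_group p \<or> (\<exists>D. perm_group D \<and> (n, A1) = direct_sum (cyclic_perm_group p) D)"
  proof (rule cyclic_normal_form[OF p pn])
    show "perm_group (n, A1)" unfolding A1_def by (rule perm_group_conjugate[OF G pi(1)])
    show "cyc p \<in> A1" unfolding A1_def pi(2) conj[symmetric] \<pi>_def[symmetric] using b by (rule imageI)
    fix \<sigma> assume "\<sigma> \<in> A1"
    then obtain a where a: "a \<in> A" "\<sigma> = \<pi> \<circ> a \<circ> \<gamma>" unfolding A1_def pi(2) by blast
    have Bq: "B = N.orbit q" using N.orbits_as_orbit[OF B q(1)] .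
    have "a q \<in> B" using N.orbit_closed[OF a(1)] q(1) Bq by simp
    then obtain k where k: "a q = (b ^^ k) q" using q(2) by blast
    have "\<sigma> i = (cyc p ^^ k) i" if i: "i \<in> {1..p}" for i
    proof -
      have "a (\<gamma> i) = (b ^^ k) (\<gamma> i)"
        using N.agree_on_orbit[OF a(1) N.power_mem[OF b] k] gB[OF i] Bq by simp
      then show ?thesis unfolding conj_pow[symmetric] a(2) \<pi>_def by simp
    qed
    then show "\<exists>k. \<forall>i\<in>{1..p}. \<sigma> i = (cyc p ^^ k) i" by blast
  qed
  then show ?thesis unfolding exceptional_def using p iso by metis
qed

text \<open>An element with a fixed point is the identity, so all others are involutions without
  fixed points and lie in \<open>K4\<close>. Transitivity gives equality, since an element of
  \<open>K4\<close> is determined by its value at 1.\<close>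

lemma K4_if_klein_like:
  assumes G: "perm_group (n, A)" and N: "has_normal_stabilizers (n, A)"
    and k: "normal_stabilizers.klein_like {1..n} A"
  shows "(n, A) = K4"
proof -
  interpret N: normal_stabilizers "{1..n}" A
    by (rule normal_stabilizers_perm_group[OF G N, unfolded fst_conv snd_conv])
  note m = perm_group_members[OF G, unfolded fst_conv snd_conv]
  have card: "card {1..n} = 4" and orb: "\<And>p. p \<in> {1..n} \<Longrightarrow> N.orbit p = {1..n}"
    and inv: "\<And>\<sigma> y. \<sigma> \<in> A \<Longrightarrow> y \<in> {1..n} \<Longrightarrow> \<sigma> (\<sigma> y) = y"
    using k unfolding N.klein_like_def by blast+
  have n: "n = 4" using card by simp
  have fp: "\<sigma> = id" if s: "\<sigma> \<in> A" and y: "y \<in> {1..n}" "\<sigma> y = y" for \<sigma> y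
  proof
    fix x
    show "\<sigma> x = id x"
    proof (cases "x \<in> {1..n}")
      case True
      then show ?thesis using N.agree_on_orbit[OF s N.id_mem, of y x] orb[OF y(1)] y(2) by simp
    next
      case False
      then show ?thesis using permutes_not_in[OF m(2)[OF s]] by simp
    qed
  qed
  have sub: "A \<subseteq> snd K4"
  proof
    fix \<sigma> assume s: "\<sigma> \<in> A"
    show "\<sigma> \<in> snd K4"
      by (rule K4_if_involution) (use m(2)[OF s] inv[OF s] fp[OF s] n in auto)
  qed
  have "snd K4 \<subseteq> A"
  proof
    fix \<tau> assume t: "\<tau> \<in> snd K4"
    then have tp: "\<tau> permutes {1..4}" by (simp add: K4_mem_iff)
    then have "\<tau> 1 \<in> {1..4}" using permutes_in_image[OF tp, of 1] by simp
    then have "\<tau> 1 \<in> N.orbit 1" using orb[of 1] n by simp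
    then obtain \<sigma> where s: "\<sigma> \<in> A" "\<sigma> 1 = \<tau> 1" by (auto simp: N.orbit_def)
    have "\<sigma> \<in> snd K4" using sub s by blast
    then have "\<sigma> i = \<tau> i" if "i \<in> {1, 2, 3, 4}" for i
      using t s(2) that unfolding K4_mem_iff by (elim conjE disjE insertE emptyE) simp_all
    moreover have "\<sigma> i = \<tau> i" if "i \<notin> {1, 2, 3, 4}" for i
      using that permutes_not_in[OF tp] permutes_not_in[OF m(2)[OF s(1)]] n unfolding atLeastAtMost_1_4 by simp
    ultimately have "\<sigma> = \<tau>" by blast
    then show "\<tau> \<in> A" using s by simp
  qed
  then show ?thesis using sub n by (intro prod_eqI) (auto simp: K4_def)
qed

text \<open>The iterated direct sum places its summands on consecutive intervals; passing from
  \<open>C\<close> to a conjugate \<open>B\<close> frees the summands from this arrangement.\<close>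

theorem theorem4:
  fixes A B C :: perm_grp
  assumes "perm_group A"
    and "sum_of_regular C" and "perm_iso B C"
    and "contained_in A B"
  shows "(\<not> exceptional A \<longrightarrow> A \<in> BGR 2) \<and>
    (exceptional A \<longrightarrow> (\<forall>k\<ge>2. A \<notin> BGR k) \<or> (perm_iso A K4 \<and> A \<in> BGR 3))"
proof (intro conjI impI)
  assume ne: "\<not> exceptional A"
  obtain n S where A: "A = (n, S)" by (cases A)
  have "has_normal_stabilizers B"
    using has_normal_stabilizers_perm_iso[OF assms(3)] sum_of_regular_normal_stabilizers[OF assms(2)] by blast
  \<comment> \<open>The condition is universal in the group elements, so it passes from
    \<open>B\<close> to the subgroup.\<close>
  then have N: "has_normal_stabilizers (n, S)"
    using assms(4) unfolding A has_normal_stabilizers_def contained_in_def by (auto simp: subset_iff)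
  have G: "perm_group (n, S)" using assms(1) A by simp
  interpret N: normal_stabilizers "{1..n}" S
    by (rule normal_stabilizers_perm_group[OF G N, unfolded fst_conv snd_conv])
  have "\<not> N.cyclic_factor b B" for b B using exceptional_if_cyclic_factor[OF G N] ne A by blast
  moreover have "\<not> N.klein_like"
  proof
    assume N.klein_like
    then have "A = K4" using K4_if_klein_like[OF G N] A by simp
    moreover have "perm_iso K4 K4" unfolding perm_iso_def by (intro conjI exI[of _ id]) (simp_all add: permutes_id)
    ultimately show False using ne by (simp add: exceptional_def)
  qed
  ultimately obtain F where F: "F \<subseteq> Pow {1..n}" "\<And>\<sigma> Y. \<sigma> \<in> S \<Longrightarrow> Y \<in> F \<Longrightarrow> \<sigma> ` Y \<in> F"
    "\<And>\<phi>. \<phi> permutes {1..n} \<Longrightarrow> (\<And>Y. Y \<in> F \<Longrightarrow> \<phi> ` Y \<in> F) \<Longrightarrow> \<phi> \<in> S"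
    using N.invariant_family_exists by metis
  show "A \<in> BGR 2" by (rule BGR_two_family[OF assms(1), of F]) (use F A in auto)
qed (rule exceptional_cases)

end
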